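(* The Lagrangian Grassmannian $\mathcal{LG}(n,2n)\subset\mathbb{P}(V_{\omega})$ in its Plücker embedding is not $h$-defective for $h\leq\left\lfloor\frac{n+1}{2}\right\rfloor$. Furthermore, the Spinor variety $\mathcal{S}_n\subset\mathbb{P}(\bigwedge^nV_{+})$ in its Plücker embedding is not $h$-defective for $h\leq\left\lfloor\frac{n}{2}\right\rfloor$. Finally, the Spinor variety $\mathcal{S}_n\subset\mathbb{P}(\Delta)$ in its Spinor embedding is not $h$-defective for $h\leq\left\lfloor\frac{n+2}{4}\right\rfloor$.
   Context: Everything is over $\mathbb{C}$. $V$ is a complex vector space of dimension $2n$, and $\mathcal{G}(n,V)\subset\mathbb{P}(\bigwedge^nV)$ is the Grassmannian of $n$-dimensional subspaces of $V$ in its Plücker embedding. Lagrangian Grassmannian: for a non-degenerate symplectic form $\omega$ on $V$, $\mathcal{LG}(n,2n)\subset\mathcal{G}(n,V)$ parametrizes the $n$-dimensional $\omega$-isotropic (Lagrangian) subspaces; it has dimension $\frac{n(n+1)}{2}$. $\mathbb{P}(V_{\omega})=\mathbb{P}(V_{\omega_n})\subseteq\mathbb{P}(\bigwedge^nV)$ is its linear span. Spinor variety: for a non-degenerate quadratic form $Q$ on $V$, the variety of $n$-dimensional $Q$-isotropic subspaces of $V$ has two isomorphic connected components; $\mathcal{S}_n$ denotes either one of them, of dimension $\frac{n(n-1)}{2}$. $\mathbb{P}(\bigwedge^nV_{+})\subseteq\mathbb{P}(\bigwedge^nV)$ is the linear span of $\mathcal{S}_n$ in the Plücker embedding of $\mathcal{G}(n,V)$.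 The Spinor embedding $\mathcal{S}_n\subset\mathbb{P}(\Delta)=\mathbb{P}^{2^{n-1}-1}$ is the minimal homogeneous embedding, in the projectivized half-spin representation; in the affine chart where the points of $\mathcal{S}_n$ are represented by $n\times n$ skew-symmetric matrices $B$ it is given by $B\mapsto(1,\mathrm{pf}_{2j}(B))$, all the $2j\times 2j$ principal Pfaffians of $B$, for $1\leq j\leq\lfloor n/2\rfloor$. Secant varieties: for an irreducible non-degenerate variety $X\subset\mathbb{P}^N$ of dimension $m$ and a positive integer $h$, the $h$-secant variety $\mathbb{S}ec_h(X)\subset\mathbb{P}^N$ is the Zariski closure of the union of all linear spaces spanned by collections of $h$ points of $X$. $X$ is $h$-defective if $\dim\mathbb{S}ec_h(X)<\min\{mh+h-1,N\}$. *)

theory Defs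
  imports
    "HOL-Library.Function_Algebras"
    "HOL-Library.Extended_Nat"
    "HOL-Analysis.Analysis"
    "Jordan_Normal_Form.Determinant"
begin

text \<open>The ambient vector spaces of all projective spaces are linear subspaces of a coordinate
  space of functions \<open>'i \<Rightarrow> complex\<close>.\<close>

abbreviation fscale :: "complex \<Rightarrow> ('i \<Rightarrow> complex) \<Rightarrow> 'i \<Rightarrow> complex"
  where "fscale c x \<equiv> (\<lambda>i. c * x i)"

global_interpretation fn: Vector_Spaces.vector_space fscale
  by unfold_locales (auto simp: fun_eq_iff algebra_simps)

inductive homogeneous_poly :: "nat \<Rightarrow> (('i \<Rightarrow> complex) \<Rightarrow> complex) \<Rightarrow> bool" where
  const: "homogeneous_poly 0 (\<lambda>x. c)"
| coord: "homogeneous_poly 1 (\<lambda>x. x i)"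
| add: "homogeneous_poly d f \<Longrightarrow> homogeneous_poly d g \<Longrightarrow> homogeneous_poly d (\<lambda>x. f x + g x)"
| mult: "homogeneous_poly d f \<Longrightarrow> homogeneous_poly e g \<Longrightarrow> homogeneous_poly (d + e) (\<lambda>x. f x * g x)"

definition proj_space :: "('i \<Rightarrow> complex) set \<Rightarrow> ('i \<Rightarrow> complex) set set" where
  "proj_space E = {L. fn.subspace L \<and> fn.dim L = 1 \<and> L \<subseteq> E}"

text \<open>\<open>E\<close> is always a finite-dimensional subspace, so that its linear forms are spanned by the
  coordinate functions even if the index type is infinite. The non-vanishing loci are closed under
  finite intersections, so the open sets generated below are exactly their unions, i.e. the
  complements of zero loci of families of homogeneous polynomials.\<close>

definition nonvanishing_locus ::
  "('i \<Rightarrow> complex) set \<Rightarrow> (('i \<Rightarrow> complex) \<Rightarrow> complex) \<Rightarrow> ('i \<Rightarrow> complex) set set" where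
  "nonvanishing_locus E f = {L \<in> proj_space E. \<exists>x\<in>L. f x \<noteq> 0}"

definition zariski :: "('i \<Rightarrow> complex) set \<Rightarrow> ('i \<Rightarrow> complex) set topology" where
  "zariski E = topology_generated_by {nonvanishing_locus E f | d f. homogeneous_poly d f}"

definition irreducible_in :: "'a topology \<Rightarrow> 'a set \<Rightarrow> bool" where
  "irreducible_in T Z \<longleftrightarrow> Z \<subseteq> topspace T \<and> Z \<noteq> {} \<and>
     (\<forall>A B. closedin T A \<longrightarrow> closedin T B \<longrightarrow> Z \<subseteq> A \<union> B \<longrightarrow> Z \<subseteq> A \<or> Z \<subseteq> B)"

text \<open>The empty space, for which this yields \<open>0\<close>, does not occur.\<close>

definition krull_dim :: "'a topology \<Rightarrow> enat" where
  "krull_dim T = Sup {enat k | k. \<exists>Z :: nat \<Rightarrow> 'a set.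
     (\<forall>i\<le>k. closedin T (Z i) \<and> irreducible_in T (Z i)) \<and> (\<forall>i<k. Z i \<subset> Z (Suc i))}"

definition variety_dim :: "('i \<Rightarrow> complex) set \<Rightarrow> ('i \<Rightarrow> complex) set set \<Rightarrow> enat" where
  "variety_dim E X = krull_dim (subtopology (zariski E) X)"

text \<open>The linear subspace of the ambient vector space whose projectivization is the linear span
  of a set of points.\<close>

definition linear_span :: "('i \<Rightarrow> complex) set set \<Rightarrow> ('i \<Rightarrow> complex) set" where
  "linear_span X = fn.span (\<Union>X)"

text \<open>Collections of \<open>h\<close> points are families, so points may be repeated. For infinite \<open>X\<close> the
  closure is the same as with distinct points, and for a single point it is that point.\<close>

definition secant_variety ::
  "('i \<Rightarrow> complex) set \<Rightarrow> nat \<Rightarrow> ('i \<Rightarrow> complex) set set \<Rightarrow> ('i \<Rightarrow> complex) set set" where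
  "secant_variety E h X =
     zariski E closure_of (\<Union>p\<in>{..<h} \<rightarrow> X. proj_space (linear_span (p ` {..<h})))"

text \<open>The ambient projective space is that of \<open>E\<close>, of dimension \<open>N = dim E - 1\<close>.\<close>

definition h_defective :: "('i \<Rightarrow> complex) set \<Rightarrow> nat \<Rightarrow> ('i \<Rightarrow> complex) set set \<Rightarrow> bool" where
  "h_defective E h X \<longleftrightarrow>
     variety_dim E (secant_variety E h X) <
       min (variety_dim E X * enat h + enat h - 1) (enat (fn.dim E - 1))"

text \<open>The exterior power \<open>\<And>\<^sup>nV\<close> of a finite-dimensional complex vector space \<open>V\<close> is realised as
  the space of alternating \<open>n\<close>-forms on the dual of \<open>V\<close>, with
  \<open>v\<^sub>0 \<and> \<dots> \<and> v\<^sub>n\<^sub>-\<^sub>1\<close> being the form \<open>(\<phi>\<^sub>0, \<dots>, \<phi>\<^sub>n\<^sub>-\<^sub>1) \<mapsto> det (\<phi>\<^sub>i v\<^sub>j)\<close>. A form is extended by \<open>0\<close> to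
  those arguments that are not tuples of linear functionals; only the first \<open>n\<close> entries of
  an argument matter. For an \<open>n\<close>-dimensional \<open>W\<close>, \<open>exterior_power s n W\<close> is a
  line in \<open>exterior_power s n UNIV\<close>: the image of \<open>W\<close> under the Pluecker embedding.\<close>

definition wedge ::
  "(complex \<Rightarrow> 'v :: ab_group_add \<Rightarrow> 'v) \<Rightarrow> nat \<Rightarrow> (nat \<Rightarrow> 'v) \<Rightarrow> (nat \<Rightarrow> 'v \<Rightarrow> complex) \<Rightarrow> complex"
  where
  "wedge s n v = (\<lambda>\<phi>. if \<forall>i<n. Vector_Spaces.linear s (*) (\<phi> i)
     then Determinant.det (mat n n (\<lambda>(i, j). \<phi> i (v j))) else 0)"

definition exterior_power ::
  "(complex \<Rightarrow> 'v :: ab_group_add \<Rightarrow> 'v) \<Rightarrow> nat \<Rightarrow> 'v set \<Rightarrow> ((nat \<Rightarrow> 'v \<Rightarrow> complex) \<Rightarrow> complex) set"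
  where "exterior_power s n W = fn.span {wedge s n v | v. \<forall>i<n. v i \<in> W}"

definition grassmannian :: "(complex \<Rightarrow> 'v :: ab_group_add \<Rightarrow> 'v) \<Rightarrow> nat \<Rightarrow> 'v set set" where
  "grassmannian s n = {W. Modules.module.subspace s W \<and> Vector_Spaces.vector_space.dim s W = n}"

definition bilinear_form ::
  "(complex \<Rightarrow> 'v :: ab_group_add \<Rightarrow> 'v) \<Rightarrow> ('v \<Rightarrow> 'v \<Rightarrow> complex) \<Rightarrow> bool" where
  "bilinear_form s b \<longleftrightarrow> (\<forall>x. Vector_Spaces.linear s (*) (\<lambda>y. b x y)) \<and>
     (\<forall>y. Vector_Spaces.linear s (*) (\<lambda>x. b x y))"

definition nondegenerate :: "('v :: ab_group_add \<Rightarrow> 'v \<Rightarrow> complex) \<Rightarrow> bool" where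
  "nondegenerate b \<longleftrightarrow> (\<forall>x. (\<forall>y. b x y = 0) \<longrightarrow> x = 0) \<and> (\<forall>y. (\<forall>x. b x y = 0) \<longrightarrow> y = 0)"

definition symplectic_form ::
  "(complex \<Rightarrow> 'v :: ab_group_add \<Rightarrow> 'v) \<Rightarrow> ('v \<Rightarrow> 'v \<Rightarrow> complex) \<Rightarrow> bool" where
  "symplectic_form s \<omega> \<longleftrightarrow> bilinear_form s \<omega> \<and> (\<forall>x. \<omega> x x = 0) \<and> nondegenerate \<omega>"

definition lagrangian_grassmannian ::
  "(complex \<Rightarrow> 'v :: ab_group_add \<Rightarrow> 'v) \<Rightarrow> ('v \<Rightarrow> 'v \<Rightarrow> complex) \<Rightarrow> nat \<Rightarrow>
    ((nat \<Rightarrow> 'v \<Rightarrow> complex) \<Rightarrow> complex) set set" where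
  "lagrangian_grassmannian s \<omega> n =
     exterior_power s n ` {W \<in> grassmannian s n. \<forall>x\<in>W. \<forall>y\<in>W. \<omega> x y = 0}"

definition polar_form :: "('v :: ab_group_add \<Rightarrow> complex) \<Rightarrow> 'v \<Rightarrow> 'v \<Rightarrow> complex" where
  "polar_form Q x y = Q (x + y) - Q x - Q y"

definition nondegenerate_quadratic_form ::
  "(complex \<Rightarrow> 'v :: ab_group_add \<Rightarrow> 'v) \<Rightarrow> ('v \<Rightarrow> complex) \<Rightarrow> bool" where
  "nondegenerate_quadratic_form s Q \<longleftrightarrow> (\<forall>c x. Q (s c x) = c\<^sup>2 * Q x) \<and>
     bilinear_form s (polar_form Q) \<and> nondegenerate (polar_form Q)"

definition orthogonal_grassmannian ::
  "(complex \<Rightarrow> 'v :: ab_group_add \<Rightarrow> 'v) \<Rightarrow> ('v \<Rightarrow> complex) \<Rightarrow> nat \<Rightarrow>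
    ((nat \<Rightarrow> 'v \<Rightarrow> complex) \<Rightarrow> complex) set set" where
  "orthogonal_grassmannian s Q n =
     exterior_power s n ` {W \<in> grassmannian s n. \<forall>x\<in>W. Q x = 0}"

text \<open>The two members of this set are the two candidates for the spinor variety.\<close>

definition spinor_varieties ::
  "(complex \<Rightarrow> 'v :: ab_group_add \<Rightarrow> 'v) \<Rightarrow> ('v \<Rightarrow> complex) \<Rightarrow> nat \<Rightarrow>
    ((nat \<Rightarrow> 'v \<Rightarrow> complex) \<Rightarrow> complex) set set set" where
  "spinor_varieties s Q n = connected_components_of
     (subtopology (zariski (exterior_power s n UNIV)) (orthogonal_grassmannian s Q n))"

text \<open>The Pfaffian of the principal submatrix of \<open>B\<close> with rows and columns in a set \<open>I\<close> of
  even cardinality \<open>2k\<close>.\<close>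

definition pfaffian :: "complex mat \<Rightarrow> nat set \<Rightarrow> complex" where
  "pfaffian B I = (let k = card I div 2; l = sorted_list_of_set I in
     (\<Sum>\<sigma> | \<sigma> permutes {..<2 * k}. of_int (sign \<sigma>) *
        (\<Prod>i<k. B $$ (l ! \<sigma> (2 * i), l ! \<sigma> (2 * i + 1)))) / (2 ^ k * fact k))"

text \<open>The half-spin representation, of dimension \<open>2\<^sup>n\<^sup>-\<^sup>1\<close> for \<open>n > 0\<close>, with coordinates
  indexed by the subsets of \<open>{..<n}\<close> of even cardinality.\<close>

definition half_spin :: "nat \<Rightarrow> (nat set \<Rightarrow> complex) set" where
  "half_spin n = {x. \<forall>I. \<not> (I \<subseteq> {..<n} \<and> even (card I)) \<longrightarrow> x I = 0}"

definition pfaffian_point :: "nat \<Rightarrow> complex mat \<Rightarrow> (nat set \<Rightarrow> complex) set" where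
  "pfaffian_point n B = fn.span {\<lambda>I. if I \<subseteq> {..<n} \<and> even (card I) then pfaffian B I else 0}"

definition hyperbolic_basis ::
  "('v :: ab_group_add \<Rightarrow> complex) \<Rightarrow> nat \<Rightarrow> (nat \<Rightarrow> 'v) \<Rightarrow> (nat \<Rightarrow> 'v) \<Rightarrow> bool" where
  "hyperbolic_basis Q n e f \<longleftrightarrow> (\<forall>i<n. \<forall>j<n.
     polar_form Q (e i) (e j) = 0 \<and> polar_form Q (f i) (f j) = 0 \<and>
     polar_form Q (e i) (f j) = (if i = j then 1 else 0))"

definition skew_matrices :: "nat \<Rightarrow> complex mat set" where
  "skew_matrices n = {B \<in> carrier_mat n n. transpose_mat B = - B}"

text \<open>The \<open>n\<close>-dimensional subspace with basis \<open>e\<^sub>i + \<Sum>\<^sub>j B\<^sub>i\<^sub>j f\<^sub>j\<close>. With respect to a hyperbolic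
  basis it is isotropic iff \<open>B\<close> is skew-symmetric; these subspaces form the affine chart of
  the spinor variety around the span of the \<open>e\<^sub>i\<close>.\<close>

definition chart_subspace ::
  "(complex \<Rightarrow> 'v :: ab_group_add \<Rightarrow> 'v) \<Rightarrow> nat \<Rightarrow> (nat \<Rightarrow> 'v) \<Rightarrow> (nat \<Rightarrow> 'v) \<Rightarrow> complex mat \<Rightarrow> 'v set"
  where
  "chart_subspace s n e f B =
     Modules.module.span s ((\<lambda>i. e i + (\<Sum>j<n. s (B $$ (i, j)) (f j))) ` {..<n})"

text \<open>The image of a spinor variety \<open>S\<close> in its spinor embedding. The chart is dense in \<open>S\<close> and the
  image of the projective variety \<open>S\<close> is closed, so the image is the Zariski closure of the image
  of the chart, on which the embedding is given by the Pfaffians.\<close>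

definition spinor_embedding_image ::
  "(complex \<Rightarrow> 'v :: ab_group_add \<Rightarrow> 'v) \<Rightarrow> nat \<Rightarrow> (nat \<Rightarrow> 'v) \<Rightarrow> (nat \<Rightarrow> 'v) \<Rightarrow>
    ((nat \<Rightarrow> 'v \<Rightarrow> complex) \<Rightarrow> complex) set set \<Rightarrow> (nat set \<Rightarrow> complex) set set" where
  "spinor_embedding_image s n e f S = zariski (half_spin n) closure_of
     {pfaffian_point n B | B. B \<in> skew_matrices n \<and>
        exterior_power s n (chart_subspace s n e f B) \<in> S}"

end

theory Submission
  imports Defs
begin

text \<open>Dimensions are controlled by counting. If \<open>Z\<^sub>0 \<subset> \<dots> \<subset> Z\<^sub>k\<close> are irreducible closed sets and
  \<open>f\<^sub>i\<close> vanishes on \<open>Z\<^sub>i\<close> but not on \<open>Z\<^sub>i\<^sub>+\<^sub>1\<close>, then the monomials in the \<open>f\<^sub>i\<close> are linearly independent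
  on \<open>Z\<^sub>k\<close>, while a set parametrised by polynomials in \<open>m\<close> variables carries only \<open>O(d\<^sup>m)\<close> independent
  forms of degree \<open>d\<close>; hence \<open>k \<le> m\<close>. Conversely, the images of the coordinate subspaces under a
  polynomial parametrisation with independent derivatives form a strict chain, again by counting.

  By Terracini's lemma it remains to find \<open>h\<close> points with independent tangent spaces. In a chart of
  symmetric or skew-symmetric matrices these are the multiples \<open>t\<^sub>1, \<dots>, t\<^sub>h\<close> of one signed permutation
  matrix. Suitable linear combinations of minors (or Pfaffians) restrict to \<open>\<Prod>\<^sub>p (t - u\<^sub>p)\<close> on this curve,
  to first order also in its neighbourhood, and the roots \<open>u\<^sub>p\<close> can be chosen freely: double roots
  at the other points and at most one simple root at the given one yield the dual functionals. This
  needs \<open>2h - 1 \<le> n\<close> factors for symmetric matrices, \<open>2h - 1 \<le> 2\<lfloor>n/2\<rfloor>\<close> for minors of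
  skew-symmetric ones and \<open>2h - 1 \<le> \<lfloor>n/2\<rfloor>\<close> for Pfaffians.\<close>

section \<open>Polynomial functions\<close>

text \<open>Placing all points of tangency on one curve reduces the separation of \<open>h\<close>
  tangent spaces to interpolation in the single variable t: a functional must vanish doubly at
  \<open>h - 1\<close> points and, to detect a direction that moves a root, once more at its own
  point, whence \<open>2 * h - 1\<close> factors. For a direction that moves no root, the chosen
  minor or Pfaffian has a factor of first order all along the curve, so single roots at the other
  \<open>h - 1\<close> points suffice, but its rows or blocks occupy up to two of the available
  factors.

  The bounds on \<open>h\<close> are these counts solved for \<open>h\<close>:
  \<open>2 * h - 1 <= n\<close> means \<open>h <= (n + 1) div 2\<close>,
  \<open>2 * h - 1 <= 2 * (n div 2)\<close> means \<open>h <= n div 2\<close>, and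
  \<open>2 * h - 1 <= n div 2\<close> means \<open>h <= (n + 2) div 4\<close>. The last is about
  half of the second because a 2 x 2 block of a skew-symmetric matrix contributes two rows to a
  minor but only one pair, hence one factor, to a Pfaffian.\<close>

definition polyfun :: "'j set \<Rightarrow> nat \<Rightarrow> (('j \<Rightarrow> complex) \<Rightarrow> complex) \<Rightarrow> bool" where
  "polyfun J D f \<longleftrightarrow> f \<in> fn.span ((\<lambda>m a. \<Prod>j\<in>J. a j ^ m j) ` (J \<rightarrow>\<^sub>E {..D}))"

lemma sum_fun_apply: "(\<Sum>i\<in>A. f i) x = (\<Sum>i\<in>A. f i x)"
  by (induction A rule: infinite_finite_induct) auto

lemma polyfun_monomial:
  assumes "\<And>j. j \<in> J \<Longrightarrow> m j \<le> D"
  shows "polyfun J D (\<lambda>a. \<Prod>j\<in>J. a j ^ m j)"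
proof -
  have "(\<lambda>a :: 'a \<Rightarrow> complex. \<Prod>j\<in>J. a j ^ m j) = (\<lambda>a. \<Prod>j\<in>J. a j ^ restrict m J j)"
    by (intro ext prod.cong) auto
  moreover have "restrict m J \<in> J \<rightarrow>\<^sub>E {..D}"
    using assms by (simp add: restrict_PiE_iff)
  ultimately show ?thesis
    unfolding polyfun_def by (intro fn.span_base image_eqI[of _ _ "restrict m J"])
qed

lemma polyfun_zero: "polyfun J D (\<lambda>a. 0)"
  unfolding polyfun_def using fn.span_zero by (simp add: zero_fun_def)

lemma polyfun_add:
  assumes "polyfun J D f" "polyfun J D g" shows "polyfun J D (\<lambda>a. f a + g a)"
  using assms fn.span_add unfolding polyfun_def plus_fun_def by blast

lemma polyfun_scale: "polyfun J D f \<Longrightarrow> polyfun J D (\<lambda>a. c * f a)"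
  unfolding polyfun_def by (rule fn.span_scale)

lemma polyfun_sum: "(\<And>i. i \<in> A \<Longrightarrow> polyfun J D (f i)) \<Longrightarrow> polyfun J D (\<lambda>a. \<Sum>i\<in>A. f i a)"
  by (induction A rule: infinite_finite_induct) (auto intro: polyfun_zero polyfun_add)

lemma polyfun_const: "polyfun J D (\<lambda>a. c)"
  using polyfun_scale[OF polyfun_monomial[of J "\<lambda>_. 0" D], of c] by simp

lemma polyfun_coord:
  assumes "finite J" "j \<in> J" shows "polyfun J 1 (\<lambda>a. a j)"
proof -
  have "(\<lambda>a :: 'a \<Rightarrow> complex. \<Prod>i\<in>J. a i ^ (if i = j then 1 else 0)) = (\<lambda>a. a j)"
    using assms by (auto simp: fun_eq_iff if_distrib prod.delta cong: if_cong)
  with polyfun_monomial[of J "\<lambda>i. if i = j then 1 else 0" 1] show ?thesis by simp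
qed

lemma polyfun_induct [consumes 1, case_names zero step]:
  assumes "polyfun J D f" "P (\<lambda>a. 0)"
    and "\<And>c m g. (\<And>j. j \<in> J \<Longrightarrow> m j \<le> D) \<Longrightarrow> polyfun J D g \<Longrightarrow> P g \<Longrightarrow>
      P (\<lambda>a. c * (\<Prod>j\<in>J. a j ^ m j) + g a)"
  shows "P f"
proof -
  have "polyfun J D f \<and> P f"
    using assms(1)[unfolded polyfun_def]
  proof (induction rule: fn.span_induct_alt)
    case base
    then show ?case using assms(2) polyfun_zero by (simp add: zero_fun_def)
  next
    case (step c x y)
    then obtain m where m: "x = (\<lambda>a. \<Prod>j\<in>J. a j ^ m j)" "\<And>j. j \<in> J \<Longrightarrow> m j \<le> D"
      by (auto simp: PiE_def Pi_def)
    have "fscale c x + y = (\<lambda>a. c * (\<Prod>j\<in>J. a j ^ m j) + y a)"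
      by (simp add: m(1) plus_fun_def)
    moreover have "polyfun J D (\<lambda>a. c * (\<Prod>j\<in>J. a j ^ m j) + y a)"
      using step.IH m(2) by (intro polyfun_add polyfun_scale polyfun_monomial) auto
    ultimately show ?case using assms(3)[OF m(2)] step.IH by simp
  qed
  then show ?thesis ..
qed

lemma polyfun_mono: "polyfun J D f \<Longrightarrow> D \<le> D' \<Longrightarrow> polyfun J D' f"
proof (induction rule: polyfun_induct)
  case zero
  show ?case by (rule polyfun_zero)
next
  case (step c m g)
  then show ?case by (intro polyfun_add polyfun_scale polyfun_monomial) (auto intro: order.trans)
qed

lemma polyfun_mult:
  assumes "polyfun J D f" "polyfun J D' g" shows "polyfun J (D + D') (\<lambda>a. f a * g a)"
  using assms(1)
proof (induction rule: polyfun_induct)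
  case zero
  show ?case using polyfun_zero by simp
next
  case (step c m f)
  have "polyfun J (D + D') (\<lambda>a. (\<Prod>j\<in>J. a j ^ m j) * g a)"
    using assms(2)
  proof (induction rule: polyfun_induct)
    case zero
    show ?case using polyfun_zero by simp
  next
    case (step c' m' g)
    have "polyfun J (D + D') (\<lambda>a. c' * (\<Prod>j\<in>J. a j ^ (m j + m' j)) + (\<Prod>j\<in>J. a j ^ m j) * g a)"
      using step \<open>\<And>j. j \<in> J \<Longrightarrow> m j \<le> D\<close>
      by (intro polyfun_add polyfun_scale polyfun_monomial) (auto intro: add_mono)
    then show ?case by (simp add: power_add prod.distrib algebra_simps)
  qed
  from polyfun_add[OF polyfun_scale[OF this, of c] step(3)] show ?case
    by (simp add: algebra_simps)
qed

lemma polyfun_prod: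
  assumes "\<And>i. i \<in> A \<Longrightarrow> polyfun J D (f i)"
  shows "polyfun J (D * card A) (\<lambda>a. \<Prod>i\<in>A. f i a)"
  using assms
proof (induction A rule: infinite_finite_induct)
  case (insert x A)
  have "polyfun J (D + D * card A) (\<lambda>a. f x a * (\<Prod>i\<in>A. f i a))"
    using insert by (intro polyfun_mult) auto
  then show ?case using insert by simp
qed (auto intro: polyfun_const)

lemma polyfun_power: "polyfun J D f \<Longrightarrow> polyfun J (D * k) (\<lambda>a. f a ^ k)"
  using polyfun_prod[of "{..<k}" J D "\<lambda>_. f"] by simp

lemma polyfun_compose:
  assumes "polyfun J D f" and \<theta>: "\<And>j. j \<in> J \<Longrightarrow> polyfun K D' (\<lambda>a. \<theta> a j)"
  shows "polyfun K (D' * D * card J) (\<lambda>a. f (\<theta> a))"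
  using assms(1)
proof (induction rule: polyfun_induct)
  case zero
  show ?case by (rule polyfun_zero)
next
  case (step c m g)
  have "polyfun K (D' * D * card J) (\<lambda>a. \<Prod>j\<in>J. \<theta> a j ^ m j)"
    using step(1) by (intro polyfun_prod polyfun_mono[OF polyfun_power[OF \<theta>]]) auto
  with step show ?case by (intro polyfun_add polyfun_scale)
qed

text \<open>\<open>D\<close> bounds the degree in each variable separately, so there are
  \<open>(D + 1) ^ card J\<close> monomials and any longer family is dependent. Every comparison of
  dimensions below comes down to this count.\<close>

lemma polyfun_dependent:
  assumes "finite J" "finite A" and card: "card A > (D + 1) ^ card J"
    and poly: "\<And>i. i \<in> A \<Longrightarrow> polyfun J D (F i)"
  shows "\<exists>c. (\<exists>i\<in>A. c i \<noteq> 0) \<and> (\<forall>a. (\<Sum>i\<in>A. c i * F i a) = 0)"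
proof (cases "inj_on F A")
  case True
  let ?S = "(\<lambda>m a. \<Prod>j\<in>J. a j ^ m j) ` (J \<rightarrow>\<^sub>E {..D}) :: (('a \<Rightarrow> complex) \<Rightarrow> complex) set"
  have fin: "finite ?S" using assms by (intro finite_imageI finite_PiE) auto
  have "card ?S \<le> card (J \<rightarrow>\<^sub>E {..D})"
    using assms by (intro card_image_le finite_PiE) auto
  also have "\<dots> = (D + 1) ^ card J"
    using assms(1) by (simp add: card_PiE)
  finally have "card ?S < card (F ` A)" using card True by (simp add: card_image)
  then have "fn.dependent (F ` A)"
    using fn.independent_span_bound[OF fin, of "F ` A"] poly unfolding polyfun_def by auto
  then have "\<exists>u. (\<exists>v\<in>F ` A. u v \<noteq> 0) \<and> (\<Sum>v\<in>F ` A. fscale (u v) v) = 0"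
    by (rule iffD1[OF fn.dependent_finite[OF finite_imageI[OF assms(2)]]])
  then obtain u where u: "\<exists>v\<in>F ` A. u v \<noteq> 0" "(\<Sum>v\<in>F ` A. fscale (u v) v) = 0"
    by (elim exE conjE) (rule that)
  have "(\<Sum>i\<in>A. fscale (u (F i)) (F i)) = 0"
    using u(2) unfolding sum.reindex[OF True] comp_def .
  then have "(\<Sum>i\<in>A. u (F i) * F i a) = 0" for a
    unfolding sum_fun_apply[of "\<lambda>i. fscale (u (F i)) (F i)" A a, symmetric] by simp
  moreover have "\<exists>i\<in>A. u (F i) \<noteq> 0" using u(1) by blast
  ultimately show ?thesis by (intro exI[of _ "\<lambda>i. u (F i)"]) blast
next
  case False
  then obtain i j where ij: "i \<in> A" "j \<in> A" "i \<noteq> j" "F i = F j" by (auto simp: inj_on_def)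
  let ?c = "\<lambda>k. if k = i then 1 else if k = j then - 1 else 0 :: complex"
  have "(\<Sum>k\<in>A. ?c k * F k a) = 0" for a
  proof -
    have "(\<Sum>k\<in>A. ?c k * F k a) = (\<Sum>k\<in>{i, j}. ?c k * F k a)"
      using ij assms(2) by (intro sum.mono_neutral_right) auto
    then show ?thesis using ij by simp
  qed
  then show ?thesis using ij(1) by (intro exI[of _ ?c]) auto
qed

lemma polyfun_line:
  assumes "polyfun J D f"
  shows "\<exists>p. \<forall>t. f (\<lambda>j. a j + t * v j) = poly p t"
  using assms
proof (induction rule: polyfun_induct)
  case zero
  show ?case by (intro exI[of _ 0]) simp
next
  case (step c m g)
  then obtain p where "\<forall>t. g (\<lambda>j. a j + t * v j) = poly p t" by blast
  then show ?case
    by (intro exI[of _ "Polynomial.smult c (\<Prod>j\<in>J. [:a j, v j:] ^ m j) + p"]) (simp add: poly_prod)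
qed

text \<open>Irreducibility of affine space in pointwise form: on the line through \<open>a\<close>
  and \<open>b\<close> both functions are nonzero polynomials in \<open>t\<close>, with finitely
  many roots. Since the common point is on that line, it stays in every linear subspace that
  contains \<open>a\<close> and \<open>b\<close>.\<close>

lemma polyfun_common_nonzero:
  assumes "polyfun J D f" "polyfun J D' g" "f a \<noteq> 0" "g b \<noteq> 0"
  shows "\<exists>t. f (\<lambda>j. a j + t * (b j - a j)) \<noteq> 0 \<and> g (\<lambda>j. a j + t * (b j - a j)) \<noteq> 0"
proof -
  obtain p where p: "\<forall>t. f (\<lambda>j. a j + t * (b j - a j)) = poly p t"
    using polyfun_line[OF assms(1), of a "\<lambda>j. b j - a j"] by (elim exE) (rule that)
  obtain q where q: "\<forall>t. g (\<lambda>j. a j + t * (b j - a j)) = poly q t"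
    using polyfun_line[OF assms(2), of a "\<lambda>j. b j - a j"] by (elim exE) (rule that)
  have "poly p 0 \<noteq> 0" "poly q 1 \<noteq> 0" using p[rule_format, of 0] q[rule_format, of 1] assms by auto
  then have "p * q \<noteq> 0" by auto
  then have "finite {t. poly (p * q) t = 0}" by (rule poly_roots_finite)
  then have "{t. poly (p * q) t = 0} \<noteq> UNIV" using infinite_UNIV_char_0 by metis
  then obtain t where "poly (p * q) t \<noteq> 0" by auto
  then have "poly p t \<noteq> 0 \<and> poly q t \<noteq> 0" by simp
  then show ?thesis unfolding p[rule_format, symmetric] q[rule_format, symmetric] by (rule exI)
qed

text \<open>\<open>\<kappa>\<close> is the gradient at the origin. That the derivative is linear in
  \<open>v\<close> later allows a functional with unknown derivative to be corrected by functionals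
  with known ones.\<close>

lemma polyfun_deriv_linear:
  assumes "polyfun J D f" "finite J"
  shows "\<exists>\<kappa>. \<forall>v. ((\<lambda>\<tau>. f (\<lambda>j. \<tau> * v j)) has_field_derivative (\<Sum>j\<in>J. \<kappa> j * v j)) (at 0)"
  using assms(1)
proof (induction rule: polyfun_induct)
  case zero
  show ?case by (intro exI[of _ "\<lambda>_. 0"]) auto
next
  case (step c m g)
  have "\<exists>\<kappa>. \<forall>v :: 'a \<Rightarrow> complex. ((\<lambda>\<tau>. \<Prod>j\<in>K. (\<tau> * v j) ^ m j) has_field_derivative (\<Sum>j\<in>J. \<kappa> j * v j)) (at 0)"
    if "finite K" "K \<subseteq> J" for K
    using that
  proof (induction K rule: finite_induct)
    case empty
    show ?case by (intro exI[of _ "\<lambda>_. 0"]) auto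
  next
    case (insert k K)
    then have "K \<subseteq> J" by blast
    from insert(3)[OF this] obtain \<kappa> where \<kappa>: "\<forall>v :: 'a \<Rightarrow> complex. ((\<lambda>\<tau>. \<Prod>j\<in>K. (\<tau> * v j) ^ m j)
        has_field_derivative (\<Sum>j\<in>J. \<kappa> j * v j)) (at 0)" by (elim exE) (rule that)
    \<comment> \<open>The derivative of the \<open>m k\<close>-th power at 0: it is 1 for
      \<open>m k = 1\<close> and 0 otherwise. For \<open>m k = 0\<close> the first factor kills the
      value \<open>0 ^ 0 = 1\<close>.\<close>
    let ?e = "of_nat (m k) * 0 ^ (m k - Suc 0) :: complex"
    let ?P = "\<Prod>j\<in>K. (0::complex) ^ m j"
    have "((\<lambda>\<tau>. \<Prod>j\<in>insert k K. (\<tau> * v j) ^ m j) has_field_derivative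
        (\<Sum>j\<in>J. (0 ^ m k * \<kappa> j + (if j = k then ?e * ?P else 0)) * v j)) (at 0)" for v :: "'a \<Rightarrow> complex"
    proof -
      have "((\<lambda>\<tau>. (\<tau> * v k) ^ m k) has_field_derivative ?e * v k) (at 0)"
        by (auto intro!: derivative_eq_intros)
      from DERIV_mult'[OF this \<kappa>[rule_format, of v]]
      have "((\<lambda>\<tau>. (\<tau> * v k) ^ m k * (\<Prod>j\<in>K. (\<tau> * v j) ^ m j)) has_field_derivative
        0 ^ m k * (\<Sum>j\<in>J. \<kappa> j * v j) + ?e * v k * ?P) (at 0)" by simp
      moreover have "(\<Sum>j\<in>J. (0 ^ m k * \<kappa> j + (if j = k then ?e * ?P else 0)) * v j)
        = 0 ^ m k * (\<Sum>j\<in>J. \<kappa> j * v j) + (\<Sum>j\<in>J. if j = k then ?e * ?P * v j else 0)"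
        by (auto simp: sum_distrib_left sum.distrib[symmetric] algebra_simps intro!: sum.cong)
      moreover have "(\<Sum>j\<in>J. if j = k then ?e * ?P * v j else 0) = ?e * v k * ?P"
        using insert assms(2) by (simp add: sum.delta)
      ultimately show ?thesis using insert(1,2) by simp
    qed
    then show ?case by (intro exI allI)
  qed
  from this[OF assms(2) order.refl] obtain \<kappa> where \<kappa>: "\<forall>v :: 'a \<Rightarrow> complex. ((\<lambda>\<tau>. \<Prod>j\<in>J. (\<tau> * v j) ^ m j)
    has_field_derivative (\<Sum>j\<in>J. \<kappa> j * v j)) (at 0)" by (elim exE) (rule that)
  from step(3) obtain \<kappa>' where \<kappa>': "\<forall>v. ((\<lambda>\<tau>. g (\<lambda>j. \<tau> * v j)) has_field_derivative
    (\<Sum>j\<in>J. \<kappa>' j * v j)) (at 0)" by (elim exE) (rule that)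
  have "((\<lambda>\<tau>. c * (\<Prod>j\<in>J. (\<tau> * v j) ^ m j) + g (\<lambda>j. \<tau> * v j)) has_field_derivative
      (\<Sum>j\<in>J. (c * \<kappa> j + \<kappa>' j) * v j)) (at 0)" for v
    using DERIV_add[OF DERIV_cmult[OF \<kappa>[rule_format, of v], of c] \<kappa>'[rule_format, of v]]
    by (simp add: sum_distrib_left sum.distrib algebra_simps)
  then show ?case by (intro exI allI)
qed

section \<open>Homogeneous polynomials\<close>

lemma homogeneous_poly_scale: "homogeneous_poly d f \<Longrightarrow> f (fscale c x) = c ^ d * f x"
  by (induction rule: homogeneous_poly.induct) (simp_all add: distrib_left power_add)

text \<open>The induction carries degree 0 along: a product has degree 1 exactly if one factor has
  degree 1 and the other has degree 0, hence is constant.\<close>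

lemma homogeneous_poly_linear:
  assumes "homogeneous_poly 1 f" shows "Vector_Spaces.linear fscale (*) f"
proof -
  have "(d = 0 \<longrightarrow> (\<forall>x y. f x = f y)) \<and>
        (d = 1 \<longrightarrow> (\<forall>x y. f (x + y) = f x + f y))"
    if "homogeneous_poly d f" for d and f :: "('a \<Rightarrow> complex) \<Rightarrow> complex"
    using that
  proof (induction rule: homogeneous_poly.induct)
    case (add d f g)
    have "f x + g x = f y + g y" if "d = 0" for x y
      using add.IH that by metis
    with add.IH show ?case by (simp add: algebra_simps)
  next
    case (mult d f e g)
    have c: "\<exists>c. g = (\<lambda>_. c)" if "\<forall>x y. g x = g y" for g :: "('a \<Rightarrow> complex) \<Rightarrow> complex"
    proof
      show "g = (\<lambda>_. g 0)" using that by blast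
    qed
    consider "d = 0" "e = 0" | "d = 1" "e = 0" | "d = 0" "e = 1" | "d + e > 1" by linarith
    then show ?case
    proof cases
      case 1
      with mult.IH c[of f] c[of g] show ?thesis by auto
    next
      case 2
      then obtain k where "g = (\<lambda>_. k)" using mult.IH c[of g] by auto
      with 2 mult.IH show ?thesis by (simp add: distrib_right)
    next
      case 3
      then obtain k where "f = (\<lambda>_. k)" using mult.IH c[of f] by auto
      with 3 mult.IH show ?thesis by (simp add: distrib_left)
    qed auto
  qed (auto simp: algebra_simps)
  with assms have "f (x + y) = f x + f y" for x y by blast
  moreover have "f (fscale c x) = c * f x" for c x
    using homogeneous_poly_scale[OF assms] by simp
  ultimately show ?thesis
    unfolding Vector_Spaces.linear_iff by (intro conjI fn.vector_space_axioms vector_space_over_itself.vector_space_axioms) auto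
qed

text \<open>The degree of the pullback grows linearly with \<open>d\<close>, the factor
  \<open>D\<close> depending on the parametrisation alone. Growth rates of the number of independent
  forms can therefore be compared.\<close>

lemma homogeneous_poly_compose:
  assumes "homogeneous_poly d f" "\<And>i. polyfun J D (\<lambda>a. \<psi> a i)"
  shows "polyfun J (D * d) (\<lambda>a. f (\<psi> a))"
  using assms(1)
proof (induction rule: homogeneous_poly.induct)
  case (const c)
  show ?case by (rule polyfun_const)
next
  case (coord i)
  show ?case using assms(2)[of i] by simp
next
  case (add d f g)
  from polyfun_add[OF add.IH] show ?case .
next
  case (mult d f e g)
  from polyfun_mult[OF mult.IH] show ?case by (simp add: add_mult_distrib2)
qed

lemma homogeneous_poly_cmult: "homogeneous_poly d f \<Longrightarrow> homogeneous_poly d (\<lambda>x. c * f x)"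
  using homogeneous_poly.mult[OF homogeneous_poly.const[of c]] by simp

lemma homogeneous_poly_power: "homogeneous_poly d f \<Longrightarrow> homogeneous_poly (d * k) (\<lambda>x. f x ^ k)"
proof (induction k)
  case 0
  show ?case using homogeneous_poly.const[of 1] by simp
next
  case (Suc k)
  then show ?case using homogeneous_poly.mult[of d f "d * k"] by simp
qed

lemma homogeneous_poly_prod:
  assumes "\<And>i. i \<in> A \<Longrightarrow> homogeneous_poly (d i) (f i)"
  shows "homogeneous_poly (\<Sum>i\<in>A. d i) (\<lambda>x. \<Prod>i\<in>A. f i x)"
  using assms
  by (induction A rule: infinite_finite_induct)
     (auto intro: homogeneous_poly.const homogeneous_poly.mult)

lemma homogeneous_poly_zero: "homogeneous_poly d (\<lambda>x. 0)"
proof (induction d)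
  case 0
  show ?case by (rule homogeneous_poly.const)
next
  case (Suc d)
  from homogeneous_poly.mult[OF homogeneous_poly.coord Suc] show ?case by simp
qed

lemma homogeneous_poly_sum:
  assumes "\<And>i. i \<in> A \<Longrightarrow> homogeneous_poly d (f i)"
  shows "homogeneous_poly d (\<lambda>x. \<Sum>i\<in>A. f i x)"
  using assms
  by (induction A rule: infinite_finite_induct)
     (auto intro: homogeneous_poly_zero homogeneous_poly.add)

section \<open>The Zariski topology\<close>

lemma proj_spaceE:
  assumes "L \<in> proj_space E"
  obtains x where "x \<noteq> 0" "x \<in> E" "L = fn.span {x}"
proof -
  have L: "fn.subspace L" "fn.dim L = 1" "L \<subseteq> E" using assms by (auto simp: proj_space_def)
  obtain B where B: "B \<subseteq> L" "fn.independent B" "L \<subseteq> fn.span B" "card B = fn.dim L"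
    by (rule fn.basis_exists)
  then obtain x where x: "B = {x}" using L(2) card_1_singletonE by metis
  have "x \<noteq> 0" using B(2) x fn.dependent_single by simp
  moreover have "L = fn.span {x}"
    using B(1,3) x L(1) fn.span_minimal[of "{x}" L] by auto
  moreover have "x \<in> E" using B(1) x L(3) by auto
  ultimately show ?thesis using that by blast
qed

lemma proj_spaceI:
  assumes "x \<noteq> 0" "x \<in> E" "fn.subspace E"
  shows "fn.span {x} \<in> proj_space E"
proof -
  have "fn.independent {x}" using assms(1) fn.dependent_single by simp
  then have "fn.dim (fn.span {x}) = 1" using fn.dim_span_eq_card_independent by fastforce
  moreover have "fn.span {x} \<subseteq> E" using assms fn.span_minimal[of "{x}" E] by simp
  ultimately show ?thesis by (simp add: proj_space_def fn.subspace_span)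
qed

lemma in_span_singleton_iff: "y \<in> fn.span {x} \<longleftrightarrow> (\<exists>c. y = fscale c x)"
  by (auto simp: fn.span_singleton)

lemma homogeneous_poly_span_zero:
  assumes "homogeneous_poly d f" "f x = 0" "y \<in> fn.span {x}" shows "f y = 0"
  using assms homogeneous_poly_scale[OF assms(1)] by (auto simp: in_span_singleton_iff)

definition vanishes_on :: "(('i \<Rightarrow> complex) \<Rightarrow> complex) \<Rightarrow> ('i \<Rightarrow> complex) set set \<Rightarrow> bool" where
  "vanishes_on f Z \<longleftrightarrow> (\<forall>L\<in>Z. \<forall>x\<in>L. f x = 0)"

lemma vanishes_onD: "vanishes_on f Z \<Longrightarrow> fn.span {x} \<in> Z \<Longrightarrow> f x = 0"
  unfolding vanishes_on_def using fn.span_base[of x "{x}"] by blast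

lemma vanishes_onI:
  assumes "Z \<subseteq> proj_space E" "homogeneous_poly d f"
    and "\<And>x. x \<noteq> 0 \<Longrightarrow> fn.span {x} \<in> Z \<Longrightarrow> f x = 0"
  shows "vanishes_on f Z"
  unfolding vanishes_on_def
proof (intro ballI)
  fix L y assume "L \<in> Z" "y \<in> L"
  with assms(1) have "L \<in> proj_space E" by blast
  then obtain x where "x \<noteq> 0" "L = fn.span {x}" by (rule proj_spaceE)
  with assms \<open>L \<in> Z\<close> \<open>y \<in> L\<close> show "f y = 0"
    using homogeneous_poly_span_zero by metis
qed

lemma topspace_zariski: "topspace (zariski E) = proj_space E"
proof -
  have "nonvanishing_locus E (\<lambda>x. 1) = proj_space E"
    using fn.subspace_0 by (auto simp: nonvanishing_locus_def proj_space_def)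
  then have "proj_space E \<subseteq> \<Union>{nonvanishing_locus E f |d f. homogeneous_poly d f}"
    using homogeneous_poly.const[of 1] by blast
  moreover have "\<Union>{nonvanishing_locus E f |d f. homogeneous_poly d f} \<subseteq> proj_space E"
    by (auto simp: nonvanishing_locus_def)
  ultimately show ?thesis
    unfolding zariski_def topology_generated_by_topspace by blast
qed

lemma openin_nonvanishing_locus: "homogeneous_poly d f \<Longrightarrow> openin (zariski E) (nonvanishing_locus E f)"
  unfolding zariski_def by (rule topology_generated_by_Basis) blast

lemma nonvanishing_locus_span:
  assumes "homogeneous_poly d f"
  shows "fn.span {x} \<in> nonvanishing_locus E f \<longleftrightarrow> fn.span {x} \<in> proj_space E \<and> f x \<noteq> 0"
  using homogeneous_poly_span_zero[OF assms] fn.span_base[of x "{x}"]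
  by (auto simp: nonvanishing_locus_def)

text \<open>The loci are only a subbasis by definition. The locus of a product is the intersection
  of the two loci, so they are a basis, and a point outside a closed set is separated from it by a
  single form.\<close>

lemma zariski_basis:
  assumes "openin (zariski E) U" "L \<in> U"
  shows "\<exists>d f. homogeneous_poly d f \<and> L \<in> nonvanishing_locus E f \<and> nonvanishing_locus E f \<subseteq> U"
proof -
  have "generate_topology_on {nonvanishing_locus E f | d f. homogeneous_poly d f} U"
    using assms(1) unfolding zariski_def openin_topology_generated_by_iff .
  then show ?thesis using assms(2)
  proof (induction arbitrary: L rule: generate_topology_on.induct)
    case Empty
    then show ?case by simp
  next
    case (Int a b)
    then have "L \<in> a" "L \<in> b" by auto
    from Int.IH(1)[OF this(1)] obtain d f where f: "homogeneous_poly d f"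
      "L \<in> nonvanishing_locus E f" "nonvanishing_locus E f \<subseteq> a"
      by (elim exE conjE) (rule that)
    from Int.IH(2)[OF \<open>L \<in> b\<close>] obtain e g where g: "homogeneous_poly e g"
      "L \<in> nonvanishing_locus E g" "nonvanishing_locus E g \<subseteq> b"
      by (elim exE conjE) (rule that)
    have fg: "homogeneous_poly (d + e) (\<lambda>x. f x * g x)"
      using f(1) g(1) by (rule homogeneous_poly.mult)
    have "L \<in> proj_space E" using f(2) by (simp add: nonvanishing_locus_def)
    then obtain x where x: "L = fn.span {x}" by (rule proj_spaceE)
    have "L \<in> nonvanishing_locus E (\<lambda>x. f x * g x)"
      using f g x by (simp add: nonvanishing_locus_span[OF fg] nonvanishing_locus_span[OF f(1)]
          nonvanishing_locus_span[OF g(1)])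
    moreover have "nonvanishing_locus E (\<lambda>x. f x * g x) \<subseteq> a \<inter> b"
      using f(3) g(3) by (auto simp: nonvanishing_locus_def)
    ultimately show ?case using fg by (intro exI conjI)
  next
    case (UN K)
    then obtain k where k: "k \<in> K" "L \<in> k" by blast
    from UN.IH[OF this] obtain d f where "homogeneous_poly d f" "L \<in> nonvanishing_locus E f"
      "nonvanishing_locus E f \<subseteq> k" by (elim exE conjE) (rule that)
    with k show ?case by (intro exI[of _ d] exI[of _ f]) auto
  next
    case (Basis s)
    then obtain d f where "s = nonvanishing_locus E f" "homogeneous_poly d f"
      unfolding mem_Collect_eq by (elim exE conjE) (rule that)
    with Basis show ?case by (intro exI[of _ d] exI[of _ f]) auto
  qed
qed

lemma zariski_separation:
  assumes "closedin (zariski E) C" "fn.span {x} \<in> proj_space E" "fn.span {x} \<notin> C"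
  shows "\<exists>d f. homogeneous_poly d f \<and> f x \<noteq> 0 \<and> vanishes_on f C"
proof -
  have C: "C \<subseteq> proj_space E" "openin (zariski E) (proj_space E - C)"
    using assms(1) by (auto simp: closedin_def topspace_zariski)
  have "fn.span {x} \<in> proj_space E - C" using assms by blast
  from zariski_basis[OF C(2) this] obtain d f where f: "homogeneous_poly d f"
    "fn.span {x} \<in> nonvanishing_locus E f" "nonvanishing_locus E f \<subseteq> proj_space E - C"
    by (elim exE conjE) (rule that)
  have "f x \<noteq> 0" using f(1,2) nonvanishing_locus_span by blast
  moreover have "vanishes_on f C"
    using f(3) C(1) by (auto simp: vanishes_on_def nonvanishing_locus_def)
  ultimately show ?thesis using f(1) by (intro exI conjI)
qed

lemma closedin_vanishing:
  assumes "homogeneous_poly d f"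
  shows "closedin (zariski E) {L \<in> proj_space E. vanishes_on f {L}}"
proof -
  have "proj_space E - {L \<in> proj_space E. vanishes_on f {L}} = nonvanishing_locus E f"
    by (auto simp: nonvanishing_locus_def vanishes_on_def)
  then show ?thesis
    using openin_nonvanishing_locus[OF assms] by (auto simp: closedin_def topspace_zariski)
qed

lemma vanishes_on_closure:
  assumes "homogeneous_poly d f" "vanishes_on f S" "S \<subseteq> proj_space E"
  shows "vanishes_on f (zariski E closure_of S)"
proof -
  have "zariski E closure_of S \<subseteq> {L \<in> proj_space E. vanishes_on f {L}}"
    using assms by (intro closure_of_minimal closedin_vanishing[OF assms(1)])
      (auto simp: vanishes_on_def)
  then show ?thesis by (auto simp: vanishes_on_def)
qed

text \<open>The ideal of an irreducible set is prime: the zero locus of a product is the union of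
  two closed zero loci.\<close>

lemma irreducible_in_vanishes_on_mult:
  assumes Z: "irreducible_in (subtopology (zariski E) X) Z" and X: "X \<subseteq> proj_space E"
    and f: "homogeneous_poly d f" and g: "homogeneous_poly e g"
    and fg: "vanishes_on (\<lambda>x. f x * g x) Z"
  shows "vanishes_on f Z \<or> vanishes_on g Z"
proof -
  let ?V = "\<lambda>f. X \<inter> {L \<in> proj_space E. vanishes_on f {L}}"
  have cl: "closedin (subtopology (zariski E) X) (?V f)" "closedin (subtopology (zariski E) X) (?V g)"
    using closedin_vanishing[OF f, of E] closedin_vanishing[OF g, of E]
    by (auto simp: closedin_subtopology)
  have ZX: "Z \<subseteq> X" using Z by (auto simp: irreducible_in_def)
  have "Z \<subseteq> ?V f \<union> ?V g"
  proof
    fix L assume L: "L \<in> Z"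
    then have "L \<in> proj_space E" using ZX X by blast
    then obtain x where x: "L = fn.span {x}" by (rule proj_spaceE)
    have "f x * g x = 0" using fg L x vanishes_onD by metis
    then have "vanishes_on f {L} \<or> vanishes_on g {L}"
      using homogeneous_poly_span_zero[OF f] homogeneous_poly_span_zero[OF g] x
      by (auto simp: vanishes_on_def)
    then show "L \<in> ?V f \<union> ?V g" using L ZX X by blast
  qed
  then have "Z \<subseteq> ?V f \<or> Z \<subseteq> ?V g" using Z cl unfolding irreducible_in_def by blast
  then show ?thesis by (auto simp: vanishes_on_def)
qed

section \<open>Irreducible subsets\<close>

lemma irreducible_in_subtopology:
  assumes "irreducible_in T Z" "Z \<subseteq> X" shows "irreducible_in (subtopology T X) Z"
  unfolding irreducible_in_def
proof (intro conjI allI impI)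
  show "Z \<subseteq> topspace (subtopology T X)" "Z \<noteq> {}"
    using assms by (auto simp: irreducible_in_def)
next
  fix A B assume "closedin (subtopology T X) A" "closedin (subtopology T X) B" "Z \<subseteq> A \<union> B"
  then obtain A' B' where "closedin T A'" "closedin T B'" "A = A' \<inter> X" "B = B' \<inter> X"
    by (auto simp: closedin_subtopology)
  moreover from this \<open>Z \<subseteq> A \<union> B\<close> have "Z \<subseteq> A' \<union> B'" by blast
  ultimately show "Z \<subseteq> A \<or> Z \<subseteq> B"
    using assms unfolding irreducible_in_def by (metis le_inf_iff)
qed

lemma irreducible_in_closure:
  assumes "irreducible_in T S" shows "irreducible_in T (T closure_of S)"
  unfolding irreducible_in_def
proof (intro conjI allI impI)
  have S: "S \<subseteq> T closure_of S" using assms by (simp add: irreducible_in_def closure_of_subset)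
  show "T closure_of S \<subseteq> topspace T" by (rule closure_of_subset_topspace)
  show "T closure_of S \<noteq> {}" using S assms by (auto simp: irreducible_in_def)
  fix A B assume A: "closedin T A" and B: "closedin T B" and "T closure_of S \<subseteq> A \<union> B"
  then have "S \<subseteq> A \<or> S \<subseteq> B" using S assms unfolding irreducible_in_def by blast
  then show "T closure_of S \<subseteq> A \<or> T closure_of S \<subseteq> B"
    using closure_of_minimal A B by metis
qed

text \<open>If two closed sets cover the image but neither contains it, forms separating a point
  from each pull back to polynomials that are nonzero somewhere, hence nonzero at a common
  parameter, whose point lies in neither set.\<close>

lemma irreducible_in_param:
  fixes \<psi> :: "('j \<Rightarrow> complex) \<Rightarrow> 'i \<Rightarrow> complex"
  assumes poly: "\<And>i. polyfun J D (\<lambda>a. \<psi> a i)"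
    and sub: "{fn.span {\<psi> a} | a. \<psi> a \<noteq> 0} \<subseteq> proj_space E" and nz: "\<psi> a0 \<noteq> 0"
  shows "irreducible_in (zariski E) {fn.span {\<psi> a} | a. \<psi> a \<noteq> 0}" (is "irreducible_in _ ?P")
  unfolding irreducible_in_def
proof (intro conjI allI impI)
  show "?P \<subseteq> topspace (zariski E)" using sub by (simp add: topspace_zariski)
  show "?P \<noteq> {}" using nz by blast
  fix A B assume A: "closedin (zariski E) A" and B: "closedin (zariski E) B" and AB: "?P \<subseteq> A \<union> B"
  show "?P \<subseteq> A \<or> ?P \<subseteq> B"
  proof (rule ccontr)
    assume "\<not> (?P \<subseteq> A \<or> ?P \<subseteq> B)"
    then obtain a b where a: "\<psi> a \<noteq> 0" "fn.span {\<psi> a} \<notin> A" and b: "\<psi> b \<noteq> 0" "fn.span {\<psi> b} \<notin> B"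
      by blast
    have spA: "fn.span {\<psi> a} \<in> proj_space E" and spB: "fn.span {\<psi> b} \<in> proj_space E"
      using sub a(1) b(1) by blast+
    obtain d f where f: "homogeneous_poly d f" "f (\<psi> a) \<noteq> 0" "vanishes_on f A"
      using zariski_separation[OF A spA a(2)] by (elim exE conjE) (rule that)
    obtain e g where g: "homogeneous_poly e g" "g (\<psi> b) \<noteq> 0" "vanishes_on g B"
      using zariski_separation[OF B spB b(2)] by (elim exE conjE) (rule that)
    \<comment> \<open>A form of degree 0 may be nonzero at the zero vector. The extra factor
      \<open>\<psi> a i\<close> guarantees that the common parameter found below yields a nonzero
      vector, and thus a point.\<close>
    obtain i where i: "\<psi> a i \<noteq> 0" using a(1) by (auto simp: fun_eq_iff)
    have "polyfun J (D * d + D) (\<lambda>a. f (\<psi> a) * \<psi> a i)"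
      by (intro polyfun_mult homogeneous_poly_compose[OF f(1)] poly)
    from polyfun_common_nonzero[OF this homogeneous_poly_compose[where \<psi> = \<psi>, OF g(1) poly], of a b]
    have "\<exists>t. f (\<psi> (\<lambda>j. a j + t * (b j - a j))) * \<psi> (\<lambda>j. a j + t * (b j - a j)) i \<noteq> 0
      \<and> g (\<psi> (\<lambda>j. a j + t * (b j - a j))) \<noteq> 0"
      using f(2) g(2) i by simp
    then obtain c where c: "f (\<psi> c) * \<psi> c i \<noteq> 0" "g (\<psi> c) \<noteq> 0"
      by (elim exE conjE) (rule that)
    then have "\<psi> c \<noteq> 0" by auto
    then have "fn.span {\<psi> c} \<in> A \<union> B" using AB by blast
    then show False using c f(3) g(3) by (auto dest: vanishes_onD)
  qed
qed

lemma connectedin_irreducible: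
  assumes "irreducible_in T S" shows "connectedin T S"
  using assms unfolding connectedin_closedin irreducible_in_def by blast

section \<open>Upper bounds for dimensions\<close>

lemma le_if_power_le_power:
  fixes a b C :: nat
  assumes "\<And>q. (q + 1) ^ a \<le> (C * (q + 1)) ^ b" shows "a \<le> b"
proof (rule ccontr)
  assume "\<not> a \<le> b"
  \<comment> \<open>With this value the constant \<open>C ^ b\<close> is smaller than
    \<open>?q + 1\<close>, the factor gained on the left by the larger exponent.\<close>
  let ?q = "C ^ b"
  have "(?q + 1) ^ Suc b \<le> (?q + 1) ^ a" using \<open>\<not> a \<le> b\<close> by (intro power_increasing) auto
  also have "\<dots> \<le> C ^ b * (?q + 1) ^ b" using assms[of ?q] by (simp only: power_mult_distrib)
  finally have "(?q + 1) * (?q + 1) ^ b \<le> ?q * (?q + 1) ^ b" by simp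
  then show False by (subst (asm) mult_le_cancel2) simp
qed

lemma sum_PiE_lessThan_Suc:
  "(\<Sum>\<alpha>\<in>{..<Suc k} \<rightarrow>\<^sub>E {..q}. h \<alpha>) = (\<Sum>m\<le>q. \<Sum>\<beta>\<in>{..<k} \<rightarrow>\<^sub>E {..q}. h (\<beta>(k := m)))"
  for q :: nat
proof -
  have "(\<Sum>\<alpha>\<in>{..<Suc k} \<rightarrow>\<^sub>E {..q}. h \<alpha>) =
      (\<Sum>(m, \<beta>)\<in>{..q} \<times> ({..<k} \<rightarrow>\<^sub>E {..q}). h (\<beta>(k := m)))"
    unfolding lessThan_Suc PiE_insert_eq
    by (subst sum.reindex[OF inj_combinator]) (auto simp: case_prod_unfold intro!: sum.cong)
  then show ?thesis by (simp add: sum.cartesian_product)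
qed

text \<open>\<open>A\<close> is an algebra of functions in which the ideal of each
  \<open>V i\<close> is prime. A relation is read as a polynomial in the last function
  \<open>f l\<close>, with coefficients in the earlier ones. As \<open>f l\<close> is not
  identically zero on \<open>V (Suc l)\<close>, its lowest power can be divided out; restriction to
  \<open>V l\<close>, where \<open>f l\<close> vanishes, then isolates the lowest coefficient, and
  the induction on \<open>l\<close> applies to it. The lemma serves both for coordinates on affine
  space and for the separating forms of a chain.\<close>

lemma monomials_independent:
  fixes A :: "('x \<Rightarrow> complex) \<Rightarrow> bool" and V :: "nat \<Rightarrow> 'x set" and f :: "nat \<Rightarrow> 'x \<Rightarrow> complex"
  assumes const: "\<And>c. A (\<lambda>_. c)"
    and add: "\<And>P Q. A P \<Longrightarrow> A Q \<Longrightarrow> A (\<lambda>x. P x + Q x)"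
    and mult: "\<And>P Q. A P \<Longrightarrow> A Q \<Longrightarrow> A (\<lambda>x. P x * Q x)"
    and prime: "\<And>i P Q. i \<le> k \<Longrightarrow> A P \<Longrightarrow> A Q \<Longrightarrow> \<forall>x\<in>V i. P x * Q x = 0 \<Longrightarrow>
      (\<forall>x\<in>V i. P x = 0) \<or> (\<forall>x\<in>V i. Q x = 0)"
    and f: "\<And>i. i < k \<Longrightarrow> A (f i)"
    and f0: "\<And>i x. i < k \<Longrightarrow> x \<in> V i \<Longrightarrow> f i x = 0"
    and f1: "\<And>i. i < k \<Longrightarrow> \<exists>x\<in>V (Suc i). f i x \<noteq> 0"
    and V: "\<And>i. i < k \<Longrightarrow> V i \<subseteq> V (Suc i)" and V0: "V 0 \<noteq> {}"
    and zero: "\<forall>x\<in>V k. (\<Sum>\<alpha>\<in>{..<k} \<rightarrow>\<^sub>E {..q}. c \<alpha> * (\<Prod>i<k. f i x ^ \<alpha> i)) = 0"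
    and \<alpha>: "\<alpha> \<in> {..<k} \<rightarrow>\<^sub>E {..q}"
  shows "c \<alpha> = 0"
proof -
  have A_prod: "A (\<lambda>x. \<Prod>i\<in>I. P i x)" if "\<And>i. i \<in> I \<Longrightarrow> A (P i)"
    for P :: "nat \<Rightarrow> 'x \<Rightarrow> complex" and I
    using that by (induction I rule: infinite_finite_induct) (simp_all add: const mult)
  have A_sum: "A (\<lambda>x. \<Sum>i\<in>I. P i x)" if "\<And>i. i \<in> I \<Longrightarrow> A (P i)"
    for P :: "nat \<Rightarrow> 'x \<Rightarrow> complex" and I
    using that by (induction I rule: infinite_finite_induct) (simp_all add: const add)
  have A_sum': "A (\<lambda>x. \<Sum>i\<in>I. P i x)" if "\<And>i. i \<in> I \<Longrightarrow> A (P i)"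
    for P :: "(nat \<Rightarrow> nat) \<Rightarrow> 'x \<Rightarrow> complex" and I
    using that by (induction I rule: infinite_finite_induct) (simp_all add: const add)
  have A_pow: "A (\<lambda>x. P x ^ n)" if "A P" for P and n :: nat
    using that by (induction n) (simp_all add: const mult)
  have "\<forall>\<alpha>\<in>{..<l} \<rightarrow>\<^sub>E {..q}. c \<alpha> = 0"
    if "l \<le> k" "\<forall>x\<in>V l. (\<Sum>\<alpha>\<in>{..<l} \<rightarrow>\<^sub>E {..q}. c \<alpha> * (\<Prod>i<l. f i x ^ \<alpha> i)) = 0" for l c
    using that
  proof (induction l arbitrary: c)
    case 0
    then show ?case using V0 by auto
  next
    case (Suc l)
    define P where "P m x = (\<Sum>\<beta>\<in>{..<l} \<rightarrow>\<^sub>E {..q}. c (\<beta>(l := m)) * (\<Prod>i<l. f i x ^ \<beta> i))" for m x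
    have AP: "A (P m)" for m
      unfolding P_def using Suc.prems(1)
      by (intro A_sum' mult const A_prod A_pow f) auto
    have eq: "(\<Sum>\<alpha>\<in>{..<Suc l} \<rightarrow>\<^sub>E {..q}. c \<alpha> * (\<Prod>i<Suc l. f i x ^ \<alpha> i)) =
        (\<Sum>m\<le>q. f l x ^ m * P m x)" for x
      unfolding sum_PiE_lessThan_Suc P_def
      by (auto simp: sum_distrib_left algebra_simps intro!: sum.cong prod.cong)
    have claim: "\<forall>\<beta>\<in>{..<l} \<rightarrow>\<^sub>E {..q}. c (\<beta>(l := m)) = 0" if "m \<le> q" for m
      using that
    proof (induction m rule: less_induct)
      case (less m)
      have P0: "P m' x = 0" if "m' < m" for m' x
      proof -
        have "c (\<beta>(l := m')) = 0" if "\<beta> \<in> {..<l} \<rightarrow>\<^sub>E {..q}" for \<beta>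
          by (rule less.IH[rule_format, OF \<open>m' < m\<close> _ that]) (use less.prems \<open>m' < m\<close> in simp)
        then show ?thesis unfolding P_def by (intro sum.neutral) simp
      qed
      \<comment> \<open>The relation divided by \<open>f l ^ m\<close>; by the inner induction all
        coefficients below \<open>m\<close> are already zero.\<close>
      define R where "R x = (\<Sum>m'\<in>{m..q}. f l x ^ (m' - m) * P m' x)" for x
      have AR: "A R" unfolding R_def using Suc.prems(1) by (intro A_sum mult A_pow f AP) auto
      have "f l x ^ m * R x = 0" if "x \<in> V (Suc l)" for x
      proof -
        have "f l x ^ m * R x = (\<Sum>m'\<in>{m..q}. f l x ^ m' * P m' x)"
          unfolding R_def sum_distrib_left
          by (intro sum.cong) (auto simp: mult.assoc[symmetric] power_add[symmetric])
        also have "\<dots> = (\<Sum>m'\<le>q. f l x ^ m' * P m' x)"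
          using P0 by (intro sum.mono_neutral_left) auto
        finally show ?thesis using eq Suc.prems(2) that by simp
      qed
      then have "(\<forall>x\<in>V (Suc l). f l x ^ m = 0) \<or> (\<forall>x\<in>V (Suc l). R x = 0)"
        using Suc.prems(1) AR f by (intro prime A_pow) auto
      then have R0: "\<forall>x\<in>V (Suc l). R x = 0"
        using f1[of l] Suc.prems(1) by auto
      have "P m x = 0" if "x \<in> V l" for x
      proof -
        have "f l x = 0" using f0 that Suc.prems(1) by simp
        then have "R x = (\<Sum>m'\<in>{m..q}. if m' = m then P m' x else 0)"
          unfolding R_def by (intro sum.cong) auto
        also have "\<dots> = P m x" using less.prems by simp
        finally show ?thesis using R0 V[of l] Suc.prems(1) that by auto
      qed
      then show ?case using Suc.prems(1)
        by (intro Suc.IH[of "\<lambda>\<beta>. c (\<beta>(l := m))"]) (auto simp: P_def)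
    qed
    show ?case
    proof
      fix \<alpha> assume "\<alpha> \<in> {..<Suc l} \<rightarrow>\<^sub>E {..q}"
      then obtain m \<beta> where "m \<le> q" "\<beta> \<in> {..<l} \<rightarrow>\<^sub>E {..q}" "\<alpha> = \<beta>(l := m)"
        unfolding lessThan_Suc PiE_insert_eq by auto
      then show "c \<alpha> = 0" using claim by blast
    qed
  qed
  from this[OF order.refl zero] \<alpha> show ?thesis by blast
qed

text \<open>The instance for the flag of coordinate subspaces: a polynomial with a nonzero
  coefficient is nonzero as a function, with a witness supported on the first \<open>k\<close>
  coordinates.\<close>

lemma monomial_sum_nonzero:
  assumes "\<alpha> \<in> {..<k} \<rightarrow>\<^sub>E {..q}" "c \<alpha> \<noteq> 0"
  shows "\<exists>v :: nat \<Rightarrow> complex. (\<forall>j\<ge>k. v j = 0) \<and>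
    (\<Sum>\<alpha>\<in>{..<k} \<rightarrow>\<^sub>E {..q}. c \<alpha> * (\<Prod>i<k. v i ^ \<alpha> i)) \<noteq> 0"
proof (rule ccontr)
  assume neg: "\<not> ?thesis"
  let ?A = "\<lambda>P :: (nat \<Rightarrow> complex) \<Rightarrow> complex. \<exists>D. polyfun {..<k} D P"
  let ?V = "\<lambda>i. {v :: nat \<Rightarrow> complex. \<forall>j\<ge>i. v j = 0}"
  have "c \<alpha> = 0"
  proof (rule monomials_independent[where A = ?A and V = ?V and f = "\<lambda>i v. v i" and k = k and q = q and c = c and \<alpha> = \<alpha>])
    fix i P Q assume P: "?A P" and Q: "?A Q" and 0: "\<forall>x\<in>?V i. P x * Q x = 0"
    obtain D where D: "polyfun {..<k} D P" using P by (rule exE)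
    obtain D' where D': "polyfun {..<k} D' Q" using Q by (rule exE)
    show "(\<forall>x\<in>?V i. P x = 0) \<or> (\<forall>x\<in>?V i. Q x = 0)"
    proof (rule ccontr)
      assume "\<not> ?thesis"
      then obtain a b where ab: "a \<in> ?V i" "P a \<noteq> 0" "b \<in> ?V i" "Q b \<noteq> 0"
        by (auto simp del: mem_Collect_eq)
      from polyfun_common_nonzero[OF D D', of a b] ab(2,4)
      have "\<exists>t. P (\<lambda>j. a j + t * (b j - a j)) \<noteq> 0 \<and> Q (\<lambda>j. a j + t * (b j - a j)) \<noteq> 0" by simp
      then obtain t where t: "P (\<lambda>j. a j + t * (b j - a j)) \<noteq> 0" "Q (\<lambda>j. a j + t * (b j - a j)) \<noteq> 0"
        by (elim exE conjE) (rule that)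
      have "(\<lambda>j. a j + t * (b j - a j)) \<in> ?V i" using ab by simp
      from bspec[OF 0 this] t show False by simp
    qed
  next
    fix i assume "i < k"
    show "\<exists>x\<in>?V (Suc i). x i \<noteq> 0" by (intro bexI[of _ "\<lambda>j. if j = i then 1 else 0"]) auto
  next
    show "\<forall>x\<in>?V k. (\<Sum>\<alpha>\<in>{..<k} \<rightarrow>\<^sub>E {..q}. c \<alpha> * (\<Prod>i<k. x i ^ \<alpha> i)) = 0"
    proof
      fix v :: "nat \<Rightarrow> complex" assume "v \<in> ?V k"
      then show "(\<Sum>\<alpha>\<in>{..<k} \<rightarrow>\<^sub>E {..q}. c \<alpha> * (\<Prod>i<k. v i ^ \<alpha> i)) = 0"
        using neg[unfolded not_ex, rule_format, of v] by simp
    qed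
  next
    show "?V 0 \<noteq> {}" by (intro ex_in_conv[THEN iffD1] exI[of _ "\<lambda>_. 0"]) simp
  next
    fix P Q assume "?A P" "?A Q"
    then obtain D D' where PQ: "polyfun {..<k} D P" "polyfun {..<k} D' Q"
      by (elim exE) (rule that)
    show "?A (\<lambda>x. P x * Q x)" using polyfun_mult[OF PQ] by (rule exI)
    show "?A (\<lambda>x. P x + Q x)"
      using polyfun_add[OF polyfun_mono[OF PQ(1), of "D + D'"] polyfun_mono[OF PQ(2), of "D + D'"]]
      by (intro exI[of _ "D + D'"]) simp
  next
    show "?A (\<lambda>_. c)" for c by (rule exI[of _ 0]) (rule polyfun_const)
    show "?A (\<lambda>v. v i)" if "i < k" for i using that by (intro exI[of _ 1] polyfun_coord) auto
    show "\<alpha> \<in> {..<k} \<rightarrow>\<^sub>E {..q}" by (rule assms(1))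
  qed auto
  with assms show False by simp
qed

text \<open>The last condition on \<open>\<psi>\<close> says that \<open>U\<close> lies in the
  closure of the image of \<open>\<psi>\<close>. For a chain of length \<open>k\<close> there are
  \<open>(q + 1) ^ k\<close> monomials of degree linear in \<open>q\<close> that are independent on
  its largest member. Pulled back along a parametrisation near a point of the smallest member they
  would satisfy a relation if \<open>k > card J\<close>, and irreducibility extends that relation
  from \<open>U\<close> to the whole largest member.\<close>

lemma variety_dim_le:
  fixes X :: "('i \<Rightarrow> complex) set set" and J :: "'j set"
  assumes J: "finite J" and X: "X \<subseteq> proj_space E"
    and cover: "\<And>L. L \<in> X \<Longrightarrow> \<exists>U D (\<psi> :: ('j \<Rightarrow> complex) \<Rightarrow> 'i \<Rightarrow> complex).
      openin (subtopology (zariski E) X) U \<and> L \<in> U \<and> (\<forall>i. polyfun J D (\<lambda>a. \<psi> a i)) \<and>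
      (\<forall>d g. homogeneous_poly d g \<longrightarrow> (\<forall>a. g (\<psi> a) = 0) \<longrightarrow> vanishes_on g U)"
  shows "variety_dim E X \<le> enat (card J)"
  unfolding variety_dim_def krull_dim_def
proof (rule Sup_least, clarsimp)
  let ?T = "subtopology (zariski E) X"
  fix k and Z :: "nat \<Rightarrow> ('i \<Rightarrow> complex) set set"
  assume Z: "\<forall>i\<le>k. closedin ?T (Z i) \<and> irreducible_in ?T (Z i)" and strict: "\<forall>i<k. Z i \<subset> Z (Suc i)"
  have ZX: "Z i \<subseteq> X" if "i \<le> k" for i
    using Z that closedin_subset by (fastforce simp: topspace_zariski)
  have Zmono: "Z 0 \<subseteq> Z i" if "i \<le> k" for i
    using that
  proof (induction i)
    case (Suc i)
    then show ?case using strict[rule_format, of i] by auto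
  qed simp
  have "Z 0 \<noteq> {}" using Z by (auto simp: irreducible_in_def)
  then obtain L0 where L0: "L0 \<in> Z 0" by blast
  then have "L0 \<in> proj_space E" using ZX[of 0] X by auto
  then obtain x0 where x0: "x0 \<noteq> 0" "L0 = fn.span {x0}" by (rule proj_spaceE)
  \<comment> \<open>\<open>L0\<close> lies in every member of the chain, so this coordinate vanishes
    identically on none of them. It serves both to equalise degrees and to dehomogenise.\<close>
  then obtain i0 where i0: "x0 i0 \<noteq> 0" by (auto simp: fun_eq_iff)
  have "\<exists>p. homogeneous_poly (fst p) (snd p) \<and> vanishes_on (snd p) (Z i) \<and> \<not> vanishes_on (snd p) (Z (Suc i))"
    if "i < k" for i
  proof -
    from strict that obtain L where L: "L \<in> Z (Suc i)" "L \<notin> Z i" by blast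
    then have "L \<in> proj_space E" using ZX[of "Suc i"] X that by auto
    then obtain x where x: "L = fn.span {x}" by (rule proj_spaceE)
    have "closedin ?T (Z i)" using Z that by simp
    then obtain C where C: "closedin (zariski E) C" "Z i = C \<inter> X"
      unfolding closedin_subtopology by blast
    have "fn.span {x} \<notin> C" using L C x ZX[of "Suc i"] that by auto
    with zariski_separation[OF C(1), of x] \<open>L \<in> proj_space E\<close> x
    have "\<exists>d f. homogeneous_poly d f \<and> f x \<noteq> 0 \<and> vanishes_on f C" by simp
    then obtain d f where f: "homogeneous_poly d f" "f x \<noteq> 0" "vanishes_on f C"
      by (elim exE conjE) (rule that)
    have "vanishes_on f (Z i)" using f(3) C(2) by (auto simp: vanishes_on_def)
    moreover have "\<not> vanishes_on f (Z (Suc i))" using f(2) L x vanishes_onD by blast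
    ultimately show ?thesis using f(1) by (intro exI[of _ "(d, f)"]) simp
  qed
  then have "\<forall>i\<in>{..<k}. \<exists>p. homogeneous_poly (fst p) (snd p) \<and> vanishes_on (snd p) (Z i) \<and>
    \<not> vanishes_on (snd p) (Z (Suc i))" by simp
  from bchoice[OF this] obtain p where p: "\<forall>i\<in>{..<k}. homogeneous_poly (fst (p i)) (snd (p i)) \<and>
    vanishes_on (snd (p i)) (Z i) \<and> \<not> vanishes_on (snd (p i)) (Z (Suc i))" by (elim exE) (rule that)
  define e where "e = (\<Sum>i<k. fst (p i))"
  \<comment> \<open>Powers of the coordinate \<open>i0\<close> pad the separating forms to the
    common degree \<open>e\<close>.\<close>
  define F where "F i x = snd (p i) x * x i0 ^ (e - fst (p i))" for i and x :: "'i \<Rightarrow> complex"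
  have coord_power: "homogeneous_poly n (\<lambda>x. x i0 ^ n)" for n
    using homogeneous_poly_power[OF homogeneous_poly.coord[of i0], of n] by simp
  have F: "homogeneous_poly e (F i)" if "i < k" for i
  proof -
    have "fst (p i) \<le> e" unfolding e_def using that by (intro member_le_sum) auto
    moreover have "homogeneous_poly (fst (p i) + (e - fst (p i))) (F i)"
      unfolding F_def using p that by (intro homogeneous_poly.mult coord_power) auto
    ultimately show ?thesis by simp
  qed
  \<comment> \<open>The affine chart of the cone over \<open>Z i\<close>. On it, forms of different
    degrees can be added, as the algebra \<open>?A\<close> requires.\<close>
  define V where "V i = {x. x i0 = 1 \<and> fn.span {x} \<in> Z i}" for i
  have normalise: "fn.span {x} \<in> Z i \<Longrightarrow> x i0 \<noteq> 0 \<Longrightarrow> fscale (1 / x i0) x \<in> V i" for x i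
  proof -
    assume x: "fn.span {x} \<in> Z i" "x i0 \<noteq> 0"
    have "fn.span {fscale (1 / x i0) x} = fn.span {x}"
      using fn.span_image_scale[of "{x}" "\<lambda>_. 1 / x i0"] x(2) by simp
    then show ?thesis using x by (simp add: V_def)
  qed
  have coord_nz: "\<not> vanishes_on (\<lambda>x. x i0 ^ n) (Z i)" if "i \<le> k" for i n
  proof
    assume "vanishes_on (\<lambda>x. x i0 ^ n) (Z i)"
    moreover have "fn.span {x0} \<in> Z i" using Zmono[OF that] L0 x0 by auto
    ultimately have "x0 i0 ^ n = 0" by (rule vanishes_onD)
    with i0 show False by simp
  qed
  have irr: "vanishes_on f (Z i) \<or> vanishes_on g (Z i)"
    if "i \<le> k" "homogeneous_poly d f" "homogeneous_poly d' g" "vanishes_on (\<lambda>x. f x * g x) (Z i)"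
    for i d d' f g
    using that Z by (intro irreducible_in_vanishes_on_mult[OF _ X]) auto
  let ?A = "\<lambda>P :: ('i \<Rightarrow> complex) \<Rightarrow> complex.
    \<exists>d f. homogeneous_poly d f \<and> (\<forall>x. x i0 = 1 \<longrightarrow> P x = f x)"
  have "L0 \<in> X" using L0 ZX[of 0] by auto
  from cover[OF this] obtain U D \<psi> where U: "openin ?T U" "L0 \<in> U"
    and \<psi>: "\<forall>i. polyfun J D (\<lambda>a. \<psi> a i)"
    and van: "\<forall>d g. homogeneous_poly d g \<longrightarrow> (\<forall>a :: 'j \<Rightarrow> complex. g (\<psi> a) = 0) \<longrightarrow> vanishes_on g U"
    by (elim exE conjE) (rule that)
  have bound: "(q + 1) ^ k \<le> (D * (e * (k * q)) + 1) ^ card J" for q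
  proof (rule ccontr)
    assume less: "\<not> ?thesis"
    let ?I = "{..<k} \<rightarrow>\<^sub>E {..q}"
    \<comment> \<open>The power of \<open>x i0\<close> makes all monomials homogeneous of the one
      degree \<open>e * (k * q)\<close>; it equals 1 on \<open>V k\<close>.\<close>
    define G where "G \<alpha> x = x i0 ^ (e * (k * q - (\<Sum>i<k. \<alpha> i))) * (\<Prod>i<k. F i x ^ \<alpha> i)"
      for \<alpha> and x :: "'i \<Rightarrow> complex"
    have G: "homogeneous_poly (e * (k * q)) (G \<alpha>)" if "\<alpha> \<in> ?I" for \<alpha>
    proof -
      have "(\<Sum>i<k. \<alpha> i) \<le> (\<Sum>i<k. q)" using that by (intro sum_mono) auto
      then have "e * (k * q - (\<Sum>i<k. \<alpha> i)) + (\<Sum>i<k. e * \<alpha> i) = e * (k * q)"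
        by (simp add: sum_distrib_left[symmetric] distrib_left[symmetric])
      moreover have "homogeneous_poly (e * (k * q - (\<Sum>i<k. \<alpha> i)) + (\<Sum>i<k. e * \<alpha> i)) (G \<alpha>)"
        unfolding G_def using F
        by (intro homogeneous_poly.mult coord_power homogeneous_poly_prod homogeneous_poly_power) auto
      ultimately show ?thesis by simp
    qed
    have "card ?I = (q + 1) ^ k" by (simp add: card_PiE)
    then have "\<exists>c. (\<exists>\<alpha>\<in>?I. c \<alpha> \<noteq> 0) \<and> (\<forall>a. (\<Sum>\<alpha>\<in>?I. c \<alpha> * G \<alpha> (\<psi> a)) = 0)"
      using less G \<psi> by (intro polyfun_dependent[OF J, where D = "D * (e * (k * q))"] finite_PiE
        homogeneous_poly_compose) auto
    then obtain c where c: "\<exists>\<alpha>\<in>?I. c \<alpha> \<noteq> 0" "\<forall>a. (\<Sum>\<alpha>\<in>?I. c \<alpha> * G \<alpha> (\<psi> a)) = 0"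
      by (elim exE conjE) (rule that)
    let ?g = "\<lambda>x. \<Sum>\<alpha>\<in>?I. c \<alpha> * G \<alpha> x"
    have g: "homogeneous_poly (e * (k * q)) ?g"
      using G by (intro homogeneous_poly_sum homogeneous_poly_cmult)
    have gU: "vanishes_on ?g U" using van[rule_format, OF g] c(2) by simp
    have gZ: "vanishes_on ?g (Z k)"
    proof -
      let ?C = "X \<inter> {L \<in> proj_space E. vanishes_on ?g {L}}"
      have "topspace ?T = X" using X by (auto simp: topspace_zariski)
      then have "closedin ?T (X - U)"
        using closedin_diff[OF closedin_topspace U(1)] by simp
      moreover have "closedin ?T ?C"
        using closedin_vanishing[OF g, of E] by (auto simp: closedin_subtopology)
      \<comment> \<open>The first of these closed sets cannot contain \<open>Z k\<close>, because
        \<open>L0\<close> belongs to both \<open>Z k\<close> and \<open>U\<close>.\<close>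
      moreover have "Z k \<subseteq> (X - U) \<union> ?C"
        using gU ZX[of k] X by (auto simp: vanishes_on_def)
      ultimately have "Z k \<subseteq> X - U \<or> Z k \<subseteq> ?C"
        using Z unfolding irreducible_in_def by blast
      then have "Z k \<subseteq> ?C" using U(2) L0 Zmono[of k] by auto
      then show ?thesis by (auto simp: vanishes_on_def)
    qed
    have "c \<alpha> = 0" if \<alpha>: "\<alpha> \<in> ?I" for \<alpha>
    proof (rule monomials_independent[where A = ?A and V = V and f = F and k = k and q = q and c = c and \<alpha> = \<alpha>])
      show "?A (\<lambda>_. c)" for c by (intro exI[of _ 0] exI[of _ "\<lambda>_. c"]) (simp add: homogeneous_poly.const)
    next
      fix P Q assume "?A P" "?A Q"
      then obtain d f d' g where fg: "homogeneous_poly d f" "\<forall>x. x i0 = 1 \<longrightarrow> P x = f x"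
        "homogeneous_poly d' g" "\<forall>x. x i0 = 1 \<longrightarrow> Q x = g x"
        by (elim exE conjE) (rule that)
      have "homogeneous_poly (d + d') (\<lambda>x. f x * x i0 ^ d' + x i0 ^ d * g x)"
        using fg by (intro homogeneous_poly.add homogeneous_poly.mult coord_power)
      then show "?A (\<lambda>x. P x + Q x)" using fg by (intro exI conjI) auto
      show "?A (\<lambda>x. P x * Q x)"
        using fg homogeneous_poly.mult[OF fg(1,3)]
        by (intro exI[of _ "d + d'"] exI[of _ "\<lambda>x. f x * g x"]) auto
    next
      fix i P Q assume i: "i \<le> k" and "?A P" "?A Q" and 0: "\<forall>x\<in>V i. P x * Q x = 0"
      then obtain d f d' g where fg: "homogeneous_poly d f" "\<forall>x. x i0 = 1 \<longrightarrow> P x = f x"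
        "homogeneous_poly d' g" "\<forall>x. x i0 = 1 \<longrightarrow> Q x = g x"
        by (elim exE conjE) (rule that)
      \<comment> \<open>The factor \<open>x i0\<close> covers the points of \<open>Z i\<close> at
        infinity, which have no representative in \<open>V i\<close>.\<close>
      have gi: "homogeneous_poly (d' + 1) (\<lambda>x. g x * x i0)"
        using fg(3) by (intro homogeneous_poly.mult homogeneous_poly.coord)
      have "vanishes_on (\<lambda>x. f x * (g x * x i0)) (Z i)"
      proof (rule vanishes_onI)
        show "Z i \<subseteq> proj_space E" using ZX[OF i] X by blast
        show "homogeneous_poly (d + (d' + 1)) (\<lambda>x. f x * (g x * x i0))"
          by (rule homogeneous_poly.mult[OF fg(1) gi])
        fix x assume x: "fn.span {x} \<in> Z i"
        show "f x * (g x * x i0) = 0"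
        proof (cases "x i0 = 0")
          case False
          have y: "fscale (1 / x i0) x \<in> V i" by (rule normalise[OF x False])
          then have "f (fscale (1 / x i0) x) * g (fscale (1 / x i0) x) = 0"
            using 0 fg(2,4) by (auto simp: V_def)
          then show ?thesis using False
            unfolding homogeneous_poly_scale[OF fg(1)] homogeneous_poly_scale[OF fg(3)] by simp
        qed simp
      qed
      from irr[OF i fg(1) gi this] have "vanishes_on f (Z i) \<or> vanishes_on (\<lambda>x. g x * x i0) (Z i)" .
      then show "(\<forall>x\<in>V i. P x = 0) \<or> (\<forall>x\<in>V i. Q x = 0)"
        using fg(2,4) vanishes_onD[of _ "Z i"] by (fastforce simp: V_def)
    next
      fix i assume i: "i < k"
      show "?A (F i)" using F[OF i] by blast
      show "V i \<subseteq> V (Suc i)" using strict i by (auto simp: V_def)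
      show "F i x = 0" if "x \<in> V i" for x
        using that p i vanishes_onD[of "snd (p i)" "Z i" x] by (auto simp: F_def V_def)
      show "\<exists>x\<in>V (Suc i). F i x \<noteq> 0"
      proof (rule ccontr)
        assume neg: "\<not> ?thesis"
        have "vanishes_on (\<lambda>x. snd (p i) x * x i0 ^ 1) (Z (Suc i))"
        proof (rule vanishes_onI)
          show "Z (Suc i) \<subseteq> proj_space E" using ZX[of "Suc i"] X i by auto
          show "homogeneous_poly (fst (p i) + 1) (\<lambda>x. snd (p i) x * x i0 ^ 1)"
            using p i by (intro homogeneous_poly.mult coord_power) auto
          fix x assume x: "fn.span {x} \<in> Z (Suc i)"
          show "snd (p i) x * x i0 ^ 1 = 0"
          proof (cases "x i0 = 0")
            case False
            have "F i (fscale (1 / x i0) x) = 0" using neg normalise[OF x False] by blast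
            then show ?thesis using False
              unfolding homogeneous_poly_scale[OF F[OF i]] by (simp add: F_def)
          qed simp
        qed
        with irr[of "Suc i", OF _ _ coord_power[of 1] this] p i coord_nz[of "Suc i" 1]
        show False by auto
      qed
    next
      show "V 0 \<noteq> {}" using normalise[of x0 0] L0 x0 i0 by auto
    next
      show "\<forall>x\<in>V k. (\<Sum>\<alpha>\<in>?I. c \<alpha> * (\<Prod>i<k. F i x ^ \<alpha> i)) = 0"
      proof
        fix x assume x: "x \<in> V k"
        then have "?g x = 0" using gZ vanishes_onD[of ?g "Z k" x] by (simp add: V_def)
        then show "(\<Sum>\<alpha>\<in>?I. c \<alpha> * (\<Prod>i<k. F i x ^ \<alpha> i)) = 0"
          using x by (simp add: G_def V_def)
      qed
    qed (use \<alpha> in auto)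
    with c(1) show False by blast
  qed
  show "k \<le> card J"
  proof (rule le_if_power_le_power)
    fix q
    have "D * (e * (k * q)) + 1 \<le> (D * e * k + 1) * (q + 1)" by (simp add: algebra_simps)
    then show "(q + 1) ^ k \<le> ((D * e * k + 1) * (q + 1)) ^ card J"
      using bound[of q] power_mono order.trans by blast
  qed
qed

section \<open>Lower bounds for dimensions\<close>

definition cutoff :: "nat \<Rightarrow> (nat \<Rightarrow> complex) \<Rightarrow> nat \<Rightarrow> complex" where
  "cutoff i a = (\<lambda>j. if j < i then a j else 0)"

lemma cutoff_cutoff: "i \<le> k \<Longrightarrow> cutoff k (cutoff i a) = cutoff i a"
  by (auto simp: cutoff_def)

lemma polyfun_cutoff:
  assumes "polyfun {..<k} D f" shows "polyfun {..<i} (D * k) (\<lambda>a. f (cutoff i a))"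
proof -
  have "polyfun {..<i} 1 (\<lambda>a. cutoff i a j)" for j
    using polyfun_coord[of "{..<i}" j] by (cases "j < i") (simp_all add: cutoff_def polyfun_const)
  from polyfun_compose[where \<theta> = "cutoff i", OF assms this] show ?thesis by simp
qed

text \<open>Strictness of one step of the chain. The \<open>i + 1\<close> forms \<open>l j\<close>,
  homogenised by \<open>lz\<close>, have more monomials than \<open>i\<close> parameters can keep
  independent, which gives a form \<open>f\<close> vanishing on the smaller image. On the larger one
  \<open>l j\<close> starts with the coordinate \<open>v j\<close> while \<open>lz\<close> starts
  with 1, so the lowest-order part of \<open>f\<close> along a line through the origin is a nonzero
  polynomial in \<open>v\<close>.\<close>

lemma ex_vanishing_on_truncation:
  fixes \<psi> :: "(nat \<Rightarrow> complex) \<Rightarrow> 'i \<Rightarrow> complex"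
  assumes poly: "\<And>x. polyfun {..<k} D (\<lambda>a. \<psi> a x)" and i: "i < k"
    and lz: "homogeneous_poly 1 lz" "lz (\<psi> (\<lambda>_. 0)) = 1"
    and l: "\<And>j. j < k \<Longrightarrow> homogeneous_poly 1 (l j)" "\<And>j. j < k \<Longrightarrow> l j (\<psi> (\<lambda>_. 0)) = 0"
    and deriv: "\<And>j v. j < k \<Longrightarrow> ((\<lambda>\<tau>. l j (\<psi> (\<lambda>x. \<tau> * v x))) has_field_derivative v j) (at 0)"
  shows "\<exists>d f. homogeneous_poly d f \<and> (\<forall>a. f (\<psi> (cutoff i a)) = 0) \<and>
    (\<exists>a. f (\<psi> (cutoff (Suc i) a)) \<noteq> 0)"
proof -
  \<comment> \<open>The pullbacks have degree at most \<open>D * k * d\<close> in each variable, and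
    \<open>D * k * d + 1 <= C * (q + 1)\<close>. With \<open>q = C ^ i\<close> the
    \<open>i\<close>-th power of the right-hand side is \<open>q * (q + 1) ^ i\<close>, just below
    the number \<open>(q + 1) ^ Suc i\<close> of monomials.\<close>
  define C where "C = (i + 1) * (D * k) + 1"
  define q where "q = C ^ i"
  define d where "d = (i + 1) * q"
  let ?I = "{..<Suc i} \<rightarrow>\<^sub>E {..q}"
  let ?s = "\<lambda>\<alpha>. \<Sum>j<Suc i. \<alpha> j :: nat"
  define F where "F \<alpha> x = lz x ^ (d - ?s \<alpha>) * (\<Prod>j<Suc i. l j x ^ \<alpha> j)" for \<alpha> x
  have F: "homogeneous_poly d (F \<alpha>)" if "\<alpha> \<in> ?I" for \<alpha>
  proof -
    have "?s \<alpha> \<le> (\<Sum>j<Suc i. q)" using that by (intro sum_mono) auto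
    then have "1 * (d - ?s \<alpha>) + (\<Sum>j<Suc i. 1 * \<alpha> j) = d" by (simp add: d_def)
    moreover have "homogeneous_poly (1 * (d - ?s \<alpha>) + (\<Sum>j<Suc i. 1 * \<alpha> j)) (F \<alpha>)"
      unfolding F_def using i lz l
      by (intro homogeneous_poly.mult homogeneous_poly_prod homogeneous_poly_power) auto
    ultimately show ?thesis by simp
  qed
  have "D * k * d + 1 \<le> C * (q + 1)" by (simp add: C_def d_def algebra_simps)
  then have "(D * k * d + 1) ^ i \<le> (C * (q + 1)) ^ i" by (rule power_mono) simp
  also have "\<dots> = q * (q + 1) ^ i" by (simp only: q_def power_mult_distrib)
  also have "\<dots> < (q + 1) ^ Suc i" by simp
  finally have "(D * k * d + 1) ^ card {..<i} < (q + 1) ^ Suc i" by (simp only: card_lessThan)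
  moreover have "card ?I = (q + 1) ^ Suc i" by (simp add: card_PiE)
  ultimately have card_less: "(D * k * d + 1) ^ card {..<i} < card ?I" by (simp only:)
  have fin: "finite ?I" by (intro finite_PiE) auto
  have "polyfun {..<i} (D * k * d) (\<lambda>a. F \<alpha> (\<psi> (cutoff i a)))" if "\<alpha> \<in> ?I" for \<alpha>
    by (rule homogeneous_poly_compose[where \<psi> = "\<lambda>a. \<psi> (cutoff i a)", OF F[OF that] polyfun_cutoff[OF poly]])
  from polyfun_dependent[where F = "\<lambda>\<alpha> a. F \<alpha> (\<psi> (cutoff i a))", OF finite_lessThan fin card_less this]
  have "\<exists>c. (\<exists>\<alpha>\<in>?I. c \<alpha> \<noteq> 0) \<and> (\<forall>a. (\<Sum>\<alpha>\<in>?I. c \<alpha> * F \<alpha> (\<psi> (cutoff i a))) = 0)"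
    by simp
  then obtain c where c: "\<exists>\<alpha>\<in>?I. c \<alpha> \<noteq> 0" "\<forall>a. (\<Sum>\<alpha>\<in>?I. c \<alpha> * F \<alpha> (\<psi> (cutoff i a))) = 0"
    by (elim exE conjE) (rule that)
  let ?f = "\<lambda>x. \<Sum>\<alpha>\<in>?I. c \<alpha> * F \<alpha> x"
  define M where "M = ?s ` {\<alpha> \<in> ?I. c \<alpha> \<noteq> 0}"
  \<comment> \<open>The least total degree of a monomial that occurs in the relation; the
    coefficients \<open>?c\<close> single out this homogeneous part, in which
    \<open>\<alpha>0\<close> occurs.\<close>
  define s where "s = Min M"
  have M: "finite M" "M \<noteq> {}" using fin c(1) by (auto simp: M_def)
  have "s \<in> M" unfolding s_def using M by (rule Min_in)
  then obtain \<alpha>0 where \<alpha>0: "\<alpha>0 \<in> ?I" "c \<alpha>0 \<noteq> 0" "?s \<alpha>0 = s" by (auto simp: M_def)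
  have s_le: "s \<le> ?s \<alpha>" if "\<alpha> \<in> ?I" "c \<alpha> \<noteq> 0" for \<alpha>
    unfolding s_def using M that by (intro Min_le) (auto simp: M_def)
  let ?c = "\<lambda>\<alpha>. if ?s \<alpha> = s then c \<alpha> else 0"
  from monomial_sum_nonzero[of \<alpha>0 "Suc i" q ?c] \<alpha>0
  have "\<exists>v. (\<forall>j\<ge>Suc i. v j = 0) \<and> (\<Sum>\<alpha>\<in>?I. ?c \<alpha> * (\<Prod>j<Suc i. v j ^ \<alpha> j)) \<noteq> 0" by simp
  then obtain v where v: "\<forall>j\<ge>Suc i. v j = 0" "(\<Sum>\<alpha>\<in>?I. ?c \<alpha> * (\<Prod>j<Suc i. v j ^ \<alpha> j)) \<noteq> 0"
    by (elim exE conjE) (rule that)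
  let ?x = "\<lambda>\<tau>. \<psi> (\<lambda>x. \<tau> * v x)"
  have "\<exists>\<tau>. ?f (?x \<tau>) \<noteq> 0"
  proof (rule ccontr)
    assume "\<not> ?thesis"
    then have f0: "?f (?x \<tau>) = 0" for \<tau> by blast
    \<comment> \<open>A term of the relation divided by \<open>\<tau> ^ s\<close>. As
      \<open>\<tau>\<close> tends to 0, terms of total degree \<open>s\<close> tend to
      \<open>c \<alpha>\<close> times the monomial in \<open>v\<close>, and all others to 0.\<close>
    define G where "G \<alpha> \<tau> = c \<alpha> * (lz (?x \<tau>) ^ (d - ?s \<alpha>) * (\<Prod>j<Suc i. (l j (?x \<tau>) / \<tau>) ^ \<alpha> j) *
      \<tau> ^ (?s \<alpha> - s))" for \<alpha> \<tau>
    have G: "c \<alpha> * F \<alpha> (?x \<tau>) = \<tau> ^ s * G \<alpha> \<tau>" if "\<alpha> \<in> ?I" "\<tau> \<noteq> 0" for \<alpha> \<tau>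
    proof (cases "c \<alpha> = 0")
      case False
      have "(\<Prod>j<Suc i. l j (?x \<tau>) ^ \<alpha> j) = (\<Prod>j<Suc i. (l j (?x \<tau>) / \<tau>) ^ \<alpha> j * \<tau> ^ \<alpha> j)"
        using that(2) by (intro prod.cong) (simp_all add: power_divide)
      also have "\<dots> = (\<Prod>j<Suc i. (l j (?x \<tau>) / \<tau>) ^ \<alpha> j) * \<tau> ^ ?s \<alpha>"
        by (simp only: prod.distrib power_sum)
      also have "\<tau> ^ ?s \<alpha> = \<tau> ^ s * \<tau> ^ (?s \<alpha> - s)"
        using s_le[OF that(1) False] by (simp only: power_add[symmetric] le_add_diff_inverse)
      finally show ?thesis by (simp only: F_def G_def mult_ac)
    qed (simp add: G_def)
    have "(\<Sum>\<alpha>\<in>?I. G \<alpha> \<tau>) = 0" if "\<tau> \<noteq> 0" for \<tau>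
    proof -
      have "\<tau> ^ s * (\<Sum>\<alpha>\<in>?I. G \<alpha> \<tau>) = ?f (?x \<tau>)"
        unfolding sum_distrib_left using G that by (intro sum.cong) auto
      then show ?thesis using f0[of \<tau>] that by simp
    qed
    then have lim0: "((\<lambda>\<tau>. \<Sum>\<alpha>\<in>?I. G \<alpha> \<tau>) \<longlongrightarrow> 0) (at 0)"
      by (intro tendsto_eventually) (auto simp: eventually_at_filter)
    have lim1: "((\<lambda>\<tau>. \<Sum>\<alpha>\<in>?I. G \<alpha> \<tau>) \<longlongrightarrow> (\<Sum>\<alpha>\<in>?I. ?c \<alpha> * (\<Prod>j<Suc i. v j ^ \<alpha> j))) (at 0)"
    proof (rule tendsto_sum)
      fix \<alpha> assume \<alpha>: "\<alpha> \<in> ?I"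
      obtain \<kappa> where "\<forall>v. ((\<lambda>\<tau>. lz (\<psi> (\<lambda>j. \<tau> * v j))) has_field_derivative (\<Sum>j<k. \<kappa> j * v j)) (at 0)"
        using polyfun_deriv_linear[OF homogeneous_poly_compose[where \<psi> = \<psi>, OF lz(1) poly]]
        by (elim exE meta_impE) (simp, rule that)
      then have "isCont (\<lambda>\<tau>. lz (?x \<tau>)) 0" by (meson DERIV_isCont)
      then have t0: "((\<lambda>\<tau>. lz (?x \<tau>)) \<longlongrightarrow> 1) (at 0)" using lz(2) by (simp add: isCont_def)
      have tj: "((\<lambda>\<tau>. l j (?x \<tau>) / \<tau>) \<longlongrightarrow> v j) (at 0)" if "j \<in> {..<Suc i}" for j
        using deriv[of j v] l(2)[of j] that i by (simp add: has_field_derivative_iff)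
      have "(G \<alpha> \<longlongrightarrow> c \<alpha> * (1 ^ (d - ?s \<alpha>) * (\<Prod>j<Suc i. v j ^ \<alpha> j) * 0 ^ (?s \<alpha> - s))) (at 0)"
        unfolding G_def by (intro tendsto_mult tendsto_const tendsto_power tendsto_prod t0 tj tendsto_ident_at)
      moreover have "c \<alpha> * (1 ^ (d - ?s \<alpha>) * (\<Prod>j<Suc i. v j ^ \<alpha> j) * 0 ^ (?s \<alpha> - s)) =
          ?c \<alpha> * (\<Prod>j<Suc i. v j ^ \<alpha> j)"
      proof (cases "c \<alpha> = 0 \<or> ?s \<alpha> = s")
        case False
        then have "?s \<alpha> - s \<noteq> 0" using s_le[OF \<alpha>] by auto
        then show ?thesis using False by (simp only: power_0_left if_False) simp
      qed auto
      ultimately show "(G \<alpha> \<longlongrightarrow> ?c \<alpha> * (\<Prod>j<Suc i. v j ^ \<alpha> j)) (at 0)" by (simp only:)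
    qed
    from tendsto_unique[OF _ lim1 lim0] v(2) show False by simp
  qed
  then obtain \<tau> where \<tau>: "?f (?x \<tau>) \<noteq> 0" by (rule exE)
  have "cutoff (Suc i) (\<lambda>x. \<tau> * v x) = (\<lambda>x. \<tau> * v x)"
    using v(1) by (auto simp: cutoff_def fun_eq_iff)
  with \<tau> have "?f (\<psi> (cutoff (Suc i) (\<lambda>x. \<tau> * v x))) \<noteq> 0" by simp
  then have "\<exists>a. ?f (\<psi> (cutoff (Suc i) a)) \<noteq> 0"
    by (rule exI[of _ "\<lambda>x. \<tau> * v x"])
  moreover have "homogeneous_poly d ?f"
    using F by (intro homogeneous_poly_sum homogeneous_poly_cmult)
  ultimately show ?thesis using c(2) by (intro exI[of _ d] exI[of _ ?f] conjI)
qed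

text \<open>\<open>lz\<close> normalises the base point and the \<open>l j\<close> invert
  \<open>\<psi>\<close> to first order there. The closures of the images of the first
  \<open>i\<close> coordinate directions, for \<open>i <= k\<close>, form the chain.\<close>

lemma variety_dim_ge:
  fixes \<psi> :: "(nat \<Rightarrow> complex) \<Rightarrow> 'i \<Rightarrow> complex"
  assumes Y: "closedin (zariski E) Y" and mem: "\<And>a. \<psi> a \<noteq> 0 \<Longrightarrow> fn.span {\<psi> a} \<in> Y"
    and poly: "\<And>x. polyfun {..<k} D (\<lambda>a. \<psi> a x)"
    and lz: "homogeneous_poly 1 lz" "lz (\<psi> (\<lambda>_. 0)) = 1"
    and l: "\<And>j. j < k \<Longrightarrow> homogeneous_poly 1 (l j)" "\<And>j. j < k \<Longrightarrow> l j (\<psi> (\<lambda>_. 0)) = 0"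
    and deriv: "\<And>j v. j < k \<Longrightarrow> ((\<lambda>\<tau>. l j (\<psi> (\<lambda>x. \<tau> * v x))) has_field_derivative v j) (at 0)"
  shows "enat k \<le> variety_dim E Y"
proof -
  define P where "P i = {fn.span {\<psi> (cutoff i a)} | a. \<psi> (cutoff i a) \<noteq> 0}" for i
  define Z where "Z i = zariski E closure_of P i" for i
  let ?T = "subtopology (zariski E) Y"
  have YE: "Y \<subseteq> proj_space E" using closedin_subset[OF Y] by (simp add: topspace_zariski)
  have PY: "P i \<subseteq> Y" for i using mem by (auto simp: P_def)
  have ZY: "Z i \<subseteq> Y" for i unfolding Z_def using PY Y by (rule closure_of_minimal)
  have PZ: "P i \<subseteq> Z i" for i
    unfolding Z_def using PY YE by (intro closure_of_subset) (auto simp: topspace_zariski)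
  have "\<psi> (\<lambda>_. 0) \<noteq> 0"
  proof
    assume "\<psi> (\<lambda>_. 0) = 0"
    then show False using lz(2) homogeneous_poly_scale[OF lz(1), of 0 "\<lambda>_. 0"] by (simp add: zero_fun_def)
  qed
  then have nz: "\<psi> (cutoff i (\<lambda>_. 0)) \<noteq> 0" for i by (simp add: cutoff_def)
  have irr: "irreducible_in ?T (Z i)" for i
  proof -
    have "irreducible_in (zariski E) (P i)"
      unfolding P_def
      by (rule irreducible_in_param[where \<psi> = "\<lambda>a. \<psi> (cutoff i a)", OF polyfun_cutoff[OF poly] _ nz])
        (use PY[of i] YE in \<open>auto simp: P_def\<close>)
    then show ?thesis
      unfolding Z_def by (intro irreducible_in_subtopology irreducible_in_closure ZY[unfolded Z_def])
  qed
  have cl: "closedin ?T (Z i)" for i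
    unfolding closedin_subtopology using ZY[of i] by (intro exI[of _ "Z i"]) (auto simp: Z_def)
  have "Z i \<subset> Z (Suc i)" if "i < k" for i
  proof -
    have "P i \<subseteq> P (Suc i)"
    proof
      fix L assume "L \<in> P i"
      then obtain a where "L = fn.span {\<psi> (cutoff i a)}" "\<psi> (cutoff i a) \<noteq> 0"
        by (auto simp: P_def)
      then show "L \<in> P (Suc i)" unfolding P_def mem_Collect_eq
        by (intro exI[of _ "cutoff i a"]) (simp add: cutoff_cutoff)
    qed
    then have sub: "Z i \<subseteq> Z (Suc i)" unfolding Z_def by (rule closure_of_mono)
    have "\<exists>d f. homogeneous_poly d f \<and> (\<forall>a. f (\<psi> (cutoff i a)) = 0) \<and>
        (\<exists>a. f (\<psi> (cutoff (Suc i) a)) \<noteq> 0)"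
      using poly that lz l deriv by (rule ex_vanishing_on_truncation)
    then obtain d f a where f: "homogeneous_poly d f" "\<forall>a. f (\<psi> (cutoff i a)) = 0"
      "f (\<psi> (cutoff (Suc i) a)) \<noteq> 0" by (elim exE conjE) (rule that)
    have "f 0 = 0"
      using homogeneous_poly_scale[OF f(1), of 0 "\<psi> (cutoff i a)"] f(2) by (simp add: zero_fun_def)
    then have "\<psi> (cutoff (Suc i) a) \<noteq> 0" using f(3) by auto
    then have "fn.span {\<psi> (cutoff (Suc i) a)} \<in> Z (Suc i)"
      using PZ[of "Suc i"] by (auto simp: P_def)
    moreover have "vanishes_on f (Z i)"
      unfolding Z_def
    proof (rule vanishes_on_closure[OF f(1)])
      show "P i \<subseteq> proj_space E" using PY YE by blast
      show "vanishes_on f (P i)"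
        unfolding vanishes_on_def P_def using f(1,2) homogeneous_poly_span_zero by blast
    qed
    then have "fn.span {\<psi> (cutoff (Suc i) a)} \<notin> Z i" using f(3) vanishes_onD by blast
    ultimately show ?thesis using sub by blast
  qed
  then show ?thesis
    unfolding variety_dim_def krull_dim_def using cl irr
    by (intro Sup_upper CollectI exI[of _ k] conjI exI[of _ Z]) auto
qed

lemma homogeneous_poly_linear_combination:
  assumes "homogeneous_poly 1 f"
  shows "f (\<lambda>x. \<Sum>j\<in>A. c j * g j x) = (\<Sum>j\<in>A. c j * f (g j))"
proof -
  have lin: "f (x + y) = f x + f y" "f (fscale r x) = r * f x" for x y r
    using homogeneous_poly_linear[OF assms] unfolding Vector_Spaces.linear_iff by blast+
  have f0: "f (\<lambda>x. 0) = 0" using lin(2)[of 0 "\<lambda>x. 0"] by simp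
  show ?thesis
  proof (induction A rule: infinite_finite_induct)
    case (insert a A)
    have "f (\<lambda>x. \<Sum>j\<in>insert a A. c j * g j x) = f (fscale (c a) (g a) + (\<lambda>x. \<Sum>j\<in>A. c j * g j x))"
      using insert by (intro arg_cong[of _ _ f]) (simp add: fun_eq_iff)
    then show ?case using insert by (simp add: lin)
  qed (simp_all add: f0)
qed

section \<open>Secant varieties\<close>

lemma has_field_derivative_sum:
  fixes f :: "'b \<Rightarrow> complex \<Rightarrow> complex"
  assumes "\<And>j. j \<in> A \<Longrightarrow> (f j has_field_derivative f' j) (at x)"
  shows "((\<lambda>\<tau>. \<Sum>j\<in>A. f j \<tau>) has_field_derivative (\<Sum>j\<in>A. f' j)) (at x)"
  using assms by (induction A rule: infinite_finite_induct) (auto intro!: derivative_eq_intros)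

text \<open>Terracini's lemma: near \<open>(\<Phi> 0 0, \<dots>, \<Phi> (h - 1) 0)\<close> the secant variety is parametrised by
  \<open>\<Phi> 0 a\<^sub>0 + \<Sum>\<^sub>j (1 + c\<^sub>j) \<Phi> j a\<^sub>j\<close>, where \<open>c\<^sub>j\<close> is the coordinate \<open>(j, None)\<close>.\<close>

lemma variety_dim_secant_ge:
  fixes \<Phi> :: "nat \<Rightarrow> ('j \<Rightarrow> complex) \<Rightarrow> 'i \<Rightarrow> complex"
    and L :: "nat \<Rightarrow> 'j \<Rightarrow> ('i \<Rightarrow> complex) \<Rightarrow> complex" and C :: "nat \<Rightarrow> ('i \<Rightarrow> complex) \<Rightarrow> complex"
  assumes J: "finite J" and E: "fn.subspace E" and X: "X \<subseteq> proj_space E" and h: "h \<ge> 1"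
    and poly: "\<And>j x. polyfun J D (\<lambda>a. \<Phi> j a x)"
    and mem: "\<And>j a. j < h \<Longrightarrow> fn.span {\<Phi> j a} \<in> X"
    and L: "\<And>j i. j < h \<Longrightarrow> i \<in> J \<Longrightarrow> homogeneous_poly 1 (L j i)"
    and Lz: "\<And>j i j'. j < h \<Longrightarrow> i \<in> J \<Longrightarrow> j' < h \<Longrightarrow> L j i (\<Phi> j' (\<lambda>_. 0)) = 0"
    and Ld: "\<And>j i j' v. j < h \<Longrightarrow> i \<in> J \<Longrightarrow> j' < h \<Longrightarrow>
      ((\<lambda>\<tau>. L j i (\<Phi> j' (\<lambda>x. \<tau> * v x))) has_field_derivative (if j' = j then v i else 0)) (at 0)"
    and C: "\<And>j. j < h \<Longrightarrow> homogeneous_poly 1 (C j)"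
    and Cz: "\<And>j j'. j < h \<Longrightarrow> j' < h \<Longrightarrow> C j (\<Phi> j' (\<lambda>_. 0)) = (if j' = j then 1 else 0)"
    and Cd: "\<And>j j' v. j < h \<Longrightarrow> j' < h \<Longrightarrow> j' \<noteq> j \<Longrightarrow>
      ((\<lambda>\<tau>. C j (\<Phi> j' (\<lambda>x. \<tau> * v x))) has_field_derivative 0) (at 0)"
  shows "enat (card J * h + h - 1) \<le> variety_dim E (secant_variety E h X)"
proof -
  have "\<forall>j\<in>{..<h}. \<exists>\<kappa>. \<forall>v. ((\<lambda>\<tau>. C j (\<Phi> j (\<lambda>x. \<tau> * v x))) has_field_derivative
    (\<Sum>i\<in>J. \<kappa> i * v i)) (at 0)"
  proof
    fix j assume "j \<in> {..<h}"
    then have "homogeneous_poly 1 (C j)" using C by simp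
    from polyfun_deriv_linear[OF homogeneous_poly_compose[where \<psi> = "\<Phi> j", OF this poly] J]
    show "\<exists>\<kappa>. \<forall>v. ((\<lambda>\<tau>. C j (\<Phi> j (\<lambda>x. \<tau> * v x))) has_field_derivative
      (\<Sum>i\<in>J. \<kappa> i * v i)) (at 0)" .
  qed
  from bchoice[OF this] obtain \<kappa> where \<kappa>: "\<forall>j\<in>{..<h}. \<forall>v.
    ((\<lambda>\<tau>. C j (\<Phi> j (\<lambda>x. \<tau> * v x))) has_field_derivative (\<Sum>i\<in>J. \<kappa> j i * v i)) (at 0)"
    by (elim exE) (rule that)
  \<comment> \<open>The derivative of \<open>C j\<close> at its own point is some unknown gradient.
    Subtracting the \<open>L j i\<close> weighted by it kills this derivative, and changes neither
    the values nor the derivatives at the other points.\<close>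
  define C' where "C' j x = C j x + (- 1) * (\<Sum>i\<in>J. \<kappa> j i * L j i x)" for j x
  have C': "homogeneous_poly 1 (C' j)" if "j < h" for j
    unfolding C'_def using that L C
    by (intro homogeneous_poly.add homogeneous_poly_cmult homogeneous_poly_sum) auto
  have C'z: "C' j (\<Phi> j' (\<lambda>_. 0)) = (if j' = j then 1 else 0)" if "j < h" "j' < h" for j j'
    using that by (simp add: C'_def Cz Lz)
  have C'd: "((\<lambda>\<tau>. C' j (\<Phi> j' (\<lambda>x. \<tau> * v x))) has_field_derivative 0) (at 0)"
    if "j < h" "j' < h" for j j' v
  proof -
    have "((\<lambda>\<tau>. C j (\<Phi> j' (\<lambda>x. \<tau> * v x))) has_field_derivative
        (\<Sum>i\<in>J. \<kappa> j i * (if j' = j then v i else 0))) (at 0)"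
      using \<kappa> Cd[OF that] that by (cases "j' = j") simp_all
    moreover have "((\<lambda>\<tau>. (- 1) * (\<Sum>i\<in>J. \<kappa> j i * L j i (\<Phi> j' (\<lambda>x. \<tau> * v x)))) has_field_derivative
        (- 1) * (\<Sum>i\<in>J. \<kappa> j i * (if j' = j then v i else 0))) (at 0)"
      using that by (intro DERIV_cmult has_field_derivative_sum Ld)
    ultimately have "((\<lambda>\<tau>. C j (\<Phi> j' (\<lambda>x. \<tau> * v x)) +
        (- 1) * (\<Sum>i\<in>J. \<kappa> j i * L j i (\<Phi> j' (\<lambda>x. \<tau> * v x)))) has_field_derivative
        (\<Sum>i\<in>J. \<kappa> j i * (if j' = j then v i else 0)) +
        (- 1) * (\<Sum>i\<in>J. \<kappa> j i * (if j' = j then v i else 0))) (at 0)"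
      by (rule DERIV_add)
    then show ?thesis unfolding C'_def by simp
  qed
  \<comment> \<open>Rescaling the sum does not change its projective point, so the coefficient of
    the first summand is fixed to 1 and its coordinate removed. This is the \<open>- 1\<close> in
    the expected dimension.\<close>
  define K where "K = {..<h} \<times> insert None (Some ` J) - {(0, None)}"
  define k where "k = card K"
  have "finite K" using J by (simp add: K_def)
  have k: "k = card J * h + h - 1"
    using J h by (simp add: k_def K_def card_cartesian_product card_image algebra_simps)
  obtain g where g: "bij_betw g {..<k} K"
    using ex_bij_betw_nat_finite[OF \<open>finite K\<close>] unfolding k_def atLeast0LessThan
    by (rule exE)
  define \<theta> where "\<theta> a p = (if p \<in> K then a (inv_into {..<k} g p) else 0)" for a :: "nat \<Rightarrow> complex" and p
  have inv: "inv_into {..<k} g p < k" if "p \<in> K" for p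
    using bij_betwE[OF bij_betw_inv_into[OF g]] that by blast
  have gK: "g m \<in> K" if "m < k" for m using bij_betwE[OF g] that by blast
  have \<theta>g: "\<theta> v (g m) = v m" if "m < k" for v m
    using gK[OF that] bij_betw_inv_into_left[OF g, of m] that by (simp add: \<theta>_def)
  have \<theta>_poly: "polyfun {..<k} 1 (\<lambda>a. \<theta> a p)" for p
  proof (cases "p \<in> K")
    case True
    then show ?thesis using polyfun_coord[of "{..<k}" "inv_into {..<k} g p"] inv[OF True]
      by (simp add: \<theta>_def)
  qed (simp add: \<theta>_def polyfun_const)
  have \<theta>_scale: "\<theta> (\<lambda>x. \<tau> * v x) = (\<lambda>p. \<tau> * \<theta> v p)" for \<tau> v by (auto simp: \<theta>_def)
  define r where "r a j = (if j = 0 then 1 else 1 + \<theta> a (j, None))" for a and j :: nat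
  define w where "w a j i = \<theta> a (j, Some i)" for a j i
  define \<psi> where "\<psi> a x = (\<Sum>j<h. r a j * \<Phi> j (w a j) x)" for a x
  \<comment> \<open>At the base point, the sum of all \<open>\<Phi> j\<close> at 0, both
    \<open>C' j\<close> and \<open>C' 0\<close> are 1. Their difference vanishes there, and its
    derivative is the coefficient with index \<open>j\<close>.\<close>
  define B where "B j x = C' j x + (- 1) * C' 0 x" for j x
  have B: "homogeneous_poly 1 (B j)" if "j < h" for j
    unfolding B_def using that C' h by (intro homogeneous_poly.add homogeneous_poly_cmult) auto
  have Bz: "B j (\<Phi> j' (\<lambda>_. 0)) = (if j' = j then 1 else 0) - (if j' = 0 then 1 else 0)"
    if "j < h" "j' < h" for j j'
    using C'z[OF that] C'z[of 0 j'] that h by (simp add: B_def)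
  have Bd: "((\<lambda>\<tau>. B j (\<Phi> j' (\<lambda>x. \<tau> * v x))) has_field_derivative 0) (at 0)"
    if "j < h" "j' < h" for j j' v
    using DERIV_add[OF C'd[OF that] DERIV_cmult[OF C'd[of 0 j'], of "- 1"]] that h
    by (simp add: B_def)
  define l where "l p = (case snd p of None \<Rightarrow> B (fst p) | Some i \<Rightarrow> L (fst p) i)" for p
  have lin: "f (\<psi> a) = (\<Sum>j<h. r a j * f (\<Phi> j (w a j)))" if "homogeneous_poly 1 f" for f a
    using homogeneous_poly_linear_combination[OF that, of "r a" "\<lambda>j. \<Phi> j (w a j)" "{..<h}"]
    by (simp only: \<psi>_def[abs_def])
  have zero: "r (\<lambda>_. 0) j = 1" "w (\<lambda>_. 0) j = (\<lambda>_. 0)" for j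
    by (auto simp: r_def w_def \<theta>_def)
  have w_scale: "w (\<lambda>x. \<tau> * v x) j = (\<lambda>i. \<tau> * w v j i)" for \<tau> v j
    by (simp add: fun_eq_iff w_def \<theta>_scale)
  have deriv: "((\<lambda>\<tau>. f (\<psi> (\<lambda>x. \<tau> * v x))) has_field_derivative
      (\<Sum>j<h. (if j = 0 then 0 else \<theta> v (j, None)) * f (\<Phi> j (\<lambda>_. 0)) + f' j)) (at 0)"
    if f: "homogeneous_poly 1 f" and f': "\<And>j. j < h \<Longrightarrow>
      ((\<lambda>\<tau>. f (\<Phi> j (\<lambda>i. \<tau> * w v j i))) has_field_derivative f' j) (at 0)" for f f' v
  proof -
    have "((\<lambda>\<tau>. r (\<lambda>x. \<tau> * v x) j * f (\<Phi> j (w (\<lambda>x. \<tau> * v x) j))) has_field_derivative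
        (if j = 0 then 0 else \<theta> v (j, None)) * f (\<Phi> j (\<lambda>_. 0)) + f' j) (at 0)" if "j < h" for j
    proof -
      have "((\<lambda>\<tau>. r (\<lambda>x. \<tau> * v x) j) has_field_derivative (if j = 0 then 0 else \<theta> v (j, None))) (at 0)"
        by (cases "j = 0") (auto simp: r_def \<theta>_scale intro!: derivative_eq_intros)
      from DERIV_mult'[OF this f'[OF that]] show ?thesis
        by (simp only: w_scale zero mult_zero_left mult_1 add.commute[of "f' j"])
    qed
    then show ?thesis unfolding lin[OF f] by (intro has_field_derivative_sum) auto
  qed
  have K_cases: "(\<exists>j i. p = (j, Some i) \<and> j < h \<and> i \<in> J) \<or> (\<exists>j. p = (j, None) \<and> j < h \<and> j \<noteq> 0)"
    if "p \<in> K" for p using that by (auto simp: K_def)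
  let ?E = "secant_variety E h X"
  have "enat k \<le> variety_dim E ?E"
  proof (rule variety_dim_ge[where \<psi> = \<psi> and lz = "C' 0" and l = "\<lambda>m. l (g m)"])
    show "closedin (zariski E) ?E" unfolding secant_variety_def by (rule closedin_closure_of)
    show "fn.span {\<psi> a} \<in> ?E" if "\<psi> a \<noteq> 0" for a
    proof -
      define p where "p j = fn.span {\<Phi> j (w a j)}" for j
      have p: "p \<in> {..<h} \<rightarrow> X" using mem by (auto simp: p_def)
      have "\<psi> a = (\<Sum>j<h. fscale (r a j) (\<Phi> j (w a j)))"
        by (auto simp: fun_eq_iff sum_fun_apply \<psi>_def)
      also have "\<dots> \<in> linear_span (p ` {..<h})"
        unfolding linear_span_def
        by (intro fn.span_sum fn.span_scale fn.span_base) (auto simp: p_def intro: fn.span_base)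
      finally have "fn.span {\<psi> a} \<in> proj_space (linear_span (p ` {..<h}))"
        using that unfolding linear_span_def by (intro proj_spaceI fn.subspace_span)
      then have mem': "fn.span {\<psi> a} \<in> (\<Union>p\<in>{..<h} \<rightarrow> X. proj_space (linear_span (p ` {..<h})))"
        using p by blast
      have "(\<Union>p\<in>{..<h} \<rightarrow> X. proj_space (linear_span (p ` {..<h}))) \<subseteq> proj_space E"
      proof (rule UN_least)
        fix p assume p: "p \<in> {..<h} \<rightarrow> X"
        have "linear_span (p ` {..<h}) \<subseteq> E"
          unfolding linear_span_def
        proof (rule fn.span_minimal[OF _ E])
          show "\<Union> (p ` {..<h}) \<subseteq> E" using p X by (force simp: proj_space_def)
        qed
        then show "proj_space (linear_span (p ` {..<h})) \<subseteq> proj_space E"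
          by (auto simp: proj_space_def)
      qed
      then have "(\<Union>p\<in>{..<h} \<rightarrow> X. proj_space (linear_span (p ` {..<h}))) \<subseteq>
          zariski E closure_of (\<Union>p\<in>{..<h} \<rightarrow> X. proj_space (linear_span (p ` {..<h})))"
        by (intro closure_of_subset) (simp only: topspace_zariski)
      from subsetD[OF this mem'] show ?thesis unfolding secant_variety_def .
    qed
    show "polyfun {..<k} (1 + 1 * D * card J) (\<lambda>a. \<psi> a x)" for x
      unfolding \<psi>_def
    proof (intro polyfun_sum polyfun_mult)
      fix j
      show "polyfun {..<k} 1 (\<lambda>a. r a j)"
        using \<theta>_poly by (cases "j = 0") (simp_all add: r_def polyfun_add polyfun_const)
      show "polyfun {..<k} (1 * D * card J) (\<lambda>a. \<Phi> j (w a j) x)"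
      proof (rule polyfun_compose[where \<theta> = "\<lambda>a. w a j", OF poly])
        show "polyfun {..<k} 1 (\<lambda>a. w a j i)" for i unfolding w_def by (rule \<theta>_poly)
      qed
    qed
    show "homogeneous_poly 1 (C' 0)" using C' h by simp
    have "C' 0 (\<psi> (\<lambda>_. 0)) = (\<Sum>j<h. if j = 0 then 1 else 0)"
      using h C'z[of 0] by (subst lin[OF C']) (auto simp: zero intro!: sum.cong)
    then show "C' 0 (\<psi> (\<lambda>_. 0)) = 1" using h by simp
  next
    fix m assume m: "m < k"
    from K_cases[OF gK[OF m]] show hom: "homogeneous_poly 1 (l (g m))"
      using L B by (auto simp: l_def)
    from K_cases[OF gK[OF m]] show "l (g m) (\<psi> (\<lambda>_. 0)) = 0"
    proof (elim disjE exE conjE)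
      fix j i assume g: "g m = (j, Some i)" "j < h" "i \<in> J"
      then show ?thesis unfolding lin[OF hom] zero using Lz by (simp add: l_def)
    next
      fix j assume "g m = (j, None)" "j < h" "j \<noteq> 0"
      then show ?thesis unfolding lin[OF hom] zero using Bz by (simp add: l_def sum_subtractf)
    qed
    fix v :: "nat \<Rightarrow> complex"
    from K_cases[OF gK[OF m]]
    show "((\<lambda>\<tau>. l (g m) (\<psi> (\<lambda>x. \<tau> * v x))) has_field_derivative v m) (at 0)"
    proof (elim disjE exE conjE)
      fix j i assume g: "g m = (j, Some i)" "j < h" "i \<in> J"
      have "((\<lambda>\<tau>. l (g m) (\<psi> (\<lambda>x. \<tau> * v x))) has_field_derivative
        (\<Sum>j'<h. (if j' = 0 then 0 else \<theta> v (j', None)) * l (g m) (\<Phi> j' (\<lambda>_. 0)) +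
          (if j' = j then w v j' i else 0))) (at 0)"
      proof (rule deriv[OF hom])
        fix j' assume "j' < h"
        from Ld[OF g(2,3) this, of "w v j'"]
        show "((\<lambda>\<tau>. l (g m) (\<Phi> j' (\<lambda>i. \<tau> * w v j' i))) has_field_derivative
          (if j' = j then w v j' i else 0)) (at 0)" by (simp add: g l_def)
      qed
      also have "(\<Sum>j'<h. (if j' = 0 then 0 else \<theta> v (j', None)) * l (g m) (\<Phi> j' (\<lambda>_. 0)) +
          (if j' = j then w v j' i else 0)) = (\<Sum>j'<h. if j' = j then w v j' i else 0)"
        using g Lz by (intro sum.cong) (auto simp: l_def)
      also have "\<dots> = v m" using g \<theta>g[OF m, of v] by (simp add: w_def)
      finally show ?thesis .
    next
      fix j assume g: "g m = (j, None)" "j < h" "j \<noteq> 0"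
      have "((\<lambda>\<tau>. l (g m) (\<psi> (\<lambda>x. \<tau> * v x))) has_field_derivative
        (\<Sum>j'<h. (if j' = 0 then 0 else \<theta> v (j', None)) * l (g m) (\<Phi> j' (\<lambda>_. 0)) + 0)) (at 0)"
      proof (rule deriv[OF hom])
        fix j' assume "j' < h"
        from Bd[OF g(2) this, of "w v j'"]
        show "((\<lambda>\<tau>. l (g m) (\<Phi> j' (\<lambda>i. \<tau> * w v j' i))) has_field_derivative 0) (at 0)"
          by (simp add: g l_def)
      qed
      also have "(\<Sum>j'<h. (if j' = 0 then 0 else \<theta> v (j', None)) * l (g m) (\<Phi> j' (\<lambda>_. 0)) + 0) =
          (\<Sum>j'<h. if j' = j then \<theta> v (j', None) else 0)"
        using g Bz by (intro sum.cong) (auto simp: l_def)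
      also have "\<dots> = v m" using g \<theta>g[OF m, of v] by simp
      finally show ?thesis .
    qed
  qed
  then show ?thesis by (simp only: k)
qed

text \<open>\<open>f \<tau> = O(\<tau>\<^sup>2)\<close> in a form that is convenient for polynomials.\<close>

definition ord2 :: "(complex \<Rightarrow> complex) \<Rightarrow> bool" where
  "ord2 f \<longleftrightarrow> (\<exists>G. isCont G 0 \<and> (\<forall>\<tau>. f \<tau> = \<tau>\<^sup>2 * G \<tau>))"

lemma ord2I: "isCont G 0 \<Longrightarrow> (\<And>\<tau>. f \<tau> = \<tau>\<^sup>2 * G \<tau>) \<Longrightarrow> ord2 f"
  unfolding ord2_def by blast

lemma ord2_zero: "ord2 (\<lambda>\<tau>. 0)"
  by (rule ord2I[of "\<lambda>_. 0"]) auto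

lemma ord2_add:
  assumes "ord2 f" "ord2 g" shows "ord2 (\<lambda>\<tau>. f \<tau> + g \<tau>)"
proof -
  obtain F where F: "isCont F 0" "\<And>\<tau>. f \<tau> = \<tau>\<^sup>2 * F \<tau>" using assms(1) by (auto simp: ord2_def)
  obtain G where G: "isCont G 0" "\<And>\<tau>. g \<tau> = \<tau>\<^sup>2 * G \<tau>" using assms(2) by (auto simp: ord2_def)
  show ?thesis
    by (rule ord2I[of "\<lambda>\<tau>. F \<tau> + G \<tau>"]) (use F G in \<open>auto simp: algebra_simps intro: continuous_intros\<close>)
qed

lemma ord2_mult:
  assumes "ord2 f" "isCont g 0" shows "ord2 (\<lambda>\<tau>. g \<tau> * f \<tau>)"
proof -
  obtain F where F: "isCont F 0" "\<And>\<tau>. f \<tau> = \<tau>\<^sup>2 * F \<tau>" using assms(1) by (auto simp: ord2_def)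
  show ?thesis
    by (rule ord2I[of "\<lambda>\<tau>. g \<tau> * F \<tau>"]) (use F assms(2) in \<open>auto intro: continuous_intros\<close>)
qed

lemma ord2_cmult: "ord2 f \<Longrightarrow> ord2 (\<lambda>\<tau>. c * f \<tau>)"
  by (rule ord2_mult) auto

lemma ord2_sum: "(\<And>i. i \<in> A \<Longrightarrow> ord2 (f i)) \<Longrightarrow> ord2 (\<lambda>\<tau>. \<Sum>i\<in>A. f i \<tau>)"
  by (induction A rule: infinite_finite_induct) (simp_all add: ord2_zero ord2_add)

lemma ord2_at_0: "ord2 f \<Longrightarrow> f 0 = 0"
  by (auto simp: ord2_def)

lemma has_field_derivative_mult_ident:
  assumes "isCont G 0" shows "((\<lambda>\<tau>. \<tau> * G \<tau>) has_field_derivative G 0) (at (0::complex))"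
proof -
  have "((\<lambda>\<tau>. \<tau> * G \<tau> / \<tau>) \<longlongrightarrow> G 0) (at 0)"
    using assms unfolding isCont_def
    by (rule Lim_transform_eventually) (auto simp: eventually_at_filter)
  then show ?thesis by (simp add: has_field_derivative_iff)
qed

lemma ord2_deriv:
  assumes "ord2 f" shows "(f has_field_derivative 0) (at 0)"
proof -
  obtain F where F: "isCont F 0" "\<And>\<tau>. f \<tau> = \<tau>\<^sup>2 * F \<tau>" using assms(1) by (auto simp: ord2_def)
  have "((\<lambda>\<tau>. \<tau> * (\<tau> * F \<tau>)) has_field_derivative 0 * F 0) (at 0)"
    by (rule has_field_derivative_mult_ident) (intro continuous_intros F)
  then show ?thesis by (simp add: F(2)[abs_def] power2_eq_square mult.assoc)
qed

lemma isCont_prod_affine: "isCont (\<lambda>\<tau>. \<Prod>p\<in>P. A p + \<tau> * B p) (0::complex)"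
  by (intro continuous_intros)

lemma prod_affine_factor:
  fixes A B :: "'s \<Rightarrow> complex"
  assumes "finite P" "p \<in> P" "A p = 0"
  shows "(\<Prod>r\<in>P. A r + \<tau> * B r) = \<tau> * (B p * (\<Prod>r\<in>P - {p}. A r + \<tau> * B r))"
  using assms by (simp add: prod.remove mult.assoc)

lemma ord2_prod_affine:
  fixes A B :: "'s \<Rightarrow> complex"
  assumes "finite P" "p \<in> P" "q \<in> P" "p \<noteq> q" "A p = 0" "A q = 0"
  shows "ord2 (\<lambda>\<tau>. \<Prod>r\<in>P. A r + \<tau> * B r)"
proof (rule ord2I)
  show "isCont (\<lambda>\<tau>. B p * (B q * (\<Prod>r\<in>P - {p} - {q}. A r + \<tau> * B r))) 0"
    by (intro continuous_intros)
  fix \<tau> show "(\<Prod>r\<in>P. A r + \<tau> * B r) = \<tau>\<^sup>2 * (B p * (B q * (\<Prod>r\<in>P - {p} - {q}. A r + \<tau> * B r)))"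
    using assms prod_affine_factor[of P p A \<tau> B] prod_affine_factor[of "P - {p}" q A \<tau> B]
    by (simp add: power2_eq_square)
qed

lemma ord2_mult_prod_affine:
  fixes A B :: "'s \<Rightarrow> complex"
  assumes "finite P" "p \<in> P" "A p = 0"
  shows "ord2 (\<lambda>\<tau>. \<tau> * w * (\<Prod>r\<in>P. A r + \<tau> * B r))"
proof (rule ord2I)
  show "isCont (\<lambda>\<tau>. w * (B p * (\<Prod>r\<in>P - {p}. A r + \<tau> * B r))) 0"
    by (intro continuous_intros)
  fix \<tau> show "\<tau> * w * (\<Prod>r\<in>P. A r + \<tau> * B r) = \<tau>\<^sup>2 * (w * (B p * (\<Prod>r\<in>P - {p}. A r + \<tau> * B r)))"
    using prod_affine_factor[of P p A \<tau> B] assms by (simp add: power2_eq_square)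
qed

lemma deriv_mult_prod_affine:
  fixes A B :: "'s \<Rightarrow> complex"
  shows "((\<lambda>\<tau>. \<tau> * w * (\<Prod>r\<in>P. A r + \<tau> * B r)) has_field_derivative w * prod A P) (at 0)"
  using has_field_derivative_mult_ident[of "\<lambda>\<tau>. w * (\<Prod>r\<in>P. A r + \<tau> * B r)"]
  by (simp add: isCont_prod_affine mult.assoc continuous_intros)

section \<open>Distribution of roots over slots\<close>

lemma ex_cover_once:
  assumes "finite R" "finite N" "card N \<le> card R"
  shows "\<exists>P u. P \<subseteq> R \<and> u ` P \<subseteq> N \<and> (\<forall>j\<in>N. \<exists>p\<in>P. u p = j)"
proof -
  obtain f where f: "f ` N \<subseteq> R" "inj_on f N" using card_le_inj[OF assms(2,1,3)] by blast
  then show ?thesis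
    by (intro exI[of _ "f ` N"] exI[of _ "inv_into N f"]) auto
qed

text \<open>Pairing \<open>N\<close> with the booleans turns the two slots reserved for each element
  into one injection.\<close>

lemma ex_cover_twice:
  assumes "finite R" "finite N" "2 * card N \<le> card R"
  shows "\<exists>P u. P \<subseteq> R \<and> u ` P \<subseteq> N \<and> (\<forall>j\<in>N. \<exists>p\<in>P. \<exists>q\<in>P. p \<noteq> q \<and> u p = j \<and> u q = j)"
proof -
  let ?N = "N \<times> (UNIV :: bool set)"
  have "card ?N \<le> card R" using assms(3) by (simp add: card_cartesian_product)
  then obtain f where f: "f ` ?N \<subseteq> R" "inj_on f ?N"
    using card_le_inj[of ?N R] assms(1,2) by auto
  have u: "fst (inv_into ?N f (f x)) = fst x" if "x \<in> ?N" for x using f(2) that by simp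
  have ne: "f (j, True) \<noteq> f (j, False)" if "j \<in> N" for j
    using f(2) that by (auto dest: inj_onD)
  show ?thesis
  proof (intro exI[of _ "f ` ?N"] exI[of _ "\<lambda>p. fst (inv_into ?N f p)"] conjI ballI)
    show "(\<lambda>p. fst (inv_into ?N f p)) ` f ` ?N \<subseteq> N" using u by auto
    fix j assume j: "j \<in> N"
    show "\<exists>p\<in>f ` ?N. \<exists>q\<in>f ` ?N. p \<noteq> q \<and> fst (inv_into ?N f p) = j \<and> fst (inv_into ?N f q) = j"
      using ne[OF j] u[of "(j, True)"] u[of "(j, False)"] j
      by (intro bexI[of _ "f (j, True)"] bexI[of _ "f (j, False)"]) auto
  qed (use f in auto)
qed

text \<open>The points of tangency are \<open>\<Phi> t 0\<close> for \<open>t < h\<close>. The functionals dual to the tangent space at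
  one of them are products of linear factors \<open>t - u p\<close>, one for each slot \<open>p\<close>, up to second order;
  they annihilate the tangent spaces at the other points since these are double roots.\<close>

lemma variety_dim_secant_ge_slots:
  fixes \<Phi> :: "complex \<Rightarrow> ('j \<Rightarrow> complex) \<Rightarrow> 'i \<Rightarrow> complex" and y :: "'s \<Rightarrow> ('j \<Rightarrow> complex) \<Rightarrow> complex"
  assumes J: "finite J" and E: "fn.subspace E" and X: "X \<subseteq> proj_space E" and h: "h \<ge> 1"
    and S: "finite S" "2 * h - 1 \<le> card S"
    and poly: "\<And>t x. polyfun J D (\<lambda>a. \<Phi> t a x)"
    and mem: "\<And>t a. fn.span {\<Phi> t a} \<in> X"
    and diag: "\<And>P u. P \<subseteq> S \<Longrightarrow> \<exists>L. homogeneous_poly 1 L \<and>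
      (\<forall>t v. ord2 (\<lambda>\<tau>. L (\<Phi> t (\<lambda>x. \<tau> * v x)) - (\<Prod>p\<in>P. (t - u p) + \<tau> * y p v)))"
    and off: "\<And>i. i \<in> J \<Longrightarrow> (\<exists>p\<in>S. \<forall>v. y p v = v i) \<or>
      (\<exists>p q. \<forall>P u. P \<subseteq> S - {p, q} \<longrightarrow> (\<exists>L. homogeneous_poly 1 L \<and>
        (\<forall>t v. ord2 (\<lambda>\<tau>. L (\<Phi> t (\<lambda>x. \<tau> * v x)) - \<tau> * v i * (\<Prod>p\<in>P. (t - u p) + \<tau> * y p v)))))"
  shows "enat (card J * h + h - 1) \<le> variety_dim E (secant_variety E h X)"
proof -
  \<comment> \<open>The parameters of the points of tangency on the curve, pairwise
    distinct.\<close>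
  define T where "T j = (of_nat j :: complex)" for j
  have T: "T j = T j' \<longleftrightarrow> j = j'" for j j' by (simp add: T_def)
  define Ldual where "Ldual j i L \<longleftrightarrow> homogeneous_poly 1 L \<and> (\<forall>j'<h. L (\<Phi> (T j') (\<lambda>_. 0)) = 0 \<and>
    (\<forall>v. ((\<lambda>\<tau>. L (\<Phi> (T j') (\<lambda>x. \<tau> * v x))) has_field_derivative (if j' = j then v i else 0)) (at 0)))"
    for j i L
  define Cdual where "Cdual j L \<longleftrightarrow> homogeneous_poly 1 L \<and>
    (\<forall>j'<h. L (\<Phi> (T j') (\<lambda>_. 0)) = (if j' = j then 1 else 0) \<and>
    (j' \<noteq> j \<longrightarrow> (\<forall>v. ((\<lambda>\<tau>. L (\<Phi> (T j') (\<lambda>x. \<tau> * v x))) has_field_derivative 0) (at 0))))"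
    for j L
  have ord2_diff: "ord2 f" if "ord2 (\<lambda>\<tau>. f \<tau> - g \<tau>)" "ord2 g" for f g
    using ord2_add[OF that] by simp
  have Ldual: "\<exists>L. Ldual j i L"
    if L: "homogeneous_poly 1 L" and P: "\<And>p. p \<in> P \<Longrightarrow> u p \<noteq> T j" "finite P"
      and at: "\<And>v. ord2 (\<lambda>\<tau>. L (\<Phi> (T j) (\<lambda>x. \<tau> * v x)) -
        \<tau> * v i * (\<Prod>p\<in>P. (T j - u p) + \<tau> * y p v))"
      and off_j: "\<And>j' v. j' < h \<Longrightarrow> j' \<noteq> j \<Longrightarrow> ord2 (\<lambda>\<tau>. L (\<Phi> (T j') (\<lambda>x. \<tau> * v x)))"
    for j i L P u
  proof -
    \<comment> \<open>At its own point the functional has derivative \<open>v i * \<pi>\<close>. As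
      no root equals \<open>T j\<close>, it can be normalised.\<close>
    define \<pi> where "\<pi> = (\<Prod>p\<in>P. T j - u p)"
    have \<pi>: "\<pi> \<noteq> 0" using P by (force simp: \<pi>_def)
    have zero: "L (\<Phi> (T j') (\<lambda>_. 0)) = 0" if "j' < h" for j'
    proof (cases "j' = j")
      case True
      then show ?thesis using ord2_at_0[OF at] by simp
    next
      case False
      from ord2_at_0[OF off_j[OF that this]] show ?thesis by simp
    qed
    have deriv: "((\<lambda>\<tau>. L (\<Phi> (T j') (\<lambda>x. \<tau> * v x))) has_field_derivative
        (if j' = j then v i * \<pi> else 0)) (at 0)" if "j' < h" for j' v
    proof (cases "j' = j")
      case True
      from DERIV_add[OF ord2_deriv[OF at[of v]]
          deriv_mult_prod_affine[where w = "v i" and P = P and A = "\<lambda>p. T j - u p" and B = "\<lambda>p. y p v"]]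
      show ?thesis using True by (simp add: \<pi>_def)
    next
      case False
      then show ?thesis using ord2_deriv[OF off_j[OF that False]] by simp
    qed
    have "Ldual j i (\<lambda>x. 1 / \<pi> * L x)"
      unfolding Ldual_def
    proof (intro conjI allI impI homogeneous_poly_cmult L)
      fix j' v assume j': "j' < h"
      show "1 / \<pi> * L (\<Phi> (T j') (\<lambda>_. 0)) = 0" using zero[OF j'] by simp
      from DERIV_cmult[OF deriv[OF j'], of "1 / \<pi>" v]
      show "((\<lambda>\<tau>. 1 / \<pi> * L (\<Phi> (T j') (\<lambda>x. \<tau> * v x))) has_field_derivative
          (if j' = j then v i else 0)) (at 0)" using \<pi> by (simp split: if_splits)
    qed
    then show ?thesis by (rule exI[of _ "\<lambda>x. 1 / \<pi> * L x"])
  qed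
  have ex_L: "\<exists>L. Ldual j i L" if j: "j < h" and i: "i \<in> J" for j i
    using off[OF i]
  proof (elim disjE bexE exE)
    fix p0 assume p0: "p0 \<in> S" "\<forall>v. y p0 v = v i"
    have "2 * card ({..<h} - {j}) \<le> card (S - {p0})" using S p0 j by simp
    from ex_cover_twice[OF _ _ this] S(1) obtain P u where P: "P \<subseteq> S - {p0}"
      "u ` P \<subseteq> {..<h} - {j}"
      "\<forall>j'\<in>{..<h} - {j}. \<exists>p\<in>P. \<exists>q\<in>P. p \<noteq> q \<and> u p = j' \<and> u q = j'" by auto
    \<comment> \<open>The slot \<open>p0\<close> carries the simple root at \<open>T j\<close>, so
      that the product has derivative proportional to \<open>y p0 v = v i\<close> there. The other
      \<open>2 * h - 2\<close> slots provide the double roots.\<close>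
    define u' where "u' p = (if p = p0 then T j else T (u p))" for p
    have fin: "finite P" using P(1) S(1) finite_subset by blast
    have "insert p0 P \<subseteq> S" using P(1) p0 by auto
    from diag[OF this, of u'] obtain L where L: "homogeneous_poly 1 L"
      "\<forall>t v. ord2 (\<lambda>\<tau>. L (\<Phi> t (\<lambda>x. \<tau> * v x)) - (\<Prod>p\<in>insert p0 P. (t - u' p) + \<tau> * y p v))"
      by (elim exE conjE) (rule that)
    show ?thesis
    proof (rule Ldual[OF L(1) _ fin])
      show "T (u p) \<noteq> T j" if "p \<in> P" for p using that P(2) T by auto
      fix v
      have "(\<Prod>p\<in>insert p0 P. (T j - u' p) + \<tau> * y p v) =
          \<tau> * v i * (\<Prod>p\<in>P. (T j - T (u p)) + \<tau> * y p v)" for \<tau>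
      proof -
        have "(\<Prod>p\<in>P. (T j - u' p) + \<tau> * y p v) = (\<Prod>p\<in>P. (T j - T (u p)) + \<tau> * y p v)"
          using P(1) by (intro prod.cong) (auto simp: u'_def)
        then show ?thesis using fin P(1) p0(2) by (subst prod.insert) (auto simp: u'_def)
      qed
      with L(2)[rule_format, of "T j" v]
      show "ord2 (\<lambda>\<tau>. L (\<Phi> (T j) (\<lambda>x. \<tau> * v x)) -
          \<tau> * v i * (\<Prod>p\<in>P. (T j - T (u p)) + \<tau> * y p v))" by simp
    next
      fix j' v assume "j' < h" "j' \<noteq> j"
      then have "\<exists>p\<in>P. \<exists>q\<in>P. p \<noteq> q \<and> u p = j' \<and> u q = j'" by (intro P(3)[rule_format]) simp
      then obtain p q where pq: "p \<in> P" "q \<in> P" "p \<noteq> q" "u p = j'" "u q = j'" by blast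
      have "p \<noteq> p0" "q \<noteq> p0" using pq P(1) by auto
      then have "ord2 (\<lambda>\<tau>. \<Prod>p\<in>insert p0 P. (T j' - u' p) + \<tau> * y p v)"
        using pq fin by (intro ord2_prod_affine[of _ p q]) (auto simp: u'_def)
      from ord2_diff[OF L(2)[rule_format, of "T j'" v] this]
      show "ord2 (\<lambda>\<tau>. L (\<Phi> (T j') (\<lambda>x. \<tau> * v x)))" .
    qed
  next
    fix p q assume pq: "\<forall>P u. P \<subseteq> S - {p, q} \<longrightarrow> (\<exists>L. homogeneous_poly 1 L \<and>
        (\<forall>t v. ord2 (\<lambda>\<tau>. L (\<Phi> t (\<lambda>x. \<tau> * v x)) - \<tau> * v i * (\<Prod>p\<in>P. (t - u p) + \<tau> * y p v))))"
    \<comment> \<open>\<open>p\<close> and \<open>q\<close> may coincide or lie outside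
      \<open>S\<close>, so at most two slots are lost. The \<open>2 * h - 3\<close> that remain are
      at least \<open>h - 1\<close> if \<open>h >= 2\<close>, and for \<open>h = 1\<close> no root
      has to be placed.\<close>
    have "card S \<le> card ((S - {p, q}) \<union> {p, q})" using S(1) by (intro card_mono) auto
    also have "\<dots> \<le> card (S - {p, q}) + card {p, q}" by (rule card_Un_le)
    also have "\<dots> \<le> card (S - {p, q}) + 2" using card_insert_le_m1[of 2 "{q}" p] by simp
    finally have "card ({..<h} - {j}) \<le> card (S - {p, q})" using S(2) j by simp
    from ex_cover_once[OF _ _ this] S(1) obtain P u where P: "P \<subseteq> S - {p, q}"
      "u ` P \<subseteq> {..<h} - {j}" "\<forall>j'\<in>{..<h} - {j}. \<exists>p\<in>P. u p = j'" by auto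
    have fin: "finite P" using P(1) S(1) finite_subset by blast
    from pq[rule_format, OF P(1), of "\<lambda>p. T (u p)"] obtain L where L: "homogeneous_poly 1 L"
      "\<forall>t v. ord2 (\<lambda>\<tau>. L (\<Phi> t (\<lambda>x. \<tau> * v x)) - \<tau> * v i * (\<Prod>p\<in>P. (t - T (u p)) + \<tau> * y p v))"
      by (elim exE conjE) (rule that)
    show ?thesis
    proof (rule Ldual[OF L(1) _ fin])
      show "T (u p) \<noteq> T j" if "p \<in> P" for p using that P(2) T by auto
      show "ord2 (\<lambda>\<tau>. L (\<Phi> (T j) (\<lambda>x. \<tau> * v x)) -
          \<tau> * v i * (\<Prod>p\<in>P. (T j - T (u p)) + \<tau> * y p v))" for v
        using L(2) by (elim allE)
    next
      fix j' v assume "j' < h" "j' \<noteq> j"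
      then have "\<exists>p\<in>P. u p = j'" by (intro P(3)[rule_format]) simp
      then obtain p where p: "p \<in> P" "u p = j'" by blast
      then have "ord2 (\<lambda>\<tau>. \<tau> * v i * (\<Prod>p\<in>P. (T j' - T (u p)) + \<tau> * y p v))"
        using fin by (intro ord2_mult_prod_affine[of _ p]) auto
      from ord2_diff[OF L(2)[rule_format, of "T j'" v] this]
      show "ord2 (\<lambda>\<tau>. L (\<Phi> (T j') (\<lambda>x. \<tau> * v x)))" .
    qed
  qed
  have ex_C: "\<exists>L. Cdual j L" if j: "j < h" for j
  proof -
    \<comment> \<open>Here the value at the own point must be nonzero, so all roots are double ones
      at the other points.\<close>
    have "2 * card ({..<h} - {j}) \<le> card S" using S j by simp
    from ex_cover_twice[OF _ _ this] S(1) obtain P u where P: "P \<subseteq> S"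
      "u ` P \<subseteq> {..<h} - {j}"
      "\<forall>j'\<in>{..<h} - {j}. \<exists>p\<in>P. \<exists>q\<in>P. p \<noteq> q \<and> u p = j' \<and> u q = j'" by auto
    have fin: "finite P" using P(1) S(1) finite_subset by blast
    from diag[OF P(1), of "\<lambda>p. T (u p)"] obtain L where L: "homogeneous_poly 1 L"
      "\<forall>t v. ord2 (\<lambda>\<tau>. L (\<Phi> t (\<lambda>x. \<tau> * v x)) - (\<Prod>p\<in>P. (t - T (u p)) + \<tau> * y p v))"
      by (elim exE conjE) (rule that)
    define \<pi> where "\<pi> = (\<Prod>p\<in>P. T j - T (u p))"
    have \<pi>: "\<pi> \<noteq> 0" using P(2) fin T by (auto simp: \<pi>_def)
    have off_j: "ord2 (\<lambda>\<tau>. L (\<Phi> (T j') (\<lambda>x. \<tau> * v x)))" if "j' < h" "j' \<noteq> j" for j' v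
    proof -
      have "\<exists>p\<in>P. \<exists>q\<in>P. p \<noteq> q \<and> u p = j' \<and> u q = j'"
        using that by (intro P(3)[rule_format]) simp
      then obtain p q where "p \<in> P" "q \<in> P" "p \<noteq> q" "u p = j'" "u q = j'" by blast
      then have "ord2 (\<lambda>\<tau>. \<Prod>p\<in>P. (T j' - T (u p)) + \<tau> * y p v)"
        using fin by (intro ord2_prod_affine[of _ p q]) auto
      from ord2_diff[OF L(2)[rule_format, of "T j'" v] this] show ?thesis .
    qed
    have at: "L (\<Phi> (T j) (\<lambda>_. 0)) = \<pi>"
      using ord2_at_0[OF L(2)[rule_format, of "T j" "\<lambda>_. 0"]] by (simp add: \<pi>_def)
    have "Cdual j (\<lambda>x. 1 / \<pi> * L x)"
      unfolding Cdual_def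
    proof (intro conjI allI impI homogeneous_poly_cmult L)
      fix j' assume j': "j' < h"
      show "1 / \<pi> * L (\<Phi> (T j') (\<lambda>_. 0)) = (if j' = j then 1 else 0)"
        using at \<pi> ord2_at_0[OF off_j[OF j']] by auto
      fix v assume "j' \<noteq> j"
      from DERIV_cmult[OF ord2_deriv[OF off_j[OF j' this]], of "1 / \<pi>" v]
      show "((\<lambda>\<tau>. 1 / \<pi> * L (\<Phi> (T j') (\<lambda>x. \<tau> * v x))) has_field_derivative 0) (at 0)" by simp
    qed
    then show ?thesis by (rule exI[of _ "\<lambda>x. 1 / \<pi> * L x"])
  qed
  define L where "L j i = (SOME L. Ldual j i L)" for j i
  define C where "C j = (SOME L. Cdual j L)" for j
  have L: "Ldual j i (L j i)" if "j < h" "i \<in> J" for j i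
    unfolding L_def using ex_L[OF that] by (rule someI_ex)
  have C: "Cdual j (C j)" if "j < h" for j
    unfolding C_def using ex_C[OF that] by (rule someI_ex)
  show ?thesis
  proof (rule variety_dim_secant_ge[where \<Phi> = "\<lambda>j. \<Phi> (T j)" and L = L and C = C, OF J E X h poly mem])
  qed (use L C in \<open>auto simp: Ldual_def Cdual_def\<close>)
qed

section \<open>Exterior powers and determinants\<close>

context vector_space
begin

lemma functional_add: "Vector_Spaces.linear scale (*) \<phi> \<Longrightarrow> \<phi> (x + y) = \<phi> x + \<phi> y"
  unfolding Vector_Spaces.linear_iff by blast

lemma functional_scale: "Vector_Spaces.linear scale (*) \<phi> \<Longrightarrow> \<phi> (scale c x) = c * \<phi> x"
  unfolding Vector_Spaces.linear_iff by blast

lemma functional_zero: "Vector_Spaces.linear scale (*) \<phi> \<Longrightarrow> \<phi> 0 = 0"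
  using functional_scale[of \<phi> 0 0] by simp

lemma functional_sum:
  assumes "Vector_Spaces.linear scale (*) \<phi>"
  shows "\<phi> (\<Sum>i\<in>A. scale (c i) (v i)) = (\<Sum>i\<in>A. c i * \<phi> (v i))"
  by (induction A rule: infinite_finite_induct)
    (simp_all add: functional_add[OF assms] functional_scale[OF assms] functional_zero[OF assms])

lemma functionalI:
  assumes "\<And>x y. \<phi> (x + y) = \<phi> x + \<phi> y" "\<And>c x. \<phi> (scale c x) = c * \<phi> x"
  shows "Vector_Spaces.linear scale (*) \<phi>"
  unfolding Vector_Spaces.linear_iff
  using assms vector_space_axioms vector_space_over_itself.vector_space_axioms by blast

lemma in_span_image:
  assumes "finite I" "x \<in> span (v ` I)"
  shows "\<exists>c. x = (\<Sum>i\<in>I. scale (c i) (v i))"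
proof -
  let ?U = "range (\<lambda>c. \<Sum>i\<in>I. scale (c i) (v i))"
  have "subspace ?U"
  proof (rule subspaceI)
    show "0 \<in> ?U" by (rule range_eqI[of _ _ "\<lambda>_. 0"]) simp
    fix x y k assume "x \<in> ?U" "y \<in> ?U"
    then obtain c d where cd: "x = (\<Sum>i\<in>I. scale (c i) (v i))" "y = (\<Sum>i\<in>I. scale (d i) (v i))"
      by auto
    then show "x + y \<in> ?U"
      by (intro range_eqI[of _ _ "\<lambda>i. c i + d i"]) (simp add: scale_left_distrib sum.distrib)
    show "scale k x \<in> ?U"
      using cd by (intro range_eqI[of _ _ "\<lambda>i. k * c i"]) (simp add: scale_sum_right)
  qed
  moreover have "v ` I \<subseteq> ?U"
  proof (rule image_subsetI)
    fix i assume "i \<in> I"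
    have "(\<Sum>j\<in>I. scale (if j = i then 1 else 0) (v j)) = (\<Sum>j\<in>I. if j = i then v j else 0)"
      by (intro sum.cong) auto
    then show "v i \<in> ?U"
      using assms(1) \<open>i \<in> I\<close> by (intro range_eqI[of _ _ "\<lambda>j. if j = i then 1 else 0"]) simp
  qed
  ultimately have "span (v ` I) \<subseteq> ?U" by (rule span_minimal[rotated])
  then show ?thesis using assms(2) by blast
qed

lemma independent_family:
  assumes "finite I" and "\<And>c. (\<Sum>i\<in>I. scale (c i) (v i)) = 0 \<Longrightarrow> \<forall>i\<in>I. c i = 0"
  shows "inj_on v I" "independent (v ` I)"
proof -
  show inj: "inj_on v I"
  proof (rule inj_onI, rule ccontr)
    fix i j assume ij: "i \<in> I" "j \<in> I" "v i = v j" "i \<noteq> j"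
    let ?c = "\<lambda>k. if k = i then 1 else if k = j then - 1 else 0"
    have "(\<Sum>k\<in>I. scale (?c k) (v k)) = (\<Sum>k\<in>{i, j}. scale (?c k) (v k))"
      using ij assms(1) by (intro sum.mono_neutral_right) auto
    also have "\<dots> = 0" using ij by simp
    finally show False using assms(2)[of ?c] ij(1) by auto
  qed
  show "independent (v ` I)"
  proof
    assume "dependent (v ` I)"
    with dependent_finite[of "v ` I"] assms(1)
    obtain u where u: "\<exists>x\<in>v ` I. u x \<noteq> 0" "(\<Sum>x\<in>v ` I. scale (u x) x) = 0" by auto
    from u(2) have "(\<Sum>i\<in>I. scale (u (v i)) (v i)) = 0" by (simp add: sum.reindex[OF inj])
    from assms(2)[OF this] u(1) show False by auto
  qed
qed

text \<open>In the step, \<open>G y\<close> is the value of \<open>F k\<close> at \<open>z\<close>,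
  the projection of \<open>y\<close> to the common kernel of the earlier functionals along their
  dual vectors. By independence \<open>G\<close> is not zero, so a multiple \<open>w\<close> of some
  \<open>z\<close> is dual to \<open>F k\<close>, and the earlier vectors are corrected by multiples
  of \<open>w\<close>.\<close>

lemma dual_vectors:
  assumes "finite I" and "\<And>i. i \<in> I \<Longrightarrow> Vector_Spaces.linear scale (*) (F i)"
    and "\<And>c. (\<And>x. (\<Sum>i\<in>I. c i * F i x) = 0) \<Longrightarrow> \<forall>i\<in>I. c i = 0"
  shows "\<exists>x. \<forall>i\<in>I. \<forall>j\<in>I. F i (x j) = (if i = j then 1 else 0)"
  using assms
proof (induction I rule: finite_induct)
  case (insert k I)
  have indep: "\<forall>i\<in>I. c i = 0" if c: "\<And>x. (\<Sum>i\<in>I. c i * F i x) = 0" for c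
  proof -
    have "(\<Sum>i\<in>insert k I. (if i = k then 0 else c i) * F i x) = (\<Sum>i\<in>I. c i * F i x)" for x
      using insert(1,2) by (auto intro!: sum.cong)
    then have "(\<Sum>i\<in>insert k I. (if i = k then 0 else c i) * F i x) = 0" for x using c by simp
    from insert.prems(2)[OF this] have *: "\<forall>i\<in>insert k I. (if i = k then 0 else c i) = 0" .
    show ?thesis using * insert(2) by (metis insertI2)
  qed
  obtain x where x: "\<forall>i\<in>I. \<forall>j\<in>I. F i (x j) = (if i = j then 1 else 0)"
    using insert.IH[OF insert.prems(1) indep] by auto
  have lin: "Vector_Spaces.linear scale (*) (F i)" if "i \<in> insert k I" for i
    using insert.prems(1) that .
  define G where "G y = F k y - (\<Sum>i\<in>I. F k (x i) * F i y)" for y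
  have "\<exists>y. G y \<noteq> 0"
  proof (rule ccontr)
    assume "\<not> ?thesis"
    then have G0: "G y = 0" for y by blast
    have "(\<Sum>i\<in>insert k I. (if i = k then 1 else - F k (x i)) * F i y) = 0" for y
    proof -
      have "(\<Sum>i\<in>I. (if i = k then 1 else - F k (x i)) * F i y) = (\<Sum>i\<in>I. - (F k (x i) * F i y))"
        using insert(2) by (intro sum.cong) auto
      then show ?thesis using insert(1,2) G0[of y] by (simp add: G_def sum_negf)
    qed
    from insert.prems(2)[OF this] show False by auto
  qed
  then obtain y where y: "G y \<noteq> 0" by blast
  define z where "z = y + (\<Sum>i\<in>I. scale (- F i y) (x i))"
  have Fz: "F j z = 0" if "j \<in> I" for j
  proof -
    have "(\<Sum>i\<in>I. - F i y * F j (x i)) = (\<Sum>i\<in>I. if i = j then - F i y else 0)"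
      using x that by (intro sum.cong) auto
    then show ?thesis
      unfolding z_def functional_add[OF lin[OF insertI2[OF that]]] functional_sum[OF lin[OF insertI2[OF that]]]
      using that insert(1) by simp
  qed
  have Fkz: "F k z = G y"
    unfolding z_def functional_add[OF lin[OF insertI1]] functional_sum[OF lin[OF insertI1]] G_def
    by (simp add: sum_negf mult.commute)
  define w where "w = scale (1 / G y) z"
  have Fw: "F j w = (if j = k then 1 else 0)" if "j \<in> insert k I" for j
    unfolding w_def functional_scale[OF lin[OF that]] using that Fz Fkz y insert(2) by auto
  define x' where "x' i = (if i = k then w else x i + scale (- F k (x i)) w)" for i
  have "F i (x' j) = (if i = j then 1 else 0)" if i: "i \<in> insert k I" and j: "j \<in> insert k I" for i j
  proof (cases "j = k")
    case False
    have "F i (x' j) = F i (x j) - F k (x j) * F i w"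
      using False unfolding x'_def
      by (simp only: if_False functional_add[OF lin[OF i]] functional_scale[OF lin[OF i]]) simp
    then show ?thesis using x i j False Fw[OF i] by auto
  qed (simp add: x'_def Fw[OF i])
  then show ?case by blast
qed simp

end

section \<open>Decomposable vectors and determinants\<close>

lemma wedge_cong: "(\<And>j. j < n \<Longrightarrow> v j = w j) \<Longrightarrow> wedge s n v = wedge s n w"
  unfolding wedge_def by (intro ext if_cong refl arg_cong[of _ _ Determinant.det] eq_matI) auto

lemma wedge_eval:
  assumes "\<And>i. i < n \<Longrightarrow> Vector_Spaces.linear s (*) (\<phi> i)"
  shows "wedge s n v \<phi> = Determinant.det (mat n n (\<lambda>(i, j). \<phi> i (v j)))"
  using assms by (simp add: wedge_def)

text \<open>Multiplicativity of the determinant. It makes the Pluecker line of a subspace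
  independent of the chosen spanning family.\<close>

lemma wedge_basis_change:
  assumes "Vector_Spaces.vector_space s"
    and w: "\<And>j. j < n \<Longrightarrow> w j = (\<Sum>k<n. s (c k j) (v k))"
  shows "wedge s n w = fscale (Determinant.det (mat n n (\<lambda>(k, j). c k j))) (wedge s n v)"
proof
  interpret Vector_Spaces.vector_space s by fact
  fix \<phi>
  show "wedge s n w \<phi> = Determinant.det (mat n n (\<lambda>(k, j). c k j)) * wedge s n v \<phi>"
  proof (cases "\<forall>i<n. Vector_Spaces.linear s (*) (\<phi> i)")
    case True
    have "mat n n (\<lambda>(i, j). \<phi> i (w j)) = mat n n (\<lambda>(i, k). \<phi> i (v k)) * mat n n (\<lambda>(k, j). c k j)"
    proof (rule eq_matI)
      fix i j assume "i < dim_row (mat n n (\<lambda>(i, k). \<phi> i (v k)) * mat n n (\<lambda>(k, j). c k j))"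
        "j < dim_col (mat n n (\<lambda>(i, k). \<phi> i (v k)) * mat n n (\<lambda>(k, j). c k j))"
      then have ij: "i < n" "j < n" by auto
      have "\<phi> i (w j) = (\<Sum>k<n. c k j * \<phi> i (v k))"
        unfolding w[OF ij(2)] using True ij(1) by (intro functional_sum) auto
      then show "mat n n (\<lambda>(i, j). \<phi> i (w j)) $$ (i, j) =
          (mat n n (\<lambda>(i, k). \<phi> i (v k)) * mat n n (\<lambda>(k, j). c k j)) $$ (i, j)"
        using ij by (simp add: scalar_prod_def atLeast0LessThan mult.commute)
    qed auto
    then show ?thesis
      using True by (simp add: wedge_def Determinant.det_mult[of _ n])
  next
    case False
    then have "wedge s n w \<phi> = 0" "wedge s n v \<phi> = 0" unfolding wedge_def by (simp_all only: if_False)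
    then show ?thesis by simp
  qed
qed

lemma exterior_power_span:
  assumes "Vector_Spaces.vector_space s"
  shows "exterior_power s n (Modules.module.span s (v ` {..<n})) = fn.span {wedge s n v}"
proof (rule subset_antisym)
  interpret Vector_Spaces.vector_space s by fact
  show "exterior_power s n (span (v ` {..<n})) \<subseteq> fn.span {wedge s n v}"
    unfolding exterior_power_def
  proof (rule fn.span_minimal[OF _ fn.subspace_span], clarify)
    fix w assume "\<forall>i<n. w i \<in> span (v ` {..<n})"
    then have "\<forall>j\<in>{..<n}. \<exists>c. w j = (\<Sum>k<n. s (c k) (v k))"
      using in_span_image[of "{..<n}" _ v] by simp
    from bchoice[OF this] obtain c where "\<forall>j\<in>{..<n}. w j = (\<Sum>k<n. s (c j k) (v k))"
      by (elim exE) (rule that)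
    then have "wedge s n w = fscale (Determinant.det (mat n n (\<lambda>(k, j). c j k))) (wedge s n v)"
      by (intro wedge_basis_change assms) simp
    then show "wedge s n w \<in> fn.span {wedge s n v}" by (auto simp: in_span_singleton_iff)
  qed
  show "fn.span {wedge s n v} \<subseteq> exterior_power s n (span (v ` {..<n}))"
    unfolding exterior_power_def
    by (intro fn.span_mono) (auto intro: span_base)
qed

lemma det_permutation_sum:
  "Determinant.det (mat n n (\<lambda>(i, j). A i j)) =
    (\<Sum>\<pi> | \<pi> permutes {0..<n}. signof \<pi> * (\<Prod>i = 0..<n. A i (\<pi> i)))"
proof -
  have "(\<Prod>i = 0..<n. mat n n (\<lambda>(i, j). A i j) $$ (i, \<pi> i)) = (\<Prod>i = 0..<n. A i (\<pi> i))"
    if "\<pi> permutes {0..<n}" for \<pi>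
    using permutes_in_image[OF that] by (intro prod.cong) auto
  then show ?thesis by (subst det_def'[of _ n]) (auto intro!: sum.cong)
qed

lemma polyfun_det:
  assumes "\<And>i j. polyfun J 1 (\<lambda>a. A a i j)"
  shows "polyfun J n (\<lambda>a. Determinant.det (mat n n (\<lambda>(i, j). A a i j)))"
  unfolding det_permutation_sum
proof (intro polyfun_sum polyfun_scale)
  fix \<pi>
  show "polyfun J n (\<lambda>a. \<Prod>i = 0..<n. A a i (\<pi> i))"
    using polyfun_prod[of "{0..<n}" J 1 "\<lambda>i a. A a i (\<pi> i)"] assms by simp
qed

text \<open>In the Leibniz expansion a permutation contributes nothing to first order if it meets an
  entry that is identically zero, or two entries with zero constant term. The assumption leaves only
  the diagonal.\<close>

lemma ord2_det_affine:
  fixes A C :: "nat \<Rightarrow> nat \<Rightarrow> complex"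
  assumes "\<And>\<pi>. \<pi> permutes {0..<n} \<Longrightarrow> \<pi> \<noteq> id \<Longrightarrow> (\<exists>i<n. A i (\<pi> i) = 0 \<and> C i (\<pi> i) = 0) \<or>
    (\<exists>i<n. \<exists>j<n. i \<noteq> j \<and> A i (\<pi> i) = 0 \<and> A j (\<pi> j) = 0)"
  shows "ord2 (\<lambda>\<tau>. Determinant.det (mat n n (\<lambda>(i, j). A i j + \<tau> * C i j)) - (\<Prod>i<n. A i i + \<tau> * C i i))"
proof -
  let ?P = "{\<pi>. \<pi> permutes {0..<n}}"
  have fin: "finite ?P" by (intro finite_permutations) simp
  have "Determinant.det (mat n n (\<lambda>(i, j). A i j + \<tau> * C i j)) =
      (\<Prod>i<n. A i i + \<tau> * C i i) +
      (\<Sum>\<pi>\<in>?P - {id}. signof \<pi> * (\<Prod>i = 0..<n. A i (\<pi> i) + \<tau> * C i (\<pi> i)))" for \<tau>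
    unfolding det_permutation_sum
    by (subst sum.remove[OF fin, of id]) (simp_all add: permutes_id atLeast0LessThan)
  moreover have "ord2 (\<lambda>\<tau>. \<Sum>\<pi>\<in>?P - {id}. signof \<pi> * (\<Prod>i = 0..<n. A i (\<pi> i) + \<tau> * C i (\<pi> i)))"
  proof (intro ord2_sum ord2_cmult)
    fix \<pi> assume "\<pi> \<in> ?P - {id}"
    then have "(\<exists>i<n. A i (\<pi> i) = 0 \<and> C i (\<pi> i) = 0) \<or>
      (\<exists>i<n. \<exists>j<n. i \<noteq> j \<and> A i (\<pi> i) = 0 \<and> A j (\<pi> j) = 0)" by (intro assms) auto
    then show "ord2 (\<lambda>\<tau>. \<Prod>i = 0..<n. A i (\<pi> i) + \<tau> * C i (\<pi> i))"
    proof (elim disjE exE conjE)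
      fix i assume i: "i < n" "A i (\<pi> i) = 0" "C i (\<pi> i) = 0"
      then have "(\<Prod>i = 0..<n. A i (\<pi> i) + \<tau> * C i (\<pi> i)) = 0" for \<tau>
        by (intro prod_zero) (auto intro!: bexI[of _ i])
      then show ?thesis by (simp only: ord2_zero)
    next
      fix i j assume "i < n" "j < n" "i \<noteq> j" "A i (\<pi> i) = 0" "A j (\<pi> j) = 0"
      then show ?thesis by (intro ord2_prod_affine[of _ i j]) auto
    qed
  qed
  ultimately show ?thesis by simp
qed

text \<open>The expected dimension is monotone in the dimension of \<open>X\<close>, so an upper
  bound \<open>m\<close> for the latter is enough; it is attained in the applications for dimension
  reasons only implicitly.\<close>

lemma not_h_defectiveI:
  assumes "variety_dim E X \<le> enat m" "enat (m * h + h - 1) \<le> variety_dim E (secant_variety E h X)"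
  shows "\<not> h_defective E h X"
proof
  assume "h_defective E h X"
  then have less: "variety_dim E (secant_variety E h X) < variety_dim E X * enat h + enat h - 1"
    by (simp add: h_defective_def)
  obtain m' where m': "variety_dim E X = enat m'" "m' \<le> m"
    using assms(1) by (cases "variety_dim E X") auto
  have "variety_dim E X * enat h + enat h - 1 = enat (m' * h + h - 1)"
    by (simp add: m' one_enat_def)
  also have "\<dots> \<le> enat (m * h + h - 1)" using m'(2) by (simp add: diff_le_mono)
  finally show False using less assms(2) by simp
qed

section \<open>Isotropic subspaces\<close>

text \<open>Symplectic forms (\<open>\<sigma> = - 1\<close>) and polar forms of quadratic forms (\<open>\<sigma> = 1\<close>) are treated
  simultaneously.\<close>

locale polar_space = finite_dimensional_vector_space s Basis
  for s :: "complex \<Rightarrow> 'v :: ab_group_add \<Rightarrow> 'v" and Basis :: "'v set" +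
  fixes b :: "'v \<Rightarrow> 'v \<Rightarrow> complex" and \<sigma> :: complex and n :: nat
  assumes dim_V: "dim UNIV = 2 * n" and bilinear: "bilinear_form s b" and nondeg: "nondegenerate b"
    and sym: "b y x = \<sigma> * b x y" and \<sigma>: "\<sigma> = 1 \<or> \<sigma> = - 1"
begin

lemma b_linear_right: "Vector_Spaces.linear s (*) (b x)"
  and b_linear_left: "Vector_Spaces.linear s (*) (\<lambda>x. b x y)"
  using bilinear by (auto simp: bilinear_form_def)

lemmas b_add_right = functional_add[OF b_linear_right]
  and b_scale_right = functional_scale[OF b_linear_right]
  and b_sum_right = functional_sum[OF b_linear_right]
  and b_zero_right = functional_zero[OF b_linear_right]
  and b_add_left = functional_add[OF b_linear_left]
  and b_scale_left = functional_scale[OF b_linear_left]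
  and b_sum_left = functional_sum[OF b_linear_left]
  and b_zero_left = functional_zero[OF b_linear_left]

lemma \<sigma>_square: "\<sigma> * \<sigma> = 1"
  using \<sigma> by auto

definition isotropic :: "'v set \<Rightarrow> bool" where
  "isotropic W \<longleftrightarrow> (\<forall>x\<in>W. \<forall>y\<in>W. b x y = 0)"

text \<open>A Darboux basis for \<open>\<sigma> = - 1\<close> and a hyperbolic basis for
  \<open>\<sigma> = 1\<close>.\<close>

definition frame :: "(nat \<Rightarrow> 'v) \<Rightarrow> (nat \<Rightarrow> 'v) \<Rightarrow> bool" where
  "frame e f \<longleftrightarrow> (\<forall>i<n. \<forall>j<n. b (e i) (e j) = 0 \<and> b (f i) (f j) = 0 \<and>
     b (e i) (f j) = (if i = j then 1 else 0))"

lemma frameD: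
  assumes "frame e f" "i < n" "j < n"
  shows "b (e i) (e j) = 0" "b (f i) (f j) = 0" "b (e i) (f j) = (if i = j then 1 else 0)"
    "b (f i) (e j) = (if i = j then \<sigma> else 0)"
  using assms sym[of "f i" "e j"] by (auto simp: frame_def)

text \<open>Pairing with the opposite half shows that the \<open>2 * n\<close> vectors are
  independent, hence a basis by dimension, and the linear identity is checked on them. The order of
  the arguments of \<open>b\<close> in the two coefficients keeps \<open>\<sigma>\<close> out of the
  formula.\<close>

lemma frame_decompose:
  assumes fr: "frame e f"
  shows "x = (\<Sum>i<n. s (b x (f i)) (e i)) + (\<Sum>i<n. s (b (e i) x) (f i))"
proof -
  define g where "g i = (if i < n then e i else f (i - n))" for i
  have "(\<Sum>i<n + m. h i) = (\<Sum>i<n. h i) + (\<Sum>i<m. h (n + i))" for h :: "nat \<Rightarrow> 'v" and m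
    by (induction m) (auto simp: add.assoc)
  then have split: "(\<Sum>i<2 * n. h i) = (\<Sum>i<n. h i) + (\<Sum>i<n. h (n + i))" for h :: "nat \<Rightarrow> 'v"
    by (simp add: mult_2)
  have zero: "\<forall>i\<in>{..<2 * n}. c i = 0" if c: "(\<Sum>i<2 * n. s (c i) (g i)) = 0" for c
  proof -
    have eq: "(\<Sum>i<n. s (c i) (e i)) + (\<Sum>i<n. s (c (n + i)) (f i)) = 0"
      using c unfolding split by (simp add: g_def)
    have "c j = 0" if j: "j < n" for j
    proof -
      have "b ((\<Sum>i<n. s (c i) (e i)) + (\<Sum>i<n. s (c (n + i)) (f i))) (f j) =
          (\<Sum>i<n. c i * b (e i) (f j)) + (\<Sum>i<n. c (n + i) * b (f i) (f j))"
        by (simp only: b_add_left b_sum_left)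
      also have "(\<Sum>i<n. c i * b (e i) (f j)) = (\<Sum>i<n. if i = j then c i else 0)"
        using frameD[OF fr _ j] by (intro sum.cong) auto
      also have "(\<Sum>i<n. c (n + i) * b (f i) (f j)) = 0"
        using frameD[OF fr _ j] by (intro sum.neutral) auto
      finally show ?thesis using j by (simp add: eq b_zero_left)
    qed
    moreover have "c (n + j) = 0" if j: "j < n" for j
    proof -
      have "b (e j) ((\<Sum>i<n. s (c i) (e i)) + (\<Sum>i<n. s (c (n + i)) (f i))) =
          (\<Sum>i<n. c i * b (e j) (e i)) + (\<Sum>i<n. c (n + i) * b (e j) (f i))"
        by (simp only: b_add_right b_sum_right)
      also have "(\<Sum>i<n. c (n + i) * b (e j) (f i)) = (\<Sum>i<n. if i = j then c (n + i) else 0)"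
        using frameD[OF fr j] by (intro sum.cong) auto
      also have "(\<Sum>i<n. c i * b (e j) (e i)) = 0"
        using frameD[OF fr j] by (intro sum.neutral) auto
      finally show ?thesis using j by (simp add: eq b_zero_right)
    qed
    ultimately have "c j = 0" if "j < 2 * n" for j
      using that by (cases "j < n") (auto dest: meta_spec[of _ "j - n"])
    then show ?thesis by simp
  qed
  have inj: "inj_on g {..<2 * n}" and ind: "independent (g ` {..<2 * n})"
    using independent_family[of "{..<2 * n}" g] zero by auto
  have "card (g ` {..<2 * n}) = dim UNIV" using card_image[OF inj] dim_V by simp
  then have spn: "UNIV \<subseteq> span (g ` {..<2 * n})"
    by (intro card_ge_dim_independent) (use ind in auto)
  let ?R = "\<lambda>x. (\<Sum>i<n. s (b x (f i)) (e i)) + (\<Sum>i<n. s (b (e i) x) (f i))"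
  have "subspace {x. x = ?R x}"
  proof (rule subspaceI)
    show "0 \<in> {x. x = ?R x}" by (simp add: b_zero_left b_zero_right)
    fix x y c assume "x \<in> {x. x = ?R x}" "y \<in> {x. x = ?R x}"
    then have x: "?R x = x" and y: "?R y = y" by auto
    have "?R (x + y) = ?R x + ?R y"
      by (simp add: b_add_left b_add_right scale_left_distrib sum.distrib)
    then show "x + y \<in> {x. x = ?R x}" using x y by simp
    have "?R (s c x) = s c (?R x)"
      by (simp add: b_scale_left b_scale_right scale_right_distrib scale_sum_right)
    then show "s c x \<in> {x. x = ?R x}" using x by simp
  qed
  moreover have "g ` {..<2 * n} \<subseteq> {x. x = ?R x}"
  proof (rule image_subsetI, rule CollectI)
    fix j assume "j \<in> {..<2 * n}"
    have delta: "(\<Sum>i<n. s (if i = k then 1 else 0) (h i)) = h k" if "k < n" for k and h :: "nat \<Rightarrow> 'v"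
    proof -
      have "(\<Sum>i<n. s (if i = k then 1 else 0) (h i)) = (\<Sum>i<n. if i = k then h i else 0)"
        by (intro sum.cong) auto
      then show ?thesis using that by simp
    qed
    show "g j = ?R (g j)"
    proof (cases "j < n")
      case True
      have "?R (e j) = (\<Sum>i<n. s (if i = j then 1 else 0) (e i)) + (\<Sum>i<n. s 0 (f i))"
        using frameD[OF fr] True by (intro arg_cong2[of _ _ _ _ "(+)"] sum.cong) auto
      then show ?thesis using True delta[OF True, of e] by (simp add: g_def)
    next
      case False
      then have k: "j - n < n" using \<open>j \<in> {..<2 * n}\<close> by auto
      have "?R (f (j - n)) = (\<Sum>i<n. s 0 (e i)) + (\<Sum>i<n. s (if i = j - n then 1 else 0) (f i))"
        using frameD[OF fr] k by (intro arg_cong2[of _ _ _ _ "(+)"] sum.cong) auto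
      then show ?thesis using False delta[OF k, of f] by (simp add: g_def)
    qed
  qed
  ultimately have "span (g ` {..<2 * n}) \<subseteq> {x. x = ?R x}" by (rule span_minimal[rotated])
  then show ?thesis using spn by blast
qed

lemma exists_frame:
  assumes W: "subspace W" "dim W = n" "isotropic W"
  shows "\<exists>e f. frame e f \<and> W = span (e ` {..<n})"
proof -
  obtain B where B: "B \<subseteq> W" "independent B" "W \<subseteq> span B" "card B = dim W"
    by (rule basis_exists)
  have "finite B" using B(2) by (rule finiteI_independent)
  then obtain e where e: "bij_betw e {..<n} B"
    using ex_bij_betw_nat_finite[of B] B(4) W(2) unfolding atLeast0LessThan by auto
  have eB: "e ` {..<n} = B" and inj: "inj_on e {..<n}" using e by (auto simp: bij_betw_def)
  have We: "W = span (e ` {..<n})"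
    using B(1,3) eB span_minimal[OF B(1) W(1)] by auto
  have eW: "e i \<in> W" if "i < n" for i using eB B(1) that by auto
  have "\<exists>x. \<forall>i\<in>{..<n}. \<forall>j\<in>{..<n}. b (e i) (x j) = (if i = j then 1 else 0)"
  proof (rule dual_vectors)
    fix c assume c: "\<And>x. (\<Sum>i<n. c i * b (e i) x) = 0"
    then have "b (\<Sum>i<n. s (c i) (e i)) x = 0" for x by (simp only: b_sum_left)
    then have zero: "(\<Sum>i<n. s (c i) (e i)) = 0" using nondeg by (auto simp: nondegenerate_def)
    define u where "u = c \<circ> the_inv_into {..<n} e"
    have "(\<Sum>x\<in>B. s (u x) x) = (\<Sum>i<n. s (u (e i)) (e i))"
      unfolding eB[symmetric] by (simp add: sum.reindex[OF inj])
    also have "\<dots> = (\<Sum>i<n. s (c i) (e i))"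
      by (intro sum.cong) (auto simp: u_def the_inv_into_f_f[OF inj])
    finally have "(\<Sum>x\<in>B. s (u x) x) = 0" using zero by simp
    then have "\<forall>x\<in>B. u x = 0" using B(2) dependent_finite[OF \<open>finite B\<close>] by blast
    then show "\<forall>i\<in>{..<n}. c i = 0" unfolding eB[symmetric] by (simp add: u_def the_inv_into_f_f[OF inj])
  qed (auto intro: b_linear_right)
  then obtain g where g: "\<forall>i\<in>{..<n}. \<forall>j\<in>{..<n}. b (e i) (g j) = (if i = j then 1 else 0)" by blast
  \<comment> \<open>The correction lies in \<open>W\<close>, so the pairing with the
    \<open>e i\<close> is unchanged. It enters \<open>b (f i) (f j)\<close> through both arguments,
    each time removing half of \<open>b (g i) (g j)\<close> because
    \<open>\<sigma> * \<sigma> = 1\<close>.\<close>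
  define f where "f j = g j + (\<Sum>k<n. s (- b (g j) (g k) / 2) (e k))" for j
  have ee: "b (e i) (e j) = 0" if "i < n" "j < n" for i j
    using W(3) eW that by (simp add: isotropic_def)
  have ef: "b (e i) (f j) = (if i = j then 1 else 0)" if "i < n" "j < n" for i j
  proof -
    have "(\<Sum>k<n. (- b (g j) (g k) / 2) * b (e i) (e k)) = 0"
      using ee that by (intro sum.neutral) auto
    then show ?thesis using g that by (simp only: f_def b_add_right b_sum_right) simp
  qed
  have ff: "b (f i) (f j) = 0" if ij: "i < n" "j < n" for i j
  proof -
    have "b (f i) (f j) = b (g i) (f j) + (\<Sum>k<n. (- b (g i) (g k) / 2) * b (e k) (f j))"
      by (simp only: f_def[of i] b_add_left b_sum_left)
    also have "(\<Sum>k<n. (- b (g i) (g k) / 2) * b (e k) (f j)) =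
        (\<Sum>k<n. if k = j then - b (g i) (g k) / 2 else 0)"
      using ef ij by (intro sum.cong) auto
    also have "\<dots> = - b (g i) (g j) / 2" using ij by simp
    also have "b (g i) (f j) = b (g i) (g j) + (\<Sum>k<n. (- b (g j) (g k) / 2) * b (g i) (e k))"
      by (simp only: f_def b_add_right b_sum_right)
    also have "(\<Sum>k<n. (- b (g j) (g k) / 2) * b (g i) (e k)) =
        (\<Sum>k<n. if k = i then - b (g j) (g k) / 2 * \<sigma> else 0)"
      using g ij sym[of "g i" "e _"] by (intro sum.cong) auto
    also have "\<dots> = - b (g j) (g i) / 2 * \<sigma>" using ij by simp
    also have "b (g j) (g i) = \<sigma> * b (g i) (g j)" by (rule sym)
    finally show ?thesis using \<sigma> by auto
  qed
  have "frame e f" using ee ef ff by (simp add: frame_def)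
  with We show ?thesis by blast
qed

section \<open>Affine charts around a maximal isotropic subspace\<close>

definition chart_vec :: "(nat \<Rightarrow> 'v) \<Rightarrow> (nat \<Rightarrow> 'v) \<Rightarrow> (nat \<Rightarrow> nat \<Rightarrow> complex) \<Rightarrow> nat \<Rightarrow> 'v" where
  "chart_vec e f M i = e i + (\<Sum>j<n. s (M i j) (f j))"

lemma b_e_chart_vec:
  assumes "frame e f" "i < n" "j < n" shows "b (e i) (chart_vec e f M j) = M j i"
proof -
  have "(\<Sum>k<n. M j k * b (e i) (f k)) = (\<Sum>k<n. if k = i then M j k else 0)"
    using frameD[OF assms(1)] assms by (intro sum.cong) auto
  then show ?thesis using assms
    by (simp add: chart_vec_def b_add_right b_sum_right frameD[OF assms(1)])
qed

lemma b_chart_vec_f: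
  assumes "frame e f" "i < n" "j < n"
  shows "b (chart_vec e f M j) (f i) = (if j = i then 1 else 0)"
proof -
  have "(\<Sum>k<n. M j k * b (f k) (f i)) = 0"
    using frameD[OF assms(1)] assms by (intro sum.neutral) auto
  then show ?thesis using assms
    by (simp add: chart_vec_def b_add_left b_sum_left frameD[OF assms(1)])
qed

lemma b_chart_vec:
  assumes fr: "frame e f" and "i < n" "j < n"
  shows "b (chart_vec e f M i) (chart_vec e f M j) = M j i + \<sigma> * M i j"
proof -
  have "b (chart_vec e f M i) (chart_vec e f M j) = b (e i) (chart_vec e f M j) +
      (\<Sum>k<n. M i k * b (f k) (chart_vec e f M j))"
    by (simp only: chart_vec_def[of e f M i] b_add_left b_sum_left)
  also have "(\<Sum>k<n. M i k * b (f k) (chart_vec e f M j)) = (\<Sum>k<n. if k = j then \<sigma> * M i k else 0)"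
    using b_chart_vec_f[OF fr _ assms(3), of _ M] sym[of "f _" "chart_vec e f M j"]
    by (intro sum.cong) auto
  finally show ?thesis using assms by (simp add: b_e_chart_vec[OF fr])
qed

text \<open>Symmetric matrices for \<open>\<sigma> = - 1\<close>, skew-symmetric ones for
  \<open>\<sigma> = 1\<close>; by \<open>b_chart_vec\<close> this is isotropy of the graph of
  \<open>M\<close>.\<close>

definition chart_condition :: "(nat \<Rightarrow> nat \<Rightarrow> complex) \<Rightarrow> bool" where
  "chart_condition M \<longleftrightarrow> (\<forall>i<n. \<forall>j<n. M j i = - \<sigma> * M i j)"

lemma span_chart_vec:
  assumes fr: "frame e f" and M: "chart_condition M"
  shows "subspace (span (chart_vec e f M ` {..<n}))" "dim (span (chart_vec e f M ` {..<n})) = n"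
    "isotropic (span (chart_vec e f M ` {..<n}))"
proof -
  let ?w = "chart_vec e f M"
  show "subspace (span (?w ` {..<n}))" by (rule subspace_span)
  have "\<forall>i\<in>{..<n}. c i = 0" if c: "(\<Sum>i<n. s (c i) (?w i)) = 0" for c
  proof
    fix j assume j: "j \<in> {..<n}"
    have "b (\<Sum>i<n. s (c i) (?w i)) (f j) = (\<Sum>i<n. if i = j then c i else 0)"
      unfolding b_sum_left using j by (intro sum.cong) (auto simp: b_chart_vec_f[OF fr])
    then show "c j = 0" using c j by (simp add: b_zero_left)
  qed
  then have "inj_on ?w {..<n}" "independent (?w ` {..<n})"
    using independent_family[of "{..<n}" ?w] by auto
  then show "dim (span (?w ` {..<n})) = n"
    by (simp add: dim_eq_card_independent card_image)
  show "isotropic (span (?w ` {..<n}))"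
    unfolding isotropic_def
  proof (intro ballI)
    fix x y assume x: "x \<in> span (?w ` {..<n})" and y: "y \<in> span (?w ` {..<n})"
    obtain c where c: "x = (\<Sum>i<n. s (c i) (?w i))"
      using in_span_image[OF finite_lessThan x] by (rule exE)
    obtain d where d: "y = (\<Sum>i<n. s (d i) (?w i))"
      using in_span_image[OF finite_lessThan y] by (rule exE)
    have "b (?w i) (?w j) = 0" if "i < n" "j < n" for i j
    proof -
      have "M j i = - \<sigma> * M i j" using M that unfolding chart_condition_def by blast
      then show ?thesis unfolding b_chart_vec[OF fr that] by simp
    qed
    then show "b x y = 0" unfolding c d b_sum_left b_sum_right by (intro sum.neutral) auto
  qed
qed

text \<open>Evaluation at \<open>coframe f\<close> is the Pluecker coordinate that equals 1 on all
  chart vectors; \<open>chart_surj\<close> shows that the chart is all of its nonvanishing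
  locus.\<close>

definition coframe :: "(nat \<Rightarrow> 'v) \<Rightarrow> nat \<Rightarrow> 'v \<Rightarrow> complex" where
  "coframe f i x = b x (f i)"

lemma coframe_linear: "Vector_Spaces.linear s (*) (coframe f i)"
  using b_linear_left by (simp add: coframe_def[abs_def])

lemma wedge_coframe: "wedge s n v (coframe f) = Determinant.det (mat n n (\<lambda>(i, j). b (v j) (f i)))"
  using coframe_linear by (subst wedge_eval) (auto simp: coframe_def)

lemma wedge_chart_vec_coframe:
  assumes "frame e f" shows "wedge s n (chart_vec e f M) (coframe f) = 1"
proof -
  have "mat n n (\<lambda>(i, j). b (chart_vec e f M j) (f i)) = 1\<^sub>m n"
    by (rule eq_matI) (auto simp: b_chart_vec_f[OF assms])
  then show ?thesis by (simp add: wedge_coframe)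
qed

lemma wedge_chart_vec_nonzero: "frame e f \<Longrightarrow> wedge s n (chart_vec e f M) \<noteq> 0"
  using wedge_chart_vec_coframe by (metis zero_fun_apply zero_neq_one)

lemma chart_vec_zero: "chart_vec e f (\<lambda>_ _. 0) = e"
  by (auto simp: chart_vec_def)

text \<open>The nonvanishing coordinate is the determinant of the pairing of a basis of
  \<open>W\<close> with the \<open>f i\<close>. Multiplying the basis by the inverse matrix makes
  its components along \<open>e\<close> the identity; the components along \<open>f\<close> are then
  \<open>M\<close>, and isotropy of \<open>W\<close> gives the chart condition.\<close>

lemma chart_surj:
  assumes fr: "frame e f" and W: "subspace W" "dim W = n" "isotropic W"
    and x: "x \<in> exterior_power s n W" "x (coframe f) \<noteq> 0"
  shows "\<exists>M. chart_condition M \<and> exterior_power s n W = fn.span {wedge s n (chart_vec e f M)}"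
proof -
  obtain v v' where "frame v v'" and Wv: "W = span (v ` {..<n})" using exists_frame[OF W] by blast
  have L: "exterior_power s n W = fn.span {wedge s n v}" unfolding Wv by (rule exterior_power_span[OF vector_space_axioms])
  then obtain c where "x = fscale c (wedge s n v)" using x(1) in_span_singleton_iff by blast
  then have nz: "wedge s n v (coframe f) \<noteq> 0" using x(2) by auto
  define A where "A = mat n n (\<lambda>(i, j). b (v j) (f i))"
  have A: "A \<in> carrier_mat n n" by (simp add: A_def)
  have "Determinant.det A \<noteq> 0" using nz by (simp add: wedge_coframe A_def)
  from det_non_zero_imp_unit[OF A this, of undefined]
  obtain C where C: "C \<in> carrier_mat n n" "A * C = 1\<^sub>m n"
    by (auto simp: Units_def ring_mat_def)
  define w where "w j = (\<Sum>k<n. s (C $$ (k, j)) (v k))" for j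
  have detC: "Determinant.det C \<noteq> 0" using Determinant.det_mult[OF A C(1)] C(2) by auto
  have "mat n n (\<lambda>(k, j). C $$ (k, j)) = C" using C(1) by (intro eq_matI) auto
  then have ww: "wedge s n w = fscale (Determinant.det C) (wedge s n v)"
    using wedge_basis_change[OF vector_space_axioms, of n w "\<lambda>k j. C $$ (k, j)" v] by (simp add: w_def)
  have spn: "fn.span {wedge s n w} = fn.span {wedge s n v}"
    using fn.span_image_scale[of "{wedge s n v}" "\<lambda>_. Determinant.det C"] detC by (simp add: ww)
  have wf: "b (w j) (f i) = (if i = j then 1 else 0)" if "i < n" "j < n" for i j
  proof -
    have "b (w j) (f i) = (A * C) $$ (i, j)"
      using that C(1) by (simp add: w_def b_sum_left A_def scalar_prod_def atLeast0LessThan mult.commute)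
    then show ?thesis using that C(2) by simp
  qed
  have wW: "w j \<in> W" for j
    unfolding w_def Wv by (intro span_sum span_scale span_base) auto
  define M where "M j k = b (e k) (w j)" for j k
  have w_chart: "w j = chart_vec e f M j" if "j < n" for j
  proof -
    have "(\<Sum>i<n. s (b (w j) (f i)) (e i)) = (\<Sum>i<n. if i = j then e i else 0)"
      using that by (intro sum.cong) (auto simp: wf)
    then show ?thesis
      using frame_decompose[OF fr, of "w j"] that by (simp add: chart_vec_def M_def)
  qed
  have "chart_condition M"
    unfolding chart_condition_def
  proof (intro allI impI)
    fix i j assume ij: "i < n" "j < n"
    have "b (w i) (w j) = 0" using wW W(3) by (simp add: isotropic_def)
    then have "M j i + \<sigma> * M i j = 0" using ij by (simp add: w_chart b_chart_vec[OF fr])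
    then show "M j i = - \<sigma> * M i j" by (simp add: eq_neg_iff_add_eq_0)
  qed
  moreover have "wedge s n w = wedge s n (chart_vec e f M)" by (rule wedge_cong) (rule w_chart)
  ultimately show ?thesis using L spn by (intro exI[of _ M]) simp
qed

end

section \<open>The Pluecker embedding in matrix coordinates\<close>

context polar_space
begin

text \<open>The free entries of a matrix subject to \<open>chart_condition\<close>: the strict upper
  triangle, together with the diagonal in the symmetric case. Their number is the dimension of the
  variety.\<close>

definition params :: "(nat \<times> nat) set" where
  "params = {(i, j). i < n \<and> j < n \<and> (i < j \<or> \<sigma> = - 1 \<and> i = j)}"

definition param_matrix :: "(nat \<times> nat \<Rightarrow> complex) \<Rightarrow> nat \<Rightarrow> nat \<Rightarrow> complex" where
  "param_matrix a i j = (if (i, j) \<in> params then a (i, j) else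
     if (j, i) \<in> params then - \<sigma> * a (j, i) else 0)"

lemma finite_params: "finite params"
  by (rule finite_subset[of _ "{..<n} \<times> {..<n}"]) (auto simp: params_def)

lemma param_matrix_scale: "param_matrix (\<lambda>x. \<tau> * a x) i j = \<tau> * param_matrix a i j"
  by (simp add: param_matrix_def)

lemma polyfun_param_matrix: "polyfun params 1 (\<lambda>a. param_matrix a i j)"
proof -
  have "polyfun params 1 (\<lambda>a. a p)" if "p \<in> params" for p
    by (rule polyfun_coord[OF finite_params that])
  then show ?thesis
    by (cases "(i, j) \<in> params"; cases "(j, i) \<in> params")
      (simp_all only: param_matrix_def if_True if_False polyfun_scale polyfun_zero)
qed

lemma param_matrix_sym:
  assumes "i < n" "j < n" shows "param_matrix a j i = - \<sigma> * param_matrix a i j"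
  using assms \<sigma> by (cases i j rule: linorder_cases) (auto simp: param_matrix_def params_def)

lemma chart_condition_imp_param:
  assumes "chart_condition M" "i < n" "j < n"
  shows "M i j = param_matrix (\<lambda>(i, j). M i j) i j"
proof -
  have ij: "M i j = - \<sigma> * M j i" using assms unfolding chart_condition_def by blast
  show ?thesis
  proof (cases i j rule: linorder_cases)
    case less
    then show ?thesis using assms by (simp add: param_matrix_def params_def)
  next
    case equal
    then show ?thesis using assms \<sigma> ij by (auto simp: param_matrix_def params_def)
  next
    case greater
    then have "(i, j) \<notin> params" "(j, i) \<in> params" using assms by (auto simp: params_def)
    then show ?thesis using ij by (simp add: param_matrix_def)
  qed
qed

lemma wedge_chart_vec_cong:
  assumes "\<And>i j. i < n \<Longrightarrow> j < n \<Longrightarrow> M i j = N i j"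
  shows "wedge s n (chart_vec e f M) = wedge s n (chart_vec e f N)"
  by (rule wedge_cong) (auto simp: chart_vec_def assms intro!: sum.cong)

lemma functional_chart_vec:
  assumes "Vector_Spaces.linear s (*) \<phi>"
  shows "\<phi> (chart_vec e f M j) = \<phi> (e j) + (\<Sum>k<n. M j k * \<phi> (f k))"
  unfolding chart_vec_def functional_add[OF assms] functional_sum[OF assms] ..

text \<open>The coordinates are indexed by arbitrary tuples \<open>\<phi>\<close>, an infinite type;
  what matters for the counting is that the degree bound \<open>n\<close> is the same for all of
  them.\<close>

lemma polyfun_wedge_chart_vec:
  assumes "\<And>i j. polyfun J 1 (\<lambda>a. M a i j)"
  shows "polyfun J n (\<lambda>a. wedge s n (chart_vec e f (M a)) \<phi>)"
proof (cases "\<forall>i<n. Vector_Spaces.linear s (*) (\<phi> i)")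
  case True
  have "wedge s n (chart_vec e f (M a)) \<phi> =
      Determinant.det (mat n n (\<lambda>(i, j). \<phi> i (e j) + (\<Sum>k<n. M a j k * \<phi> i (f k))))" for a
    using True by (subst wedge_eval) (auto intro!: arg_cong[of _ _ Determinant.det] eq_matI functional_chart_vec)
  moreover have "polyfun J n (\<lambda>a. Determinant.det (mat n n
      (\<lambda>(i, j). \<phi> i (e j) + (\<Sum>k<n. M a j k * \<phi> i (f k)))))"
  proof (rule polyfun_det)
    fix i j
    have "polyfun J 1 (\<lambda>a. M a j k * \<phi> i (f k))" for k
      using polyfun_scale[OF assms[of j k], of "\<phi> i (f k)"] by (simp only: mult.commute)
    then show "polyfun J 1 (\<lambda>a. \<phi> i (e j) + (\<Sum>k<n. M a j k * \<phi> i (f k)))"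
      by (intro polyfun_add polyfun_const polyfun_sum)
  qed
  ultimately show ?thesis by simp
next
  case False
  then have "wedge s n (chart_vec e f (M a)) \<phi> = 0" for a unfolding wedge_def by (simp only: if_False)
  then show ?thesis by (simp only: polyfun_zero)
qed

lemma isotropic_line:
  assumes "subspace W" "dim W = n" "isotropic W"
  obtains e f where "frame e f" "W = span (e ` {..<n})" "exterior_power s n W = fn.span {wedge s n e}"
    "wedge s n e \<noteq> 0" "wedge s n e (coframe f) = 1"
proof -
  obtain e f where ef: "frame e f" "W = span (e ` {..<n})" using exists_frame[OF assms] by blast
  show ?thesis
  proof (rule that[OF ef])
    show "exterior_power s n W = fn.span {wedge s n e}"
      unfolding ef(2) by (rule exterior_power_span[OF vector_space_axioms])
    show "wedge s n e \<noteq> 0"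
      using wedge_chart_vec_nonzero[OF ef(1), of "\<lambda>_ _. 0"] unfolding chart_vec_zero .
    show "wedge s n e (coframe f) = 1"
      using wedge_chart_vec_coframe[OF ef(1), of "\<lambda>_ _. 0"] unfolding chart_vec_zero .
  qed
qed

lemma isotropic_subset_proj_space:
  assumes "\<And>L. L \<in> X \<Longrightarrow> \<exists>W. subspace W \<and> dim W = n \<and> isotropic W \<and> L = exterior_power s n W"
    and "fn.subspace E" "\<Union>X \<subseteq> E"
  shows "X \<subseteq> proj_space E"
proof
  fix L assume L: "L \<in> X"
  from assms(1)[OF this] obtain W where W: "subspace W" "dim W = n" "isotropic W"
    "L = exterior_power s n W" by (elim exE conjE) (rule that)
  obtain e f where e: "L = fn.span {wedge s n e}" "wedge s n e \<noteq> 0"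
    by (rule isotropic_line[OF W(1-3)]) (simp add: that W(4))
  have "wedge s n e \<in> E" using e(1) L assms(3) fn.span_base[of "wedge s n e" "{wedge s n e}"] by blast
  then show "L \<in> proj_space E" unfolding e(1) using e(2) assms(2) by (intro proj_spaceI)
qed

text \<open>Every point is the centre of a chart of its own, built from a frame whose
  \<open>e i\<close> span the given subspace.\<close>

lemma variety_dim_isotropic_le:
  assumes X: "\<And>L. L \<in> X \<Longrightarrow> \<exists>W. subspace W \<and> dim W = n \<and> isotropic W \<and> L = exterior_power s n W"
    and XE: "X \<subseteq> proj_space E"
  shows "variety_dim E X \<le> enat (card params)"
proof (rule variety_dim_le[OF finite_params XE])
  fix L assume L: "L \<in> X"
  from X[OF this] obtain W where W: "subspace W" "dim W = n" "isotropic W"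
    "L = exterior_power s n W" by (elim exE conjE) (rule that)
  obtain e f where fr: "frame e f" and e: "exterior_power s n W = fn.span {wedge s n e}"
    "wedge s n e (coframe f) = 1"
    by (rule isotropic_line[OF W(1-3)])
  define U where "U = X \<inter> nonvanishing_locus E (\<lambda>x. x (coframe f))"
  define \<psi> where "\<psi> a = wedge s n (chart_vec e f (param_matrix a))" for a
  have U_open: "openin (subtopology (zariski E) X) U"
    unfolding U_def openin_subtopology
    by (intro exI[of _ "nonvanishing_locus E (\<lambda>x. x (coframe f))"] conjI
        openin_nonvanishing_locus[OF homogeneous_poly.coord] Int_commute)
  have LU: "L \<in> U"
  proof -
    have "L \<in> nonvanishing_locus E (\<lambda>x. x (coframe f))"
      unfolding W(4) e(1) nonvanishing_locus_span[OF homogeneous_poly.coord]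
      using L XE W(4) e by auto
    then show ?thesis using L by (simp add: U_def)
  qed
  have poly: "polyfun params n (\<lambda>a. \<psi> a i)" for i
    unfolding \<psi>_def by (intro polyfun_wedge_chart_vec polyfun_param_matrix)
  have van: "vanishes_on g U" if g: "homogeneous_poly d g" "\<forall>a. g (\<psi> a) = 0" for d g
    unfolding vanishes_on_def
  proof (intro ballI)
    fix L' x assume L': "L' \<in> U" "x \<in> L'"
    then have "L' \<in> X" by (simp add: U_def)
    from X[OF this] obtain W' where W': "subspace W'" "dim W' = n" "isotropic W'"
      "L' = exterior_power s n W'" by (elim exE conjE) (rule that)
    obtain x' where x': "x' \<in> exterior_power s n W'" "x' (coframe f) \<noteq> 0"
      using L'(1) W'(4) by (auto simp: U_def nonvanishing_locus_def)
    from chart_surj[OF fr W'(1-3) x'] obtain M where M: "chart_condition M"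
      "exterior_power s n W' = fn.span {wedge s n (chart_vec e f M)}" by blast
    have "wedge s n (chart_vec e f M) = \<psi> (\<lambda>(i, j). M i j)"
      unfolding \<psi>_def using chart_condition_imp_param[OF M(1)] by (intro wedge_chart_vec_cong)
    then have "x \<in> fn.span {\<psi> (\<lambda>(i, j). M i j)}" using M(2) L'(2) W'(4) by simp
    then show "g x = 0" using homogeneous_poly_span_zero[OF g(1)] g(2) by blast
  qed
  show "\<exists>U D (\<psi> :: (nat \<times> nat \<Rightarrow> complex) \<Rightarrow> (nat \<Rightarrow> 'v \<Rightarrow> complex) \<Rightarrow> complex).
      openin (subtopology (zariski E) X) U \<and> L \<in> U \<and> (\<forall>i. polyfun params D (\<lambda>a. \<psi> a i)) \<and>
      (\<forall>d g. homogeneous_poly d g \<longrightarrow> (\<forall>a. g (\<psi> a) = 0) \<longrightarrow> vanishes_on g U)"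
    by (intro exI[of _ U] exI[of _ n] exI[of _ \<psi>] conjI allI impI U_open LU poly) (rule van)
qed

text \<open>The points of tangency are the charts at \<open>t\<close> times the (signed) permutation matrix with entries
  \<open>\<epsilon> i\<close> at \<open>(i, \<pi> i)\<close> for \<open>i < r\<close>. After the permutation of the columns by \<open>\<pi>\<close> it is \<open>t\<close> times the
  identity of size \<open>r\<close>.\<close>

lemma plucker_not_h_defective:
  fixes \<pi> :: "nat \<Rightarrow> nat" and \<epsilon> :: "nat \<Rightarrow> complex"
  assumes h: "h \<ge> 1"
    and X: "\<And>L. L \<in> X \<Longrightarrow> \<exists>W. subspace W \<and> dim W = n \<and> isotropic W \<and> L = exterior_power s n W"
    and chart: "\<And>e f M. frame e f \<Longrightarrow> exterior_power s n (span (e ` {..<n})) \<in> X \<Longrightarrow>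
      chart_condition M \<Longrightarrow> fn.span {wedge s n (chart_vec e f M)} \<in> X"
    and ne: "X \<noteq> {}"
    and r: "r \<le> n" "2 * h - 1 \<le> r"
    and \<pi>: "\<And>i. i < n \<Longrightarrow> \<pi> i < n" "\<And>i. i < n \<Longrightarrow> \<pi> (\<pi> i) = i" "\<And>i. i < r \<Longrightarrow> \<pi> i < r"
    and \<epsilon>: "\<And>i. i < n \<Longrightarrow> \<epsilon> i * \<epsilon> i = 1" "\<And>i. i < r \<Longrightarrow> \<epsilon> (\<pi> i) = - \<sigma> * \<epsilon> i"
    and slot: "\<And>i. (i, \<pi> i) \<in> params \<Longrightarrow> i < r \<and> \<epsilon> i = 1"
  shows "\<not> h_defective (linear_span X) h X"
proof -
  let ?E = "linear_span X"
  have E: "fn.subspace ?E" unfolding linear_span_def by (rule fn.subspace_span)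
  have XE: "X \<subseteq> proj_space ?E"
    using X E by (rule isotropic_subset_proj_space) (auto simp: linear_span_def intro: fn.span_base)
  obtain L0 where L0: "L0 \<in> X" using ne by blast
  from X[OF this] obtain W where W: "subspace W" "dim W = n" "isotropic W"
    "L0 = exterior_power s n W" by (elim exE conjE) (rule that)
  obtain e f where fr: "frame e f" and We: "W = span (e ` {..<n})"
    by (rule isotropic_line[OF W(1-3)])
  have base: "exterior_power s n (span (e ` {..<n})) \<in> X" using L0 W(4) We by simp
  define P0 where "P0 i j = (if i < r \<and> j = \<pi> i then \<epsilon> i else 0)" for i j
  define M where "M t a i j = t * P0 i j + param_matrix a i j" for t a i j
  define \<Phi> where "\<Phi> t a = wedge s n (chart_vec e f (M t a))" for t a
  define y where "y p v = \<epsilon> p * param_matrix v p (\<pi> p)" for p v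
  have P0_sym: "P0 j i = - \<sigma> * P0 i j" if "i < n" "j < n" for i j
  proof (cases "i < r \<and> j = \<pi> i")
    case True
    then show ?thesis using \<pi> \<epsilon>(2)[of i] that by (simp add: P0_def)
  next
    case False
    then have "\<not> (j < r \<and> i = \<pi> j)" using \<pi> that by auto
    with False show ?thesis by (auto simp: P0_def)
  qed
  have P0_\<pi>: "\<epsilon> l * P0 j (\<pi> l) = (if l = j then 1 else 0)" if "l < r" "j < n" for l j
  proof (cases "l = j")
    case True
    then show ?thesis using that \<epsilon>(1)[of j] by (simp add: P0_def)
  next
    case False
    have "\<pi> l \<noteq> \<pi> j"
    proof
      assume "\<pi> l = \<pi> j"
      then have "\<pi> (\<pi> l) = \<pi> (\<pi> j)" by (rule arg_cong)
      then show False using False that r \<pi>(2)[of l] \<pi>(2)[of j] by simp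
    qed
    then show ?thesis using False by (simp add: P0_def)
  qed
  have cond: "chart_condition (M t a)" for t a
    unfolding chart_condition_def
  proof (intro allI impI)
    fix i j assume "i < n" "j < n"
    from P0_sym[OF this] param_matrix_sym[OF this, of a]
    show "M t a j i = - \<sigma> * M t a i j" by (simp only: M_def) (simp add: algebra_simps)
  qed
  have poly: "polyfun params n (\<lambda>a. \<Phi> t a \<phi>)" for t \<phi>
    unfolding \<Phi>_def M_def
    by (intro polyfun_wedge_chart_vec polyfun_add polyfun_const polyfun_param_matrix)
  have mem: "fn.span {\<Phi> t a} \<in> X" for t a
    unfolding \<Phi>_def by (rule chart[OF fr base cond])
  have b_e: "b (e i) (chart_vec e f (M t (\<lambda>x. \<tau> * v x)) j) = t * P0 j i + \<tau> * param_matrix v j i"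
    if "i < n" "j < n" for i j t \<tau> v
    unfolding b_e_chart_vec[OF fr that] M_def param_matrix_scale ..
  have b_f: "coframe f l (chart_vec e f (M t a) j) = (if l = j then 1 else 0)" if "l < n" "j < n" for l j t a
    unfolding coframe_def b_chart_vec_f[OF fr that] by auto
  \<comment> \<open>Row \<open>l\<close> of the minor pairs with \<open>e (\<pi> l)\<close> in place
    of \<open>f l\<close>, which puts \<open>t\<close> on the diagonal; subtracting
    \<open>u l\<close> times the coframe moves the root from 0 to \<open>u l\<close>.\<close>
  have row_linear: "Vector_Spaces.linear s (*) (\<lambda>x. \<epsilon> l * b (e (\<pi> l)) x - u l * coframe f l x)" for u l
    by (rule functionalI) (simp_all add: coframe_def b_add_right b_add_left b_scale_right b_scale_left algebra_simps)
  have row: "\<epsilon> l * b (e (\<pi> l)) (chart_vec e f (M t (\<lambda>x. \<tau> * v x)) j) -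
      u l * coframe f l (chart_vec e f (M t (\<lambda>x. \<tau> * v x)) j) =
      (if l = j then t - u l else 0) + \<tau> * (\<epsilon> l * param_matrix v j (\<pi> l))"
    if "l < r" "j < n" for l j t \<tau> v u
  proof -
    have "\<epsilon> l * (t * P0 j (\<pi> l) + \<tau> * param_matrix v j (\<pi> l)) =
        t * (\<epsilon> l * P0 j (\<pi> l)) + \<tau> * (\<epsilon> l * param_matrix v j (\<pi> l))" by (simp add: algebra_simps)
    then show ?thesis using that r \<pi>(1)[of l] P0_\<pi>[OF that] by (simp add: b_e b_f)
  qed
  \<comment> \<open>A permutation that moves one index moves a second one. Its Leibniz term
    therefore contains two off-diagonal entries, whose constant terms vanish below.\<close>
  have moved: "\<exists>j. j < n \<and> j \<noteq> i \<and> p j \<noteq> j" if "p permutes {0..<n}" "i < n" "p i \<noteq> i" for p i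
  proof (intro exI[of _ "p i"] conjI)
    show "p i < n" using permutes_in_image[OF that(1), of i] that(2) by simp
    show "p (p i) \<noteq> p i" using permutes_inj[OF that(1)] that(3) by (auto dest: injD)
  qed (rule that(3))
  have ex_moved: "\<exists>i<n. p i \<noteq> i" if "p permutes {0..<n}" "p \<noteq> id" for p
    using that permutes_not_in[OF that(1)] by (fastforce simp: fun_eq_iff)
  have prod_P: "(\<Prod>i<n. if i \<in> P then g i else 1) = prod g P" if "P \<subseteq> {..<r}"
    for P and g :: "nat \<Rightarrow> complex"
  proof -
    have "{..<n} \<inter> P = P" using that r by auto
    then show ?thesis using prod.inter_restrict[of "{..<n}" g P] by simp
  qed
  have diag: "\<exists>L. homogeneous_poly 1 L \<and>
      (\<forall>t v. ord2 (\<lambda>\<tau>. L (\<Phi> t (\<lambda>x. \<tau> * v x)) - (\<Prod>p\<in>P. (t - u p) + \<tau> * y p v)))"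
    if P: "P \<subseteq> {..<r}" for P u
  proof -
    \<comment> \<open>In this realisation of the exterior power, evaluation at any tuple of
      functionals is a coordinate. The linear combination of minors with prescribed roots is
      therefore a single coordinate.\<close>
    define \<phi> where "\<phi> l = (if l \<in> P then (\<lambda>x. \<epsilon> l * b (e (\<pi> l)) x - u l * coframe f l x) else coframe f l)" for l
    have lin: "Vector_Spaces.linear s (*) (\<phi> l)" for l
      unfolding \<phi>_def using row_linear coframe_linear by simp
    define A where "A t l j = (if l = j then if l \<in> P then t - u l else 1 else 0)" for t l and j :: nat
    define C where "C v l j = (if l \<in> P then \<epsilon> l * param_matrix v j (\<pi> l) else 0)" for v l j
    have "ord2 (\<lambda>\<tau>. \<Phi> t (\<lambda>x. \<tau> * v x) \<phi> - (\<Prod>p\<in>P. (t - u p) + \<tau> * y p v))" for t v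
    proof -
      have "\<Phi> t (\<lambda>x. \<tau> * v x) \<phi> = Determinant.det (mat n n (\<lambda>(l, j). A t l j + \<tau> * C v l j))" for \<tau>
      proof -
        have "\<phi> l (chart_vec e f (M t (\<lambda>x. \<tau> * v x)) j) = A t l j + \<tau> * C v l j" if "l < n" "j < n" for l j
        proof (cases "l \<in> P")
          case True
          then have "l < r" using P by auto
          from row[OF this that(2)] show ?thesis using True by (auto simp: \<phi>_def A_def C_def)
        qed (auto simp: \<phi>_def A_def C_def b_f that)
        then show ?thesis unfolding \<Phi>_def wedge_eval[of n s \<phi>, OF lin]
          by (intro arg_cong[of _ _ Determinant.det] eq_matI) auto
      qed
      moreover have "ord2 (\<lambda>\<tau>. Determinant.det (mat n n (\<lambda>(l, j). A t l j + \<tau> * C v l j)) -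
          (\<Prod>i<n. A t i i + \<tau> * C v i i))"
      proof (rule ord2_det_affine, rule disjI2)
        fix p assume p: "p permutes {0..<n}" "p \<noteq> id"
        obtain i where i: "i < n" "p i \<noteq> i" using ex_moved[OF p] by blast
        obtain j where j: "j < n" "j \<noteq> i" "p j \<noteq> j" using moved[OF p(1) i] by blast
        show "\<exists>i<n. \<exists>j<n. i \<noteq> j \<and> A t i (p i) = 0 \<and> A t j (p j) = 0"
          using i j by (intro exI[of _ i] exI[of _ j] conjI) (auto simp: A_def)
      qed
      moreover have "(\<Prod>i<n. A t i i + \<tau> * C v i i) = (\<Prod>p\<in>P. (t - u p) + \<tau> * y p v)" for \<tau>
      proof -
        have "(\<Prod>i<n. A t i i + \<tau> * C v i i) = (\<Prod>i<n. if i \<in> P then (t - u i) + \<tau> * y i v else 1)"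
          by (intro prod.cong) (auto simp: A_def C_def y_def)
        then show ?thesis using prod_P[OF P] by simp
      qed
      ultimately show ?thesis by simp
    qed
    then show ?thesis
      by (intro exI[of _ "\<lambda>x. x \<phi>"] conjI allI homogeneous_poly.coord)
  qed
  have off: "(\<exists>p\<in>{..<r}. \<forall>v. y p v = v i) \<or>
      (\<exists>p q. \<forall>P u. P \<subseteq> {..<r} - {p, q} \<longrightarrow> (\<exists>L. homogeneous_poly 1 L \<and>
        (\<forall>t v. ord2 (\<lambda>\<tau>. L (\<Phi> t (\<lambda>x. \<tau> * v x)) - \<tau> * v i * (\<Prod>p\<in>P. (t - u p) + \<tau> * y p v)))))"
    if i: "i \<in> params" for i
  proof -
    obtain a c where ac: "i = (a, c)" "a < n" "c < n" using i by (auto simp: params_def)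
    have v_ac: "param_matrix v a c = v i" for v using i ac(1) by (simp add: param_matrix_def)
    show ?thesis
    proof (cases "a = \<pi> c")
      case True
      then have "c = \<pi> a" using \<pi>(2)[of c] ac by simp
      then have "a < r" "\<epsilon> a = 1" using slot[of a] i ac(1) by auto
      then have "\<forall>v. y a v = v i" using v_ac \<open>c = \<pi> a\<close> by (simp add: y_def)
      then show ?thesis using \<open>a < r\<close> by blast
    next
      case False
      \<comment> \<open>To read off the parameter at \<open>(a, c)\<close>, row \<open>a\<close> is
        paired with \<open>e c\<close>. The constant part of that row sits in column
        \<open>c'\<close> alone, so keeping rows \<open>a\<close> and \<open>c'\<close> free of
        slots makes its diagonal entry the parameter times \<open>\<tau>\<close>.\<close>
      define c' where "c' = \<pi> c"
      have c': "c' < n" "a \<noteq> c'" using False ac \<pi> by (auto simp: c'_def)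
      have "\<exists>L. homogeneous_poly 1 L \<and>
        (\<forall>t v. ord2 (\<lambda>\<tau>. L (\<Phi> t (\<lambda>x. \<tau> * v x)) - \<tau> * v i * (\<Prod>p\<in>P. (t - u p) + \<tau> * y p v)))"
        if P: "P \<subseteq> {..<r} - {a, c'}" for P u
      proof -
        have Pr: "P \<subseteq> {..<r}" "a \<notin> P" "c' \<notin> P" using P by auto
        define \<phi> where "\<phi> l = (if l = a then b (e c) else
          if l \<in> P then (\<lambda>x. \<epsilon> l * b (e (\<pi> l)) x - u l * coframe f l x) else coframe f l)" for l
        have lin: "Vector_Spaces.linear s (*) (\<phi> l)" for l
          unfolding \<phi>_def using row_linear coframe_linear b_linear_right by simp
        define A where "A t l j = (if l = a then t * P0 j c else
          if l = j then if l \<in> P then t - u l else 1 else 0)" for t l and j :: nat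
        define C where "C v l j = (if l = a then param_matrix v j c else
          if l \<in> P then \<epsilon> l * param_matrix v j (\<pi> l) else 0)" for v l j
        have P0_c: "P0 j c = 0" if "j < n" "j \<noteq> c'" for j
          using that \<pi>(2)[of j] by (auto simp: P0_def c'_def)
        have "ord2 (\<lambda>\<tau>. \<Phi> t (\<lambda>x. \<tau> * v x) \<phi> - \<tau> * v i * (\<Prod>p\<in>P. (t - u p) + \<tau> * y p v))" for t v
        proof -
          have "\<Phi> t (\<lambda>x. \<tau> * v x) \<phi> = Determinant.det (mat n n (\<lambda>(l, j). A t l j + \<tau> * C v l j))" for \<tau>
          proof -
            have "\<phi> l (chart_vec e f (M t (\<lambda>x. \<tau> * v x)) j) = A t l j + \<tau> * C v l j"
              if "l < n" "j < n" for l j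
            proof (cases "l = a")
              case True
              then show ?thesis using b_e[OF ac(3) that(2)] by (simp add: \<phi>_def A_def C_def)
            next
              case la: False
              show ?thesis
              proof (cases "l \<in> P")
                case True
                then have "l < r" using P by auto
                from row[OF this that(2)] show ?thesis using True la by (auto simp: \<phi>_def A_def C_def)
              qed (auto simp: \<phi>_def A_def C_def b_f that la)
            qed
            then show ?thesis unfolding \<Phi>_def wedge_eval[of n s \<phi>, OF lin]
              by (intro arg_cong[of _ _ Determinant.det] eq_matI) auto
          qed
          moreover have "ord2 (\<lambda>\<tau>. Determinant.det (mat n n (\<lambda>(l, j). A t l j + \<tau> * C v l j)) -
              (\<Prod>i<n. A t i i + \<tau> * C v i i))"
          proof (rule ord2_det_affine)
            fix p assume p: "p permutes {0..<n}" "p \<noteq> id"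
            show "(\<exists>i<n. A t i (p i) = 0 \<and> C v i (p i) = 0) \<or>
              (\<exists>i<n. \<exists>j<n. i \<noteq> j \<and> A t i (p i) = 0 \<and> A t j (p j) = 0)"
            \<comment> \<open>Row \<open>c'\<close> is a plain coframe row, with the constant 1 on
              the diagonal and zeros elsewhere. If \<open>p\<close> moves \<open>c'\<close>, its
              term is identically zero. Otherwise row \<open>a\<close> avoids column
              \<open>c'\<close> and has zero constant term, as has another row moved by
              \<open>p\<close>.\<close>
            proof (cases "p c' = c'")
              case False
              then have "A t c' (p c') = 0" "C v c' (p c') = 0"
                using c' Pr by (auto simp: A_def C_def)
              then show ?thesis using c'(1) by blast
            next
              case True
              have "p a \<noteq> c'" using True c'(2) permutes_inj[OF p(1)] by (metis injD)
              moreover have "p a < n" using permutes_in_image[OF p(1), of a] ac(2) by simp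
              ultimately have A_a: "A t a (p a) = 0" using P0_c by (simp add: A_def)
              obtain i where i: "i < n" "p i \<noteq> i" using ex_moved[OF p] by blast
              obtain j where j: "j < n" "j \<noteq> a" "p j \<noteq> j"
                using moved[OF p(1) i] i by metis
              then have "A t j (p j) = 0" by (simp add: A_def)
              then show ?thesis using A_a j ac(2) by blast
            qed
          qed
          moreover have "(\<Prod>i<n. A t i i + \<tau> * C v i i) = \<tau> * v i * (\<Prod>p\<in>P. (t - u p) + \<tau> * y p v)" for \<tau>
          proof -
            have "(\<Prod>i<n. A t i i + \<tau> * C v i i) =
                (A t a a + \<tau> * C v a a) * (\<Prod>i\<in>{..<n} - {a}. A t i i + \<tau> * C v i i)"
              using ac(2) by (intro prod.remove) auto
            also have "A t a a + \<tau> * C v a a = \<tau> * v i"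
              using P0_c[OF ac(2) c'(2)] v_ac by (simp add: A_def C_def)
            also have "(\<Prod>i\<in>{..<n} - {a}. A t i i + \<tau> * C v i i) =
                (\<Prod>i\<in>{..<n} - {a}. if i \<in> P then (t - u i) + \<tau> * y i v else 1)"
              by (intro prod.cong) (auto simp: A_def C_def y_def)
            also have "\<dots> = (\<Prod>i<n. if i \<in> P then (t - u i) + \<tau> * y i v else 1)"
              using Pr(2) by (intro prod.mono_neutral_left) auto
            also have "\<dots> = (\<Prod>p\<in>P. (t - u p) + \<tau> * y p v)" by (rule prod_P[OF Pr(1)])
            finally show ?thesis .
          qed
          ultimately show ?thesis by simp
        qed
        then show ?thesis
          by (intro exI[of _ "\<lambda>x. x \<phi>"] conjI allI homogeneous_poly.coord)
      qed
      then show ?thesis by (intro disjI2 exI[of _ a] exI[of _ c'] allI impI)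
    qed
  qed
  have S: "finite {..<r}" "2 * h - 1 \<le> card {..<r}" using r(2) by auto
  have "enat (card params * h + h - 1) \<le> variety_dim ?E (secant_variety ?E h X)"
    by (rule variety_dim_secant_ge_slots[where \<Phi> = \<Phi> and y = y and S = "{..<r}",
      OF finite_params E XE h S poly mem diag off])
  with variety_dim_isotropic_le[OF X XE] show ?thesis by (rule not_h_defectiveI)
qed

end

section \<open>Pfaffians\<close>

definition mate :: "nat \<Rightarrow> nat" where
  "mate x = (if even x then x + 1 else x - 1)"

lemma mate_mate: "mate (mate x) = x"
  by (auto simp: mate_def)

lemma mate_neq: "mate x \<noteq> x"
  by (cases "even x") (auto simp: mate_def elim: oddE)

lemma mate_div2: "mate x div 2 = x div 2"
  by (cases "even x") (auto simp: mate_def elim: evenE oddE)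

lemma prod_blocks_right_swap:
  fixes T :: "nat \<Rightarrow> nat \<Rightarrow> complex"
  assumes "i0 < k" "k0 < k"
    and "\<And>i. i < k \<Longrightarrow> \<tau> (2 * i) = 2 * Transposition.transpose i0 k0 i"
    and "\<And>i. i < k \<Longrightarrow> \<tau> (2 * i + 1) = 2 * Transposition.transpose i0 k0 i + 1"
  shows "(\<Prod>i<k. T ((\<rho> \<circ> \<tau>) (2 * i)) ((\<rho> \<circ> \<tau>) (2 * i + 1))) = (\<Prod>i<k. T (\<rho> (2 * i)) (\<rho> (2 * i + 1)))"
proof -
  have bij: "bij_betw (Transposition.transpose i0 k0) {..<k} {..<k}"
    using assms(1,2) by (intro permutes_imp_bij permutes_swap_id) auto
  have "(\<Prod>i<k. T ((\<rho> \<circ> \<tau>) (2 * i)) ((\<rho> \<circ> \<tau>) (2 * i + 1))) =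
      (\<Prod>i<k. T (\<rho> (2 * Transposition.transpose i0 k0 i)) (\<rho> (2 * Transposition.transpose i0 k0 i + 1)))"
    using assms(3,4) by (intro prod.cong) auto
  also have "\<dots> = (\<Prod>i<k. T (\<rho> (2 * i)) (\<rho> (2 * i + 1)))"
    by (rule prod.reindex_bij_betw[OF bij])
  finally show ?thesis .
qed

text \<open>The sign of a permutation of the blocks \<open>{2i, 2i + 1}\<close> is determined by the orientations of
  the blocks, since a transposition of two blocks is even. The block that is mapped to the last one
  is moved to the last place by composition on the right.\<close>

lemma sign_block_permutation:
  fixes T :: "nat \<Rightarrow> nat \<Rightarrow> complex"
  assumes "\<rho> permutes {..<2 * k}" and "\<And>i. i < k \<Longrightarrow> \<rho> (2 * i + 1) = mate (\<rho> (2 * i))"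
    and T: "\<And>x y. T y x = - T x y"
  shows "of_int (sign \<rho>) * (\<Prod>i<k. T (\<rho> (2 * i)) (\<rho> (2 * i + 1))) = (\<Prod>i<k. T (2 * i) (2 * i + 1))"
  using assms(1,2)
proof (induction k arbitrary: \<rho>)
  case 0
  then show ?case by (simp add: sign_id)
next
  case (Suc k)
  define g where "g \<rho> = of_int (sign \<rho>) * (\<Prod>i<Suc k. T (\<rho> (2 * i)) (\<rho> (2 * i + 1)))" for \<rho>
  have perm: "permutation \<rho>" using Suc.prems(1) by (rule permutation_permutes[THEN iffD2, OF exI, OF conjI, rotated]) simp
  have "2 * k \<in> \<rho> ` {..<2 * Suc k}" using permutes_image[OF Suc.prems(1)] by simp
  then obtain m where m: "m < 2 * Suc k" "\<rho> m = 2 * k" by auto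
  define i0 where "i0 = m div 2"
  have i0: "i0 < Suc k" using m(1) by (simp add: i0_def)
  have cases: "\<rho> (2 * i0) = 2 * k \<or> \<rho> (2 * i0) = 2 * k + 1"
  proof (cases "even m")
    case True
    then show ?thesis using m(2) by (simp add: i0_def)
  next
    case False
    then have "m = 2 * i0 + 1" by (simp add: i0_def)
    then have "mate (\<rho> (2 * i0)) = 2 * k" using Suc.prems(2)[OF i0] m(2) by simp
    then have "\<rho> (2 * i0) = mate (2 * k)" using mate_mate by metis
    then show ?thesis by (simp add: mate_def)
  qed
  define \<tau> where "\<tau> = (if i0 = k then id else Transposition.transpose (2 * i0) (2 * k) \<circ> Transposition.transpose (2 * i0 + 1) (2 * k + 1))"
  have \<tau>: "\<tau> (2 * i) = 2 * Transposition.transpose i0 k i" "\<tau> (2 * i + 1) = 2 * Transposition.transpose i0 k i + 1" for i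
    unfolding \<tau>_def by (auto simp: Transposition.transpose_def; presburger)+
  have \<tau>_perm: "\<tau> permutes {..<2 * Suc k}"
    unfolding \<tau>_def using i0 by (auto intro!: permutes_compose permutes_swap_id permutes_id)
  have sign_\<tau>: "sign \<tau> = 1"
    by (simp add: \<tau>_def sign_id sign_compose permutation_swap_id sign_swap_id)
  define \<rho>1 where "\<rho>1 = \<rho> \<circ> \<tau>"
  have \<rho>1: "\<rho>1 permutes {..<2 * Suc k}"
    unfolding \<rho>1_def by (rule permutes_compose[OF \<tau>_perm Suc.prems(1)])
  have \<rho>1_mate: "\<rho>1 (2 * i + 1) = mate (\<rho>1 (2 * i))" if "i < Suc k" for i
  proof -
    have "Transposition.transpose i0 k i < Suc k" using that i0 by (auto simp: Transposition.transpose_def)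
    then show ?thesis unfolding \<rho>1_def comp_def \<tau> by (rule Suc.prems(2))
  qed
  have g1: "g \<rho>1 = g \<rho>"
  proof -
    have "permutation \<tau>" using \<tau>_perm permutation_permutes by blast
    then have "sign \<rho>1 = sign \<rho>" unfolding \<rho>1_def using sign_compose[OF perm] sign_\<tau> by simp
    moreover have "(\<Prod>i<Suc k. T (\<rho>1 (2 * i)) (\<rho>1 (2 * i + 1))) =
        (\<Prod>i<Suc k. T (\<rho> (2 * i)) (\<rho> (2 * i + 1)))"
      unfolding \<rho>1_def by (rule prod_blocks_right_swap[OF i0 lessI \<tau>])
    ultimately show ?thesis by (simp only: g_def)
  qed
  have last: "\<rho>1 (2 * k) = 2 * k \<or> \<rho>1 (2 * k) = 2 * k + 1"
    using cases by (simp add: \<rho>1_def \<tau>)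
  have "\<exists>\<rho>2. g \<rho>2 = g \<rho>1 \<and> \<rho>2 permutes {..<2 * Suc k} \<and> \<rho>2 (2 * k) = 2 * k \<and>
    (\<forall>i<Suc k. \<rho>2 (2 * i + 1) = mate (\<rho>2 (2 * i)))"
    using last
  proof
    assume "\<rho>1 (2 * k) = 2 * k"
    then show ?thesis using \<rho>1 \<rho>1_mate by blast
  next
    assume flip: "\<rho>1 (2 * k) = 2 * k + 1"
    \<comment> \<open>Exchanging the two entries of the last block changes both the sign of the
      permutation and the sign of one factor \<open>T\<close>.\<close>
    define \<delta> where "\<delta> = Transposition.transpose (2 * k) (2 * k + 1)"
    have \<delta>_perm: "\<delta> permutes {..<2 * Suc k}" unfolding \<delta>_def by (rule permutes_swap_id) auto
    have \<delta>: "\<delta> (2 * k) = 2 * k + 1" "\<delta> (2 * k + 1) = 2 * k" by (simp_all add: \<delta>_def)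
    have \<delta>': "\<delta> (2 * i) = 2 * i" "\<delta> (2 * i + 1) = 2 * i + 1" if "i < k" for i
      using that by (auto simp: \<delta>_def Transposition.transpose_def)
    have "permutation \<rho>1" "permutation \<delta>" using \<rho>1 \<delta>_perm permutation_permutes by blast+
    then have "sign (\<rho>1 \<circ> \<delta>) = - sign \<rho>1" by (simp add: sign_compose \<delta>_def sign_swap_id)
    moreover have "(\<Prod>i<k. T ((\<rho>1 \<circ> \<delta>) (2 * i)) ((\<rho>1 \<circ> \<delta>) (2 * i + 1))) =
        (\<Prod>i<k. T (\<rho>1 (2 * i)) (\<rho>1 (2 * i + 1)))"
      by (intro prod.cong) (simp_all only: comp_def \<delta>' lessThan_iff)
    moreover have "T ((\<rho>1 \<circ> \<delta>) (2 * k)) ((\<rho>1 \<circ> \<delta>) (2 * k + 1)) = - T (\<rho>1 (2 * k)) (\<rho>1 (2 * k + 1))"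
      unfolding comp_def \<delta> by (rule T)
    ultimately have "g (\<rho>1 \<circ> \<delta>) = g \<rho>1" by (simp only: g_def prod.lessThan_Suc) simp
    moreover have "\<rho>1 \<circ> \<delta> permutes {..<2 * Suc k}" by (rule permutes_compose[OF \<delta>_perm \<rho>1])
    moreover have "(\<rho>1 \<circ> \<delta>) (2 * k) = 2 * k"
      using \<rho>1_mate[OF lessI] flip by (simp add: \<delta> mate_def)
    moreover have "(\<rho>1 \<circ> \<delta>) (2 * i + 1) = mate ((\<rho>1 \<circ> \<delta>) (2 * i))" if "i < Suc k" for i
    proof (cases "i = k")
      case True
      then show ?thesis unfolding comp_def True \<delta> using \<rho>1_mate[OF lessI] mate_mate by metis
    next
      case False
      then have "i < k" using that by simp
      then show ?thesis unfolding comp_def \<delta>'[OF \<open>i < k\<close>] by (intro \<rho>1_mate) simp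
    qed
    ultimately show ?thesis by blast
  qed
  then obtain \<rho>2 where \<rho>2: "g \<rho>2 = g \<rho>1" "\<rho>2 permutes {..<2 * Suc k}" "\<rho>2 (2 * k) = 2 * k"
    "\<forall>i<Suc k. \<rho>2 (2 * i + 1) = mate (\<rho>2 (2 * i))" by blast
  have "\<rho>2 (2 * k + 1) = mate (2 * k)" using \<rho>2(3,4) by auto
  then have last2: "\<rho>2 (2 * k + 1) = 2 * k + 1" by (simp add: mate_def)
  have "\<rho>2 permutes {..<2 * k}"
  proof (rule permutes_superset[OF \<rho>2(2)])
    fix x assume "x \<in> {..<2 * Suc k} - {..<2 * k}"
    then have "x = 2 * k \<or> x = 2 * k + 1" by auto
    then show "\<rho>2 x = x" using \<rho>2(3) last2 by auto
  qed
  from Suc.IH[OF this] \<rho>2(4)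
  have "of_int (sign \<rho>2) * (\<Prod>i<k. T (\<rho>2 (2 * i)) (\<rho>2 (2 * i + 1))) = (\<Prod>i<k. T (2 * i) (2 * i + 1))"
    by simp
  then have "g \<rho>2 = (\<Prod>i<Suc k. T (2 * i) (2 * i + 1))"
    using \<rho>2(3) last2 by (simp add: g_def)
  then show ?case using \<rho>2(1) g1 by (simp add: g_def)
qed

text \<open>The infinite block-diagonal matrix with blocks (0, 1; -1, 0), cut to size by
  \<open>mat\<close>. For odd \<open>n\<close> the last row and column of the cut matrix are
  zero.\<close>

definition std_skew :: "nat \<Rightarrow> nat \<Rightarrow> complex" where
  "std_skew i j = (if j = mate i then if even i then 1 else - 1 else 0)"

lemma std_skew_skew: "std_skew j i = - std_skew i j"
proof (cases "j = mate i")
  case True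
  then show ?thesis using mate_mate[of i] by (auto simp: std_skew_def mate_def)
next
  case False
  then have "i \<noteq> mate j" using mate_mate by metis
  with False show ?thesis by (simp add: std_skew_def)
qed

text \<open>If \<open>\<mu>\<close> is a perfect matching of \<open>I\<close> that contains all the pairs of mates in \<open>I\<close>, then every
  other perfect matching of \<open>I\<close> has at least two pairs that are not mates.\<close>

lemma pfaffian_expand:
  assumes I: "I \<subseteq> {..<n}" and \<mu>: "\<And>x. x \<in> I \<Longrightarrow> \<mu> x \<in> I" "\<And>x. x \<in> I \<Longrightarrow> \<mu> (\<mu> x) = x"
      "\<And>x. x \<in> I \<Longrightarrow> \<mu> x \<noteq> x"
    and H: "\<And>x. x \<in> I \<Longrightarrow> mate x \<in> I \<Longrightarrow> mate x = \<mu> x"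
  shows "even (card I)" and "\<exists>c\<noteq>0. \<forall>t X. (\<forall>i j. X j i = - X i j) \<longrightarrow>
    ord2 (\<lambda>\<tau>. pfaffian (mat n n (\<lambda>(i, j). t * std_skew i j + \<tau> * X i j)) I -
      c * (\<Prod>x | x \<in> I \<and> x < \<mu> x. t * std_skew x (\<mu> x) + \<tau> * X x (\<mu> x)))"
proof -
  have fin: "finite I" using I finite_subset by blast
  define R where "R = {x \<in> I. x < \<mu> x}"
  define k where "k = card R"
  have finR: "finite R" using fin by (simp add: R_def)
  have inj_\<mu>: "inj_on \<mu> I" using \<mu>(2) by (metis inj_onI)
  have IR: "I = R \<union> \<mu> ` R"
  proof
    show "I \<subseteq> R \<union> \<mu> ` R"
    proof
      fix x assume x: "x \<in> I"
      show "x \<in> R \<union> \<mu> ` R"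
      proof (cases "x < \<mu> x")
        case False
        then have "\<mu> x < x" using \<mu>(3)[OF x] by simp
        then have "\<mu> x \<in> R" using \<mu>(1,2)[OF x] by (simp add: R_def)
        then show ?thesis using \<mu>(2)[OF x] by (metis UnI2 imageI)
      qed (use x in \<open>simp add: R_def\<close>)
    qed
  qed (use \<mu>(1) in \<open>auto simp: R_def\<close>)
  have disj: "R \<inter> \<mu> ` R = {}" using \<mu>(2) by (auto simp: R_def)
  have "card (\<mu> ` R) = k" unfolding k_def
    by (rule card_image) (rule inj_on_subset[OF inj_\<mu>], auto simp: R_def)
  then have cardI: "card I = 2 * k"
    using card_Un_disjoint[OF finR finite_imageI[OF finR] disj] IR by (simp add: k_def)
  show "even (card I)" using cardI by simp
  define l where "l = sorted_list_of_set I"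
  have l: "length l = 2 * k" "set l = I" "distinct l"
    using fin cardI by (simp_all add: l_def)
  have nth_bij: "bij_betw (nth l) {..<2 * k} I"
    using bij_betw_nth[OF l(3)] l by auto
  have lI: "l ! m \<in> I" if "m < 2 * k" for m using that l by auto
  let ?S = "{\<sigma>. \<sigma> permutes {..<2 * k}}"
  \<comment> \<open>\<open>pfaffian\<close> sums over permutations, not over matchings. The matched
    ones list the pairs of \<open>\<mu>\<close> in any order and with any orientation, and all
    contribute the same term.\<close>
  define matched where "matched \<sigma> \<longleftrightarrow> (\<forall>i<k. \<mu> (l ! \<sigma> (2 * i)) = l ! \<sigma> (2 * i + 1))" for \<sigma>
  define M where "M = {\<sigma> \<in> ?S. matched \<sigma>}"
  have finS: "finite ?S" by (intro finite_permutations) simp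
  obtain g where g: "bij_betw g {..<k} R"
    using ex_bij_betw_nat_finite[OF finR] unfolding k_def atLeast0LessThan by (rule exE)
  have gR: "g i \<in> R" if "i < k" for i using bij_betwE[OF g] that by blast
  \<comment> \<open>The pairs of \<open>\<mu>\<close> written one after the other, smaller element
    first. \<open>\<sigma>0\<close> is the permutation that produces this list and serves as the
    reference.\<close>
  define f where "f m = (if even m then g (m div 2) else \<mu> (g (m div 2)))" for m
  have f_bij: "bij_betw f {..<2 * k} I"
  proof -
    have "f ` {..<2 * k} = I"
    proof
      show "f ` {..<2 * k} \<subseteq> I" using gR IR by (auto simp: f_def)
      show "I \<subseteq> f ` {..<2 * k}"
      proof
        fix x assume "x \<in> I"
        then consider "x \<in> R" | "x \<in> \<mu> ` R" using IR by blast
        then show "x \<in> f ` {..<2 * k}"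
        proof cases
          case 1
          then obtain i where "i < k" "x = g i" using g by (auto simp: bij_betw_def)
          then show ?thesis by (intro image_eqI[of _ _ "2 * i"]) (auto simp: f_def)
        next
          case 2
          then obtain i where "i < k" "x = \<mu> (g i)" using g by (auto simp: bij_betw_def)
          then show ?thesis by (intro image_eqI[of _ _ "2 * i + 1"]) (auto simp: f_def)
        qed
      qed
    qed
    then show ?thesis using cardI by (simp add: bij_betw_def eq_card_imp_inj_on)
  qed
  define \<sigma>0 where "\<sigma>0 m = (if m < 2 * k then inv_into {..<2 * k} (nth l) (f m) else m)" for m
  have "bij_betw (inv_into {..<2 * k} (nth l) \<circ> f) {..<2 * k} {..<2 * k}"
    by (rule bij_betw_trans[OF f_bij bij_betw_inv_into[OF nth_bij]])
  then have "bij_betw \<sigma>0 {..<2 * k} {..<2 * k}"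
    by (subst bij_betw_cong[of _ _ "inv_into {..<2 * k} (nth l) \<circ> f"]) (simp_all add: \<sigma>0_def)
  then have \<sigma>0: "\<sigma>0 permutes {..<2 * k}"
    by (rule bij_imp_permutes) (simp add: \<sigma>0_def)
  have l\<sigma>0: "l ! \<sigma>0 m = f m" if "m < 2 * k" for m
    using that bij_betw_inv_into_right[OF nth_bij] bij_betwE[OF f_bij] by (simp add: \<sigma>0_def)
  have \<sigma>0_even: "l ! \<sigma>0 (2 * i) = g i" "l ! \<sigma>0 (2 * i + 1) = \<mu> (g i)" if "i < k" for i
    using that l\<sigma>0[of "2 * i"] l\<sigma>0[of "2 * i + 1"] by (simp_all add: f_def)
  have \<sigma>0M: "\<sigma>0 \<in> M" using \<sigma>0 \<sigma>0_even by (simp add: M_def matched_def)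
  \<comment> \<open>The number of matched permutations times the sign of the reference, over the
    normalisation of the Pfaffian. Its exact value is immaterial, since functionals can be
    rescaled.\<close>
  define c where "c = of_nat (card M) * of_int (sign \<sigma>0) / (2 ^ k * fact k :: complex)"
  have "card M \<noteq> 0" using \<sigma>0M finS by (auto simp: M_def)
  then have "c \<noteq> 0" by (simp add: c_def sign_nz)
  moreover have "ord2 (\<lambda>\<tau>. pfaffian (mat n n (\<lambda>(i, j). t * std_skew i j + \<tau> * X i j)) I -
      c * (\<Prod>x | x \<in> I \<and> x < \<mu> x. t * std_skew x (\<mu> x) + \<tau> * X x (\<mu> x)))"
    if X: "\<forall>i j. X j i = - X i j" for t X
  proof -
    define B where "B \<tau> i j = t * std_skew i j + \<tau> * X i j" for \<tau> i j
    have B_skew: "B \<tau> j i = - B \<tau> i j" for \<tau> i j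
      using X[rule_format, of j i] std_skew_skew[of j i] by (simp add: B_def)
    define term_of where "term_of \<sigma> \<tau> = of_int (sign \<sigma>) *
      (\<Prod>i<k. B \<tau> (l ! \<sigma> (2 * i)) (l ! \<sigma> (2 * i + 1)))" for \<sigma> \<tau>
    have \<sigma>_lt: "\<sigma> m < 2 * k" if "\<sigma> \<in> ?S" "m < 2 * k" for \<sigma> m
      using permutes_in_image[of \<sigma> "{..<2 * k}" m] that by simp
    have pf: "pfaffian (mat n n (\<lambda>(i, j). t * std_skew i j + \<tau> * X i j)) I =
        (\<Sum>\<sigma>\<in>?S. term_of \<sigma> \<tau>) / (2 ^ k * fact k)" for \<tau>
    proof -
      have "mat n n (\<lambda>(i, j). t * std_skew i j + \<tau> * X i j) $$ (l ! \<sigma> (2 * i), l ! \<sigma> (2 * i + 1)) =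
          B \<tau> (l ! \<sigma> (2 * i)) (l ! \<sigma> (2 * i + 1))" if "\<sigma> \<in> ?S" "i < k" for \<sigma> i
      proof -
        have "l ! \<sigma> (2 * i) \<in> I" "l ! \<sigma> (2 * i + 1) \<in> I"
          using that(2) by (auto intro!: lI \<sigma>_lt[OF that(1)])
        then have "l ! \<sigma> (2 * i) < n" "l ! \<sigma> (2 * i + 1) < n" using I by auto
        then show ?thesis unfolding B_def by (subst index_mat) auto
      qed
      then show ?thesis
        unfolding pfaffian_def Let_def l_def[symmetric] cardI term_of_def
        by (simp add: sum_divide_distrib)
    qed
    have matched_term: "term_of \<sigma> \<tau> = of_int (sign \<sigma>0) * (\<Prod>x\<in>R. B \<tau> x (\<mu> x))" if "\<sigma> \<in> M" for \<sigma> \<tau>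
    proof -
      have \<sigma>: "\<sigma> permutes {..<2 * k}" "matched \<sigma>" using that by (auto simp: M_def)
      \<comment> \<open>\<open>\<sigma>\<close> and \<open>\<sigma>0\<close> list the same matching,
        so they differ by a permutation \<open>\<rho>\<close> of the blocks, with possible flips;
        antisymmetry absorbs its sign.\<close>
      define \<rho> where "\<rho> = inv_into UNIV \<sigma>0 \<circ> \<sigma>"
      have \<rho>: "\<rho> permutes {..<2 * k}"
        unfolding \<rho>_def by (rule permutes_compose[OF \<sigma>(1) permutes_inv[OF \<sigma>0]])
      have \<sigma>0\<rho>: "\<sigma>0 (\<rho> m) = \<sigma> m" for m
        unfolding \<rho>_def by (simp add: permutes_inverses[OF \<sigma>0])
      have \<rho>_mate: "\<rho> (2 * i + 1) = mate (\<rho> (2 * i))" if i: "i < k" for i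
      proof -
        define m where "m = \<rho> (2 * i)"
        have m: "m < 2 * k" using permutes_in_image[OF \<rho>, of "2 * i"] i by (simp add: m_def)
        have mm: "mate m < 2 * k" using m by (auto simp: mate_def)
        have f_mate: "f (mate m) = \<mu> (f m)"
        proof -
          have "g (m div 2) \<in> I" using gR[of "m div 2"] m by (auto simp: R_def)
          then show ?thesis using \<mu>(2) mate_div2[of m] by (auto simp: f_def mate_def)
        qed
        have "l ! \<sigma>0 (\<rho> (2 * i + 1)) = \<mu> (l ! \<sigma>0 m)"
          using \<sigma>(2) i by (simp add: matched_def \<sigma>0\<rho> m_def)
        also have "\<dots> = l ! \<sigma>0 (mate m)" using l\<sigma>0[OF m] l\<sigma>0[OF mm] f_mate by simp
        finally have eq: "l ! \<sigma>0 (\<rho> (2 * i + 1)) = l ! \<sigma>0 (mate m)" .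
        have "\<rho> (2 * i + 1) < 2 * k" using permutes_in_image[OF \<rho>, of "2 * i + 1"] i by simp
        then have "\<sigma>0 (\<rho> (2 * i + 1)) < 2 * k" "\<sigma>0 (mate m) < 2 * k"
          using permutes_in_image[OF \<sigma>0, of "\<rho> (2 * i + 1)"] permutes_in_image[OF \<sigma>0, of "mate m"] mm
          by auto
        then have "\<sigma>0 (\<rho> (2 * i + 1)) = \<sigma>0 (mate m)" using eq l by (simp add: nth_eq_iff_index_eq)
        then show ?thesis using permutes_inj[OF \<sigma>0] by (auto simp: m_def dest: injD)
      qed
      have sgn: "sign \<sigma> = sign \<sigma>0 * sign \<rho>"
      proof -
        have "\<sigma> = \<sigma>0 \<circ> \<rho>" using \<sigma>0\<rho> by (auto simp: fun_eq_iff)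
        moreover have "permutation \<sigma>0" "permutation \<rho>" using \<sigma>0 \<rho> permutation_permutes by blast+
        ultimately show ?thesis using sign_compose by simp
      qed
      define T where "T x y = B \<tau> (l ! \<sigma>0 x) (l ! \<sigma>0 y)" for x y
      have T: "T y x = - T x y" for x y unfolding T_def by (rule B_skew)
      have "term_of \<sigma> \<tau> = of_int (sign \<sigma>0) * (of_int (sign \<rho>) * (\<Prod>i<k. T (\<rho> (2 * i)) (\<rho> (2 * i + 1))))"
        by (simp add: term_of_def T_def \<sigma>0\<rho> sgn mult.assoc)
      also have "of_int (sign \<rho>) * (\<Prod>i<k. T (\<rho> (2 * i)) (\<rho> (2 * i + 1))) = (\<Prod>i<k. T (2 * i) (2 * i + 1))"
        by (rule sign_block_permutation[OF \<rho> \<rho>_mate T])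
      also have "\<dots> = (\<Prod>i<k. B \<tau> (g i) (\<mu> (g i)))"
        by (intro prod.cong) (simp_all only: T_def \<sigma>0_even lessThan_iff)
      also have "\<dots> = (\<Prod>x\<in>R. B \<tau> x (\<mu> x))" by (rule prod.reindex_bij_betw[OF g])
      finally show ?thesis .
    qed
    have unmatched_ord2: "ord2 (term_of \<sigma>)" if "\<sigma> \<in> ?S - M" for \<sigma>
    proof -
      have \<sigma>: "\<sigma> permutes {..<2 * k}" "\<not> matched \<sigma>" using that by (auto simp: M_def)
      obtain i where i: "i < k" "\<mu> (l ! \<sigma> (2 * i)) \<noteq> l ! \<sigma> (2 * i + 1)"
        using \<sigma>(2) by (auto simp: matched_def)
      have \<sigma>S: "\<sigma> \<in> ?S" using \<sigma>(1) by simp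
      define x where "x = l ! \<sigma> (2 * i)"
      have x: "x \<in> I" unfolding x_def using i by (intro lI \<sigma>_lt[OF \<sigma>S]) simp
      have "\<mu> x \<in> (\<lambda>m. l ! \<sigma> m) ` {..<2 * k}"
      proof -
        have "(\<lambda>m. l ! \<sigma> m) ` {..<2 * k} = I"
          using permutes_image[OF \<sigma>(1)] nth_bij by (simp add: image_image[symmetric] bij_betw_def)
        then show ?thesis using \<mu>(1)[OF x] by simp
      qed
      then obtain m where m: "m < 2 * k" "\<mu> x = l ! \<sigma> m" by auto
      have inj: "m1 = m2" if "l ! \<sigma> m1 = l ! \<sigma> m2" "m1 < 2 * k" "m2 < 2 * k" for m1 m2
      proof -
        have "\<sigma> m1 = \<sigma> m2" using that \<sigma>_lt[OF \<sigma>S] l by (simp add: nth_eq_iff_index_eq)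
        then show ?thesis using permutes_inj[OF \<sigma>(1)] by (auto dest: injD)
      qed
      \<comment> \<open>The block that contains the true partner of \<open>x\<close>. It differs
        from block \<open>i\<close> and cannot be a pair of \<open>\<mu>\<close> either, so
        \<open>H\<close> makes the constant terms of both blocks vanish.\<close>
      define i' where "i' = m div 2"
      have i': "i' < k" using m(1) by (simp add: i'_def)
      have "m \<noteq> 2 * i" using m(2) \<mu>(3)[OF x] by (auto simp: x_def)
      moreover have "m \<noteq> 2 * i + 1" using m(2) i(2) by (auto simp: x_def)
      ultimately have ne: "i \<noteq> i'" by (auto simp: i'_def)
      have zero: "std_skew u v = 0" "std_skew v u = 0" if "u \<in> I" "v \<in> I" "\<mu> u \<noteq> v" for u v
        using H[OF that(1)] that std_skew_skew[of v u] by (auto simp: std_skew_def)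
      have y: "l ! \<sigma> (2 * i + 1) \<in> I" using i by (intro lI \<sigma>_lt[OF \<sigma>S]) simp
      have z1: "std_skew (l ! \<sigma> (2 * i)) (l ! \<sigma> (2 * i + 1)) = 0"
        by (rule zero(1)[OF _ y i(2)]) (use x in \<open>simp add: x_def\<close>)
      have z2: "std_skew (l ! \<sigma> (2 * i')) (l ! \<sigma> (2 * i' + 1)) = 0"
      proof (cases "even m")
        case True
        then have mi: "m = 2 * i'" by (simp add: i'_def)
        have u: "l ! \<sigma> (2 * i' + 1) \<in> I" using i' by (intro lI \<sigma>_lt[OF \<sigma>S]) simp
        have "\<mu> (\<mu> x) \<noteq> l ! \<sigma> (2 * i' + 1)"
        proof
          assume "\<mu> (\<mu> x) = l ! \<sigma> (2 * i' + 1)"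
          then have "l ! \<sigma> (2 * i) = l ! \<sigma> (2 * i' + 1)" using \<mu>(2)[OF x] by (simp add: x_def)
          from inj[OF this] have "2 * i = 2 * i' + 1" using i(1) i' by simp
          then show False by presburger
        qed
        from zero(1)[OF \<mu>(1)[OF x] u this] show ?thesis using m(2) mi by simp
      next
        case False
        then have mi: "m = 2 * i' + 1" by (simp add: i'_def)
        have u: "l ! \<sigma> (2 * i') \<in> I" using i' by (intro lI \<sigma>_lt[OF \<sigma>S]) simp
        have "\<mu> (\<mu> x) \<noteq> l ! \<sigma> (2 * i')"
        proof
          assume "\<mu> (\<mu> x) = l ! \<sigma> (2 * i')"
          then have "l ! \<sigma> (2 * i) = l ! \<sigma> (2 * i')" using \<mu>(2)[OF x] by (simp add: x_def)
          from inj[OF this] show False using i(1) i' ne by simp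
        qed
        from zero(2)[OF \<mu>(1)[OF x] u this] show ?thesis using m(2) mi by simp
      qed
      have "ord2 (\<lambda>\<tau>. \<Prod>i<k. t * std_skew (l ! \<sigma> (2 * i)) (l ! \<sigma> (2 * i + 1)) +
          \<tau> * X (l ! \<sigma> (2 * i)) (l ! \<sigma> (2 * i + 1)))"
        using i(1) i' ne z1 z2 by (intro ord2_prod_affine[of _ i i']) auto
      from ord2_cmult[OF this] show ?thesis unfolding term_of_def[abs_def] B_def .
    qed
    have "pfaffian (mat n n (\<lambda>(i, j). t * std_skew i j + \<tau> * X i j)) I -
        c * (\<Prod>x | x \<in> I \<and> x < \<mu> x. t * std_skew x (\<mu> x) + \<tau> * X x (\<mu> x)) =
        1 / (2 ^ k * fact k) * (\<Sum>\<sigma>\<in>?S - M. term_of \<sigma> \<tau>)" for \<tau>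
    proof -
      have "(\<Sum>\<sigma>\<in>?S. term_of \<sigma> \<tau>) = (\<Sum>\<sigma>\<in>?S - M. term_of \<sigma> \<tau>) + (\<Sum>\<sigma>\<in>M. term_of \<sigma> \<tau>)"
        using finS by (intro sum.subset_diff) (auto simp: M_def)
      also have "(\<Sum>\<sigma>\<in>M. term_of \<sigma> \<tau>) = of_nat (card M) * (of_int (sign \<sigma>0) * (\<Prod>x\<in>R. B \<tau> x (\<mu> x)))"
        by (simp add: matched_term)
      finally have "pfaffian (mat n n (\<lambda>(i, j). t * std_skew i j + \<tau> * X i j)) I =
          1 / (2 ^ k * fact k) * (\<Sum>\<sigma>\<in>?S - M. term_of \<sigma> \<tau>) + c * (\<Prod>x\<in>R. B \<tau> x (\<mu> x))"
        unfolding pf c_def by (simp add: add_divide_distrib)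
      then show ?thesis by (simp add: R_def B_def)
    qed
    moreover have "ord2 (\<lambda>\<tau>. 1 / (2 ^ k * fact k) * (\<Sum>\<sigma>\<in>?S - M. term_of \<sigma> \<tau>))"
      by (intro ord2_cmult ord2_sum unmatched_ord2)
    ultimately show ?thesis by presburger
  qed
  ultimately show "\<exists>c\<noteq>0. \<forall>t X. (\<forall>i j. X j i = - X i j) \<longrightarrow>
    ord2 (\<lambda>\<tau>. pfaffian (mat n n (\<lambda>(i, j). t * std_skew i j + \<tau> * X i j)) I -
      c * (\<Prod>x | x \<in> I \<and> x < \<mu> x. t * std_skew x (\<mu> x) + \<tau> * X x (\<mu> x)))"
    by (intro exI[of _ c] conjI allI impI)
qed

section \<open>The affine chart of the spinor embedding\<close>

definition skew_params :: "nat \<Rightarrow> (nat \<times> nat) set" where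
  "skew_params n = {(i, j). i < j \<and> j < n}"

definition skew_entries :: "nat \<Rightarrow> (nat \<times> nat \<Rightarrow> complex) \<Rightarrow> nat \<Rightarrow> nat \<Rightarrow> complex" where
  "skew_entries n a i j = (if (i, j) \<in> skew_params n then a (i, j) else
     if (j, i) \<in> skew_params n then - a (j, i) else 0)"

definition spinor_vec :: "nat \<Rightarrow> complex mat \<Rightarrow> nat set \<Rightarrow> complex" where
  "spinor_vec n B = (\<lambda>I. if I \<subseteq> {..<n} \<and> even (card I) then pfaffian B I else 0)"

text \<open>The chart is recentred so that the zero parameter is the point of tangency with
  parameter \<open>t\<close>; for \<open>t = 0\<close> it is the whole chart in its original
  coordinates.\<close>

definition spinor_chart :: "nat \<Rightarrow> complex \<Rightarrow> (nat \<times> nat \<Rightarrow> complex) \<Rightarrow> nat set \<Rightarrow> complex" where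
  "spinor_chart n t a = spinor_vec n (mat n n (\<lambda>(i, j). t * std_skew i j + skew_entries n a i j))"

lemma finite_skew_params: "finite (skew_params n)"
  by (rule finite_subset[of _ "{..<n} \<times> {..<n}"]) (auto simp: skew_params_def)

lemma skew_entries_skew: "skew_entries n a j i = - skew_entries n a i j"
  by (auto simp: skew_entries_def skew_params_def)

lemma skew_entries_scale: "skew_entries n (\<lambda>x. \<tau> * a x) i j = \<tau> * skew_entries n a i j"
  by (simp add: skew_entries_def)

lemma polyfun_skew_entries: "polyfun (skew_params n) 1 (\<lambda>a. skew_entries n a i j)"
proof -
  have "polyfun (skew_params n) 1 (\<lambda>a. a p)" if "p \<in> skew_params n" for p
    by (rule polyfun_coord[OF finite_skew_params that])
  moreover from this have "polyfun (skew_params n) 1 (\<lambda>a. - a p)" if "p \<in> skew_params n" for p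
    using polyfun_scale[of "skew_params n" 1 "\<lambda>a. a p" "- 1"] that by simp
  ultimately show ?thesis
    by (cases "(i, j) \<in> skew_params n"; cases "(j, i) \<in> skew_params n")
      (simp_all only: skew_entries_def if_True if_False polyfun_zero)
qed

lemma polyfun_spinor_chart: "polyfun (skew_params n) n (\<lambda>a. spinor_chart n t a I)"
proof (cases "I \<subseteq> {..<n} \<and> even (card I)")
  case True
  define k where "k = card I div 2"
  define l where "l = sorted_list_of_set I"
  have "finite I" using True finite_subset by blast
  then have l: "length l = 2 * k" "set l = I" using True by (simp_all add: l_def k_def)
  have "k \<le> n" using card_mono[of "{..<n}" I] True by (simp add: k_def)
  have entry: "polyfun (skew_params n) 1 (\<lambda>a. mat n n (\<lambda>(i, j). t * std_skew i j + skew_entries n a i j) $$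
      (l ! \<sigma> (2 * i), l ! \<sigma> (2 * i + 1)))" if "\<sigma> permutes {..<2 * k}" "i < k" for \<sigma> i
  proof -
    have "\<sigma> (2 * i) < 2 * k" "\<sigma> (2 * i + 1) < 2 * k"
      using permutes_in_image[OF that(1), of "2 * i"] permutes_in_image[OF that(1), of "2 * i + 1"] that(2)
      by auto
    then have "l ! \<sigma> (2 * i) \<in> I" "l ! \<sigma> (2 * i + 1) \<in> I" using l by (metis nth_mem)+
    then have "l ! \<sigma> (2 * i) < n" "l ! \<sigma> (2 * i + 1) < n" using True by auto
    then have "mat n n (\<lambda>(i, j). t * std_skew i j + skew_entries n a i j) $$ (l ! \<sigma> (2 * i), l ! \<sigma> (2 * i + 1)) =
        t * std_skew (l ! \<sigma> (2 * i)) (l ! \<sigma> (2 * i + 1)) + skew_entries n a (l ! \<sigma> (2 * i)) (l ! \<sigma> (2 * i + 1))" for a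
      by (subst index_mat) auto
    then show ?thesis by (simp only: polyfun_add polyfun_const polyfun_skew_entries)
  qed
  have "polyfun (skew_params n) n (\<lambda>a. 1 / (2 ^ k * fact k) * (\<Sum>\<sigma> | \<sigma> permutes {..<2 * k}. of_int (sign \<sigma>) *
      (\<Prod>i<k. mat n n (\<lambda>(i, j). t * std_skew i j + skew_entries n a i j) $$
        (l ! \<sigma> (2 * i), l ! \<sigma> (2 * i + 1)))))"
  proof (intro polyfun_scale polyfun_sum)
    fix \<sigma> assume "\<sigma> \<in> {\<sigma>. \<sigma> permutes {..<2 * k}}"
    then have "polyfun (skew_params n) (1 * card {..<k}) (\<lambda>a. \<Prod>i<k.
        mat n n (\<lambda>(i, j). t * std_skew i j + skew_entries n a i j) $$ (l ! \<sigma> (2 * i), l ! \<sigma> (2 * i + 1)))"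
      by (intro polyfun_prod entry) auto
    then show "polyfun (skew_params n) n (\<lambda>a. \<Prod>i<k.
        mat n n (\<lambda>(i, j). t * std_skew i j + skew_entries n a i j) $$ (l ! \<sigma> (2 * i), l ! \<sigma> (2 * i + 1)))"
      by (rule polyfun_mono) (simp add: \<open>k \<le> n\<close>)
  qed
  then show ?thesis
    using True by (simp add: spinor_chart_def spinor_vec_def pfaffian_def Let_def k_def l_def)
next
  case False
  then have "spinor_chart n t a I = 0" for a unfolding spinor_chart_def spinor_vec_def by (simp only: if_False)
  then show ?thesis by (simp only: polyfun_zero)
qed

lemma spinor_vec_empty: "spinor_vec n B {} = 1"
  by (simp add: spinor_vec_def pfaffian_def sign_id)

lemma spinor_chart_expand:
  assumes I: "I \<subseteq> {..<n}" and \<mu>: "\<And>x. x \<in> I \<Longrightarrow> \<mu> x \<in> I" "\<And>x. x \<in> I \<Longrightarrow> \<mu> (\<mu> x) = x"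
      "\<And>x. x \<in> I \<Longrightarrow> \<mu> x \<noteq> x"
    and H: "\<And>x. x \<in> I \<Longrightarrow> mate x \<in> I \<Longrightarrow> mate x = \<mu> x"
  shows "\<exists>c\<noteq>0. \<forall>t v. ord2 (\<lambda>\<tau>. spinor_chart n t (\<lambda>x. \<tau> * v x) I -
      c * (\<Prod>x | x \<in> I \<and> x < \<mu> x. t * std_skew x (\<mu> x) + \<tau> * skew_entries n v x (\<mu> x)))"
proof -
  have even_card: "even (card I)"
    by (rule pfaffian_expand(1)[where \<mu> = \<mu>, OF I]) (use \<mu> H in blast)+
  have expand: "\<exists>c\<noteq>0. \<forall>t X. (\<forall>i j. X j i = - X i j) \<longrightarrow>
    ord2 (\<lambda>\<tau>. pfaffian (mat n n (\<lambda>(i, j). t * std_skew i j + \<tau> * X i j)) I -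
      c * (\<Prod>x | x \<in> I \<and> x < \<mu> x. t * std_skew x (\<mu> x) + \<tau> * X x (\<mu> x)))"
    by (rule pfaffian_expand(2)[where \<mu> = \<mu>, OF I]) (use \<mu> H in blast)+
  have eq: "spinor_chart n t (\<lambda>x. \<tau> * v x) I =
      pfaffian (mat n n (\<lambda>(i, j). t * std_skew i j + \<tau> * skew_entries n v i j)) I" for t \<tau> v
    using I even_card by (simp add: spinor_chart_def spinor_vec_def skew_entries_scale)
  obtain c where c: "c \<noteq> 0" "\<forall>t X. (\<forall>i j. X j i = - X i j) \<longrightarrow>
    ord2 (\<lambda>\<tau>. pfaffian (mat n n (\<lambda>(i, j). t * std_skew i j + \<tau> * X i j)) I -
      c * (\<Prod>x | x \<in> I \<and> x < \<mu> x. t * std_skew x (\<mu> x) + \<tau> * X x (\<mu> x)))"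
    using expand by (elim exE conjE) (rule that)
  show ?thesis
    unfolding eq
  proof (intro exI[of _ c] conjI allI)
    show "c \<noteq> 0" by (rule c(1))
    fix t v
    show "ord2 (\<lambda>\<tau>. pfaffian (mat n n (\<lambda>(i, j). t * std_skew i j + \<tau> * skew_entries n v i j)) I -
      c * (\<Prod>x | x \<in> I \<and> x < \<mu> x. t * std_skew x (\<mu> x) + \<tau> * skew_entries n v x (\<mu> x)))"
      by (rule c(2)[rule_format]) (rule skew_entries_skew)
  qed
qed

definition pairs :: "nat set \<Rightarrow> nat set" where
  "pairs K = {x. x div 2 \<in> K}"

lemma mate_pairs: "mate x \<in> pairs K \<longleftrightarrow> x \<in> pairs K"
  by (simp add: pairs_def mate_div2)

lemma pairs_bound: "K \<subseteq> {..<n div 2} \<Longrightarrow> pairs K \<subseteq> {..<n}"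
  by (auto simp: pairs_def)

lemma pairs_less_mate: "{x \<in> pairs K. x < mate x} = (*) 2 ` K"
proof
  show "{x \<in> pairs K. x < mate x} \<subseteq> (*) 2 ` K"
    by (auto simp: pairs_def mate_def image_iff split: if_splits elim!: evenE)
qed (auto simp: pairs_def mate_def)

lemma prod_double:
  assumes "K \<subseteq> {..<n div 2}"
  shows "(\<Prod>x\<in>(*) 2 ` K. t * std_skew x (mate x) + \<tau> * skew_entries n v x (mate x)) =
    (\<Prod>p\<in>K. t + \<tau> * v (2 * p, 2 * p + 1))"
proof -
  have "std_skew (2 * p) (mate (2 * p)) = 1" for p by (simp add: std_skew_def)
  moreover have "skew_entries n v (2 * p) (mate (2 * p)) = v (2 * p, 2 * p + 1)" if "p \<in> K" for p
    using assms that by (auto simp: skew_entries_def skew_params_def mate_def)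
  ultimately show ?thesis
    by (subst prod.reindex) (auto simp: inj_on_def intro!: prod.cong)
qed

lemma spinor_chart_pairs:
  assumes "K \<subseteq> {..<n div 2}"
  shows "\<exists>c\<noteq>0. \<forall>t v. ord2 (\<lambda>\<tau>. spinor_chart n t (\<lambda>x. \<tau> * v x) (pairs K) -
      c * (\<Prod>p\<in>K. t + \<tau> * v (2 * p, 2 * p + 1)))"
  using spinor_chart_expand[of "pairs K" n mate]
  unfolding pairs_less_mate prod_double[OF assms]
  using pairs_bound[OF assms] by (simp add: mate_pairs mate_mate mate_neq)

text \<open>The mates of \<open>a\<close> and \<open>c\<close> are absent from the index set, so the
  matching that joins \<open>a\<close> with \<open>c\<close> contains all pairs of mates. Its entry
  at \<open>(a, c)\<close> has no constant term and supplies the factor of first order.\<close>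

lemma spinor_chart_pairs_insert:
  assumes K: "K \<subseteq> {..<n div 2} - {a div 2, c div 2}" and ac: "a < c" "c < n" "c \<noteq> mate a"
  shows "\<exists>k\<noteq>0. \<forall>t v. ord2 (\<lambda>\<tau>. spinor_chart n t (\<lambda>x. \<tau> * v x) (pairs K \<union> {a, c}) -
      k * (\<tau> * v (a, c) * (\<Prod>p\<in>K. t + \<tau> * v (2 * p, 2 * p + 1))))"
proof -
  define \<mu> where "\<mu> x = (if x = a then c else if x = c then a else mate x)" for x
  let ?I = "pairs K \<union> {a, c}"
  have K': "K \<subseteq> {..<n div 2}" using K by blast
  have out: "a \<notin> pairs K" "c \<notin> pairs K" using K by (auto simp: pairs_def)
  have mate_out: "mate a \<notin> pairs K" "mate c \<notin> pairs K" using out mate_pairs by auto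
  have ne: "mate a \<noteq> c" "mate c \<noteq> a" using ac(3) mate_mate by metis+
  have pairs_ne: "x \<noteq> a" "x \<noteq> c" "mate x \<noteq> a" "mate x \<noteq> c" if "x \<in> pairs K" for x
    using that out mate_pairs[of x K] by auto
  have "\<exists>k\<noteq>0. \<forall>t v. ord2 (\<lambda>\<tau>. spinor_chart n t (\<lambda>x. \<tau> * v x) ?I -
      k * (\<Prod>x | x \<in> ?I \<and> x < \<mu> x. t * std_skew x (\<mu> x) + \<tau> * skew_entries n v x (\<mu> x)))"
  proof (rule spinor_chart_expand)
    show "?I \<subseteq> {..<n}" using pairs_bound[OF K'] ac by auto
    fix x assume x: "x \<in> ?I"
    show "\<mu> x \<in> ?I" "\<mu> (\<mu> x) = x" "\<mu> x \<noteq> x"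
      using x pairs_ne ac mate_pairs[of x K] mate_mate[of x] mate_neq[of x] by (auto simp: \<mu>_def)
    assume "mate x \<in> ?I"
    then show "mate x = \<mu> x"
      using x pairs_ne ne mate_out mate_neq[of x] by (auto simp: \<mu>_def)
  qed
  moreover have "(\<Prod>x | x \<in> ?I \<and> x < \<mu> x. t * std_skew x (\<mu> x) + \<tau> * skew_entries n v x (\<mu> x)) =
      \<tau> * v (a, c) * (\<Prod>p\<in>K. t + \<tau> * v (2 * p, 2 * p + 1))" for t \<tau> v
  proof -
    have R: "{x. x \<in> ?I \<and> x < \<mu> x} = insert a ((*) 2 ` K)"
    proof -
      have "{x. x \<in> ?I \<and> x < \<mu> x} = insert a {x \<in> pairs K. x < mate x}"
        using pairs_ne ac by (auto simp: \<mu>_def)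
      then show ?thesis by (simp only: pairs_less_mate)
    qed
    have sub: "(*) 2 ` K \<subseteq> pairs K" by (auto simp: pairs_def)
    have "finite K" using K' finite_subset by blast
    moreover have "a \<notin> (*) 2 ` K" using sub out by blast
    moreover have "(\<Prod>x\<in>(*) 2 ` K. t * std_skew x (\<mu> x) + \<tau> * skew_entries n v x (\<mu> x)) =
        (\<Prod>x\<in>(*) 2 ` K. t * std_skew x (mate x) + \<tau> * skew_entries n v x (mate x))"
      using sub pairs_ne by (intro prod.cong) (auto simp: \<mu>_def)
    moreover have "t * std_skew a (\<mu> a) + \<tau> * skew_entries n v a (\<mu> a) = \<tau> * v (a, c)"
      using ac by (simp add: \<mu>_def std_skew_def skew_entries_def skew_params_def)
    ultimately show ?thesis unfolding R by (simp add: prod_double[OF K'])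
  qed
  ultimately show ?thesis by (simp only:)
qed

text \<open>A principal Pfaffian has all its roots at 0. Expanding the product of the factors
  \<open>(t + \<tau> * y p v) + - u p\<close> over the subsets \<open>K\<close> of \<open>P\<close>
  writes the product with roots \<open>u p\<close> as a linear combination of Pfaffian coordinates,
  up to second order. \<open>G\<close> is the common factor: 1 for slots, the parameter times
  \<open>\<tau>\<close> for the other directions.\<close>

lemma ex_linear_form_product:
  fixes \<Phi> :: "complex \<Rightarrow> ('j \<Rightarrow> complex) \<Rightarrow> 'i \<Rightarrow> complex" and D :: "'s set \<Rightarrow> 'i"
  assumes P: "finite P" and D: "\<And>K. K \<subseteq> P \<Longrightarrow> \<exists>c\<noteq>0. \<forall>t v. ord2 (\<lambda>\<tau>. \<Phi> t (\<lambda>x. \<tau> * v x) (D K) -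
      c * (G v \<tau> * (\<Prod>p\<in>K. t + \<tau> * y p v)))"
  shows "\<exists>L. homogeneous_poly 1 L \<and> (\<forall>t v. ord2 (\<lambda>\<tau>. L (\<Phi> t (\<lambda>x. \<tau> * v x)) -
      G v \<tau> * (\<Prod>p\<in>P. (t - u p) + \<tau> * y p v)))"
proof -
  have "\<forall>K\<in>Pow P. \<exists>c. c \<noteq> 0 \<and> (\<forall>t v. ord2 (\<lambda>\<tau>. \<Phi> t (\<lambda>x. \<tau> * v x) (D K) -
      c * (G v \<tau> * (\<Prod>p\<in>K. t + \<tau> * y p v))))"
    using D by blast
  from bchoice[OF this] obtain c where c: "\<forall>K\<in>Pow P. c K \<noteq> 0 \<and> (\<forall>t v. ord2 (\<lambda>\<tau>. \<Phi> t (\<lambda>x. \<tau> * v x) (D K) -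
      c K * (G v \<tau> * (\<Prod>p\<in>K. t + \<tau> * y p v))))" by (elim exE) (rule that)
  \<comment> \<open>The coefficient of \<open>K\<close> in the expansion, divided by the constant of
    its Pfaffian.\<close>
  define w where "w K = (\<Prod>p\<in>P - K. - u p) / c K" for K
  define L where "L x = (\<Sum>K\<in>Pow P. w K * x (D K))" for x
  have "homogeneous_poly 1 L"
    unfolding L_def by (intro homogeneous_poly_sum homogeneous_poly_cmult homogeneous_poly.coord)
  moreover have "ord2 (\<lambda>\<tau>. L (\<Phi> t (\<lambda>x. \<tau> * v x)) - G v \<tau> * (\<Prod>p\<in>P. (t - u p) + \<tau> * y p v))" for t v
  proof -
    have "G v \<tau> * (\<Prod>p\<in>P. (t - u p) + \<tau> * y p v) =
        (\<Sum>K\<in>Pow P. w K * (c K * (G v \<tau> * (\<Prod>p\<in>K. t + \<tau> * y p v))))" for \<tau>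
    proof -
      have "(\<Prod>p\<in>P. (t - u p) + \<tau> * y p v) = (\<Prod>p\<in>P. (t + \<tau> * y p v) + - u p)"
        by (intro prod.cong) auto
      also have "\<dots> = (\<Sum>K\<in>Pow P. (\<Prod>p\<in>K. t + \<tau> * y p v) * (\<Prod>p\<in>P - K. - u p))"
        by (rule prod_add[OF P])
      finally show ?thesis
        using c by (auto simp: w_def sum_distrib_left intro!: sum.cong)
    qed
    then have "L (\<Phi> t (\<lambda>x. \<tau> * v x)) - G v \<tau> * (\<Prod>p\<in>P. (t - u p) + \<tau> * y p v) =
      (\<Sum>K\<in>Pow P. w K * (\<Phi> t (\<lambda>x. \<tau> * v x) (D K) - c K * (G v \<tau> * (\<Prod>p\<in>K. t + \<tau> * y p v))))" for \<tau>
      by (simp only: L_def right_diff_distrib sum_subtractf)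
    moreover have "ord2 (\<lambda>\<tau>. \<Sum>K\<in>Pow P. w K * (\<Phi> t (\<lambda>x. \<tau> * v x) (D K) -
        c K * (G v \<tau> * (\<Prod>p\<in>K. t + \<tau> * y p v))))"
      using c by (intro ord2_sum ord2_cmult) blast
    ultimately show ?thesis by (simp only:)
  qed
  ultimately show ?thesis by (intro exI[of _ L] conjI allI)
qed

section \<open>The closure of the chart in the half-spin representation\<close>

lemma subspace_half_spin: "fn.subspace (half_spin n)"
  by (rule fn.subspaceI) (auto simp: half_spin_def)

lemma spinor_vec_line: "fn.span {spinor_vec n B} \<in> proj_space (half_spin n)"
proof (rule proj_spaceI[OF _ _ subspace_half_spin])
  show "spinor_vec n B \<noteq> 0"
    using spinor_vec_empty[of n B] by (metis zero_fun_apply zero_neq_one)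
  show "spinor_vec n B \<in> half_spin n" unfolding half_spin_def spinor_vec_def by simp
qed

text \<open>The term with factor 0 brings the matrix into the shape of
  \<open>spinor_chart n 0\<close>, which thus parametrises all skew-symmetric matrices.\<close>

lemma skew_matrix_entries:
  assumes "B \<in> skew_matrices n"
  shows "B = mat n n (\<lambda>(i, j). 0 * std_skew i j + skew_entries n (\<lambda>(i, j). B $$ (i, j)) i j)"
proof (rule eq_matI)
  have B: "B \<in> carrier_mat n n" "transpose_mat B = - B" using assms by (auto simp: skew_matrices_def)
  have skew: "B $$ (j, i) = - B $$ (i, j)" if "i < n" "j < n" for i j
    using arg_cong[OF B(2), of "\<lambda>A. A $$ (i, j)"] B(1) that by auto
  fix i j assume "i < dim_row (mat n n (\<lambda>(i, j). 0 * std_skew i j + skew_entries n (\<lambda>(i, j). B $$ (i, j)) i j))"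
    "j < dim_col (mat n n (\<lambda>(i, j). 0 * std_skew i j + skew_entries n (\<lambda>(i, j). B $$ (i, j)) i j))"
  then have ij: "i < n" "j < n" by auto
  have "B $$ (i, j) = skew_entries n (\<lambda>(i, j). B $$ (i, j)) i j"
  proof (cases i j rule: linorder_cases)
    case equal
    then show ?thesis using skew[of i i] ij by (simp add: skew_entries_def skew_params_def)
  next
    case less
    then show ?thesis using ij by (simp add: skew_entries_def skew_params_def)
  next
    case greater
    then show ?thesis using ij skew[of j i] by (simp add: skew_entries_def skew_params_def)
  qed
  then show "B $$ (i, j) = mat n n (\<lambda>(i, j). 0 * std_skew i j + skew_entries n (\<lambda>(i, j). B $$ (i, j)) i j) $$ (i, j)"
    using ij by simp
qed (use assms in \<open>auto simp: skew_matrices_def\<close>)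

lemma mat_in_skew_matrices:
  assumes "\<And>i j. F j i = - F i j" shows "mat n n (\<lambda>(i, j). F i j) \<in> skew_matrices n"
  unfolding skew_matrices_def by (auto intro!: eq_matI simp: assms[symmetric])

lemma spinor_chart_skew:
  "mat n n (\<lambda>(i, j). t * std_skew i j + skew_entries n a i j) \<in> skew_matrices n"
proof (rule mat_in_skew_matrices)
  show "t * std_skew j i + skew_entries n a j i = - (t * std_skew i j + skew_entries n a i j)" for i j
    unfolding std_skew_skew[of j i] skew_entries_skew[of n a j i] by simp
qed

lemma spinor_embedding_not_h_defective:
  assumes h: "h \<ge> 1" "h \<le> (n + 2) div 4"
  shows "\<not> h_defective (half_spin n) h
    (zariski (half_spin n) closure_of {pfaffian_point n B | B. B \<in> skew_matrices n})"
proof -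
  let ?E = "half_spin n"
  let ?P = "{pfaffian_point n B | B. B \<in> skew_matrices n}"
  let ?X = "zariski ?E closure_of ?P"
  have point: "pfaffian_point n B = fn.span {spinor_vec n B}" for B
    by (simp add: pfaffian_point_def spinor_vec_def)
  have PE: "?P \<subseteq> proj_space ?E" using spinor_vec_line by (auto simp: point)
  have PX: "?P \<subseteq> ?X" using PE by (intro closure_of_subset) (simp only: topspace_zariski)
  have XE: "?X \<subseteq> proj_space ?E" using closure_of_subset_topspace[of "zariski ?E" ?P] by (simp only: topspace_zariski)
  have mem: "fn.span {spinor_chart n t a} \<in> ?X" for t a
  proof -
    have "fn.span {spinor_chart n t a} \<in> ?P"
      using spinor_chart_skew[of n t a] unfolding spinor_chart_def point[symmetric] by blast
    then show ?thesis using PX by blast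
  qed
  have "variety_dim ?E ?X \<le> enat (card (skew_params n))"
  proof (rule variety_dim_le[OF finite_skew_params XE])
    fix L assume L: "L \<in> ?X"
    \<comment> \<open>One chart serves for all points: a form that vanishes on the chart vanishes on
      its closure, so the whole variety can be taken as the neighbourhood.\<close>
    have "openin (subtopology (zariski ?E) ?X) ?X"
      using XE by (subst openin_subtopology_refl) (simp only: topspace_zariski)
    moreover have "vanishes_on g ?X" if g: "homogeneous_poly d g" "\<forall>a. g (spinor_chart n 0 a) = 0" for d g
    proof (rule vanishes_on_closure[OF g(1) _ PE])
      show "vanishes_on g ?P"
        unfolding vanishes_on_def
      proof (intro ballI)
        fix L x assume "L \<in> ?P" "x \<in> L"
        then obtain B where B: "B \<in> skew_matrices n" "x \<in> fn.span {spinor_vec n B}" by (auto simp: point)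
        have "spinor_vec n B = spinor_chart n 0 (\<lambda>(i, j). B $$ (i, j))"
          unfolding spinor_chart_def using skew_matrix_entries[OF B(1)] by (rule arg_cong)
        then have "g (spinor_vec n B) = 0" using g(2) by simp
        from homogeneous_poly_span_zero[OF g(1) this B(2)] show "g x = 0" .
      qed
    qed
    ultimately show "\<exists>U D (\<psi> :: (nat \<times> nat \<Rightarrow> complex) \<Rightarrow> nat set \<Rightarrow> complex).
      openin (subtopology (zariski ?E) ?X) U \<and> L \<in> U \<and> (\<forall>i. polyfun (skew_params n) D (\<lambda>a. \<psi> a i)) \<and>
      (\<forall>d g. homogeneous_poly d g \<longrightarrow> (\<forall>a. g (\<psi> a) = 0) \<longrightarrow> vanishes_on g U)"
      using L by (intro exI[of _ ?X] exI[of _ n] exI[of _ "spinor_chart n 0"] conjI allI impI polyfun_spinor_chart)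
  qed
  moreover have "enat (card (skew_params n) * h + h - 1) \<le> variety_dim ?E (secant_variety ?E h ?X)"
  proof (rule variety_dim_secant_ge_slots[where \<Phi> = "spinor_chart n" and S = "{..<n div 2}" and
        y = "\<lambda>p v. v (2 * p, 2 * p + 1)", OF finite_skew_params subspace_half_spin XE h(1) _ _ polyfun_spinor_chart mem])
    show "finite {..<n div 2}" "2 * h - 1 \<le> card {..<n div 2}" using h(2) by auto
  next
    fix P and u :: "nat \<Rightarrow> complex" assume P: "P \<subseteq> {..<n div 2}"
    have "\<exists>L. homogeneous_poly 1 L \<and> (\<forall>t v. ord2 (\<lambda>\<tau>. L (spinor_chart n t (\<lambda>x. \<tau> * v x)) -
      1 * (\<Prod>p\<in>P. (t - u p) + \<tau> * v (2 * p, 2 * p + 1))))"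
    proof (rule ex_linear_form_product[where D = pairs and G = "\<lambda>_ _. 1" and y = "\<lambda>p v. v (2 * p, 2 * p + 1)"])
      show "finite P" using P finite_subset by blast
      fix K assume "K \<subseteq> P"
      then have "K \<subseteq> {..<n div 2}" using P by blast
      from spinor_chart_pairs[OF this]
      show "\<exists>c\<noteq>0. \<forall>t v. ord2 (\<lambda>\<tau>. spinor_chart n t (\<lambda>x. \<tau> * v x) (pairs K) -
        c * (1 * (\<Prod>p\<in>K. t + \<tau> * v (2 * p, 2 * p + 1))))" by (simp only: mult_1)
    qed
    then show "\<exists>L. homogeneous_poly 1 L \<and> (\<forall>t v. ord2 (\<lambda>\<tau>. L (spinor_chart n t (\<lambda>x. \<tau> * v x)) -
      (\<Prod>p\<in>P. (t - u p) + \<tau> * v (2 * p, 2 * p + 1))))" by (simp only: mult_1)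
  next
    fix i assume "i \<in> skew_params n"
    then obtain a c where i: "i = (a, c)" "a < c" "c < n" by (auto simp: skew_params_def)
    show "(\<exists>p\<in>{..<n div 2}. \<forall>v. v (2 * p, 2 * p + 1) = v i) \<or>
      (\<exists>p q. \<forall>P u. P \<subseteq> {..<n div 2} - {p, q} \<longrightarrow> (\<exists>L. homogeneous_poly 1 L \<and>
        (\<forall>t v. ord2 (\<lambda>\<tau>. L (spinor_chart n t (\<lambda>x. \<tau> * v x)) -
          \<tau> * v i * (\<Prod>p\<in>P. (t - u p) + \<tau> * v (2 * p, 2 * p + 1))))))"
    proof (cases "c = mate a")
      case True
      then have "even a" "c = a + 1" using i(2) by (auto simp: mate_def split: if_splits)
      then have "2 * (a div 2) = a" "c = a + 1" by auto
      then have "\<forall>v. v (2 * (a div 2), 2 * (a div 2) + 1) = v i" using i(1) by simp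
      moreover have "a div 2 \<in> {..<n div 2}" using \<open>even a\<close> \<open>c = a + 1\<close> i(3) by (auto elim!: evenE)
      ultimately show ?thesis by blast
    next
      case False
      have "\<exists>L. homogeneous_poly 1 L \<and> (\<forall>t v. ord2 (\<lambda>\<tau>. L (spinor_chart n t (\<lambda>x. \<tau> * v x)) -
          \<tau> * v i * (\<Prod>p\<in>P. (t - u p) + \<tau> * v (2 * p, 2 * p + 1))))"
        if P: "P \<subseteq> {..<n div 2} - {a div 2, c div 2}" for P and u :: "nat \<Rightarrow> complex"
      proof (rule ex_linear_form_product[where D = "\<lambda>K. pairs K \<union> {a, c}" and G = "\<lambda>v \<tau>. \<tau> * v i" and
            y = "\<lambda>p v. v (2 * p, 2 * p + 1)"])
        show "finite P" using P finite_subset by blast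
        fix K assume "K \<subseteq> P"
        then have "K \<subseteq> {..<n div 2} - {a div 2, c div 2}" using P by blast
        from spinor_chart_pairs_insert[OF this i(2,3) False]
        show "\<exists>k\<noteq>0. \<forall>t v. ord2 (\<lambda>\<tau>. spinor_chart n t (\<lambda>x. \<tau> * v x) (pairs K \<union> {a, c}) -
          k * (\<tau> * v i * (\<Prod>p\<in>K. t + \<tau> * v (2 * p, 2 * p + 1))))" unfolding i(1) .
      qed
      then show ?thesis by (intro disjI2 exI[of _ "a div 2"] exI[of _ "c div 2"] allI impI)
    qed
  qed
  ultimately show ?thesis by (rule not_h_defectiveI)
qed

section \<open>Lagrangian Grassmannians and spinor varieties\<close>

text \<open>The span of no points has dimension 0, the truncated difference \<open>0 - 1\<close> is
  0, and no dimension is smaller. This settles the case without isotropic subspaces, so that their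
  existence is not an issue.\<close>

lemma not_h_defective_empty: "\<not> h_defective (linear_span {}) h ({} :: ('i \<Rightarrow> complex) set set)"
proof -
  have "fn.dim (linear_span ({} :: ('i \<Rightarrow> complex) set set)) = 0"
    using fn.dim_span_eq_card_independent[OF fn.independent_empty] by (simp add: linear_span_def)
  then have "enat (fn.dim (linear_span ({} :: ('i \<Rightarrow> complex) set set)) - 1) = 0"
    by (simp add: zero_enat_def)
  moreover have "\<not> x < min y (0 :: enat)" for x y by simp
  ultimately show ?thesis unfolding h_defective_def by (simp only: not_False_eq_True)
qed

lemma (in polar_space) not_h_defective_lagrangian:
  assumes h: "h \<ge> 1" "h \<le> (n + 1) div 2" and \<sigma>1: "\<sigma> = - 1"
  shows "\<not> h_defective (linear_span (lagrangian_grassmannian s b n)) h (lagrangian_grassmannian s b n)"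
proof (cases "lagrangian_grassmannian s b n = {}")
  case True
  then show ?thesis using not_h_defective_empty by simp
next
  case False
  have LG: "L \<in> lagrangian_grassmannian s b n \<longleftrightarrow>
      (\<exists>W. subspace W \<and> dim W = n \<and> isotropic W \<and> L = exterior_power s n W)" for L
    by (auto simp: lagrangian_grassmannian_def grassmannian_def isotropic_def)
  show ?thesis
  \<comment> \<open>The points of tangency are the multiples of the identity matrix, and each of the
    \<open>n\<close> diagonal entries is a slot.\<close>
  proof (rule plucker_not_h_defective[where \<pi> = "\<lambda>i. i" and \<epsilon> = "\<lambda>_. 1" and r = n, OF h(1)])
    show "\<exists>W. subspace W \<and> dim W = n \<and> isotropic W \<and> L = exterior_power s n W"
      if "L \<in> lagrangian_grassmannian s b n" for L
      using that LG by blast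
  next
    fix e f M assume "frame e f" "chart_condition M"
    from span_chart_vec[OF this]
    show "fn.span {wedge s n (chart_vec e f M)} \<in> lagrangian_grassmannian s b n"
      unfolding LG using exterior_power_span[OF vector_space_axioms, of n "chart_vec e f M"] by metis
  next
    show "i < n \<and> (1 :: complex) = 1" if "(i, i) \<in> params" for i using that by (simp add: params_def)
  qed (use False h \<sigma>1 in auto)
qed

section \<open>Symplectic and quadratic forms as polar spaces\<close>

lemma symplectic_polar_space:
  fixes s :: "complex \<Rightarrow> 'v :: ab_group_add \<Rightarrow> 'v" and Basis :: "'v set"
  assumes V: "finite_dimensional_vector_space s Basis"
    and dim_V: "Vector_Spaces.vector_space.dim s (UNIV :: 'v set) = 2 * n"
    and \<omega>: "symplectic_form s \<omega>"
  shows "polar_space s Basis \<omega> (- 1) n"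
proof -
  interpret finite_dimensional_vector_space s Basis by fact
  have bil: "bilinear_form s \<omega>" and alt: "\<omega> x x = 0" and nd: "nondegenerate \<omega>" for x
    using \<omega> by (auto simp: symplectic_form_def)
  have r: "Vector_Spaces.linear s (*) (\<omega> x)" and l: "Vector_Spaces.linear s (*) (\<lambda>x. \<omega> x y)" for x y
    using bil by (auto simp: bilinear_form_def)
  have sym: "\<omega> y x = - 1 * \<omega> x y" for x y
  proof -
    have "\<omega> (x + y) (x + y) = \<omega> x x + \<omega> x y + (\<omega> y x + \<omega> y y)"
      by (simp only: functional_add[OF r] functional_add[OF l] add_ac)
    then show ?thesis by (simp add: alt eq_neg_iff_add_eq_0 add.commute)
  qed
  show ?thesis by (intro polar_space.intro polar_space_axioms.intro V dim_V bil nd sym) simp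
qed

lemma quadratic_polar_space:
  fixes s :: "complex \<Rightarrow> 'v :: ab_group_add \<Rightarrow> 'v" and Basis :: "'v set"
  assumes V: "finite_dimensional_vector_space s Basis"
    and dim_V: "Vector_Spaces.vector_space.dim s (UNIV :: 'v set) = 2 * n"
    and Q: "nondegenerate_quadratic_form s Q"
  shows "polar_space s Basis (polar_form Q) 1 n"
proof -
  have sym: "polar_form Q y x = 1 * polar_form Q x y" for x y
    by (simp add: polar_form_def add.commute[of y x])
  have "bilinear_form s (polar_form Q)" "nondegenerate (polar_form Q)"
    using Q by (auto simp: nondegenerate_quadratic_form_def)
  then show ?thesis by (intro polar_space.intro polar_space_axioms.intro V dim_V sym) simp_all
qed

text \<open>The scaling law recovers \<open>Q\<close> from its polar form, by
  \<open>polar_form Q x x = 2 * Q x\<close>, so that both notions of isotropic subspace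
  agree.\<close>

locale quadratic_space = polar_space s Basis "polar_form Q" 1 n
  for s :: "complex \<Rightarrow> 'v :: ab_group_add \<Rightarrow> 'v" and Basis :: "'v set" and Q :: "'v \<Rightarrow> complex" and n :: nat +
  assumes Q_scale: "Q (s c x) = c\<^sup>2 * Q x"
begin

lemma polar_form_self: "polar_form Q x x = 2 * Q x"
proof -
  have "x + x = s 2 x" using scale_left_distrib[of 1 1 x] by simp
  then show ?thesis by (simp add: polar_form_def Q_scale)
qed

lemma isotropic_iff: "subspace W \<Longrightarrow> isotropic W \<longleftrightarrow> (\<forall>x\<in>W. Q x = 0)"
proof
  assume W: "subspace W" and Q: "\<forall>x\<in>W. Q x = 0"
  show "isotropic W"
    unfolding isotropic_def polar_form_def using Q subspace_add[OF W] by simp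
next
  assume "isotropic W"
  then show "\<forall>x\<in>W. Q x = 0" using polar_form_self by (fastforce simp: isotropic_def)
qed

lemma orthogonal_grassmannian_iff: "L \<in> orthogonal_grassmannian s Q n \<longleftrightarrow>
    (\<exists>W. subspace W \<and> dim W = n \<and> isotropic W \<and> L = exterior_power s n W)"
  by (auto simp: orthogonal_grassmannian_def grassmannian_def isotropic_iff)

lemma spinor_variety_subset: "S \<in> spinor_varieties s Q n \<Longrightarrow> S \<subseteq> orthogonal_grassmannian s Q n"
  using connected_components_of_subset by (fastforce simp: spinor_varieties_def)

text \<open>A line in the chart around a point of a spinor variety is connected.\<close>

lemma chart_in_spinor_variety:
  assumes S: "S \<in> spinor_varieties s Q n" and fr: "frame e f"
    and base: "exterior_power s n (span (e ` {..<n})) \<in> S" and M: "chart_condition M"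
  shows "fn.span {wedge s n (chart_vec e f M)} \<in> S"
proof -
  let ?E = "exterior_power s n UNIV"
  let ?O = "orthogonal_grassmannian s Q n"
  \<comment> \<open>The line of multiples of \<open>M\<close>, with one parameter: it joins the base
    point at 0 to the given point of the chart at 1.\<close>
  define \<psi> where "\<psi> a = wedge s n (chart_vec e f (\<lambda>i j. a () * M i j))" for a :: "unit \<Rightarrow> complex"
  have OE: "?O \<subseteq> proj_space ?E"
  proof (rule isotropic_subset_proj_space)
    show "fn.subspace ?E" unfolding exterior_power_def by (rule fn.subspace_span)
    have "exterior_power s n W \<subseteq> ?E" for W
      unfolding exterior_power_def by (intro fn.span_mono) auto
    then show "\<Union>?O \<subseteq> ?E" unfolding orthogonal_grassmannian_def by blast
  qed (simp add: orthogonal_grassmannian_iff)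
  have nz: "\<psi> a \<noteq> 0" for a unfolding \<psi>_def by (rule wedge_chart_vec_nonzero[OF fr])
  have cond: "chart_condition (\<lambda>i j. c * M i j)" for c
    unfolding chart_condition_def
  proof (intro allI impI)
    fix i j assume "i < n" "j < n"
    then have "M j i = - 1 * M i j" using M unfolding chart_condition_def by blast
    then show "c * M j i = - 1 * (c * M i j)" by simp
  qed
  define C where "C = {fn.span {\<psi> a} | a. \<psi> a \<noteq> 0}"
  have CO: "C \<subseteq> ?O"
  proof
    fix L assume "L \<in> C"
    then obtain c where L: "L = fn.span {wedge s n (chart_vec e f (\<lambda>i j. c * M i j))}"
      by (auto simp: C_def \<psi>_def)
    show "L \<in> ?O"
      unfolding orthogonal_grassmannian_iff L
      using span_chart_vec[OF fr cond] exterior_power_span[OF vector_space_axioms, of n "chart_vec e f (\<lambda>i j. c * M i j)"]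
      by metis
  qed
  have poly: "polyfun {()} n (\<lambda>a. \<psi> a \<phi>)" for \<phi>
  proof -
    have "polyfun {()} 1 (\<lambda>a. a () * M i j)" for i j
      using polyfun_scale[OF polyfun_coord[of "{()}" "()"], of "M i j"] by (simp add: mult.commute)
    then show ?thesis unfolding \<psi>_def by (rule polyfun_wedge_chart_vec)
  qed
  have "irreducible_in (zariski ?E) C"
    unfolding C_def using CO OE by (intro irreducible_in_param[OF poly _ nz]) (auto simp: C_def)
  then have "connectedin (subtopology (zariski ?E) ?O) C"
    by (intro connectedin_irreducible irreducible_in_subtopology CO)
  moreover have "exterior_power s n (span (e ` {..<n})) \<in> C"
  proof -
    have "\<psi> (\<lambda>_. 0) = wedge s n e" by (simp add: \<psi>_def chart_vec_zero)
    then have "exterior_power s n (span (e ` {..<n})) = fn.span {\<psi> (\<lambda>_. 0)}"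
      using exterior_power_span[OF vector_space_axioms, of n e] by simp
    then show ?thesis unfolding C_def using nz by blast
  qed
  then have "\<not> disjnt S C" using base by (auto simp: disjnt_def)
  ultimately have "C \<subseteq> S"
    using connected_components_of_maximal S unfolding spinor_varieties_def by blast
  moreover have "fn.span {wedge s n (chart_vec e f M)} \<in> C"
  proof -
    have "\<psi> (\<lambda>_. 1) = wedge s n (chart_vec e f M)" by (simp add: \<psi>_def)
    then show ?thesis unfolding C_def mem_Collect_eq using nz[of "\<lambda>_. 1"]
      by (intro exI[of _ "\<lambda>_. 1"]) simp
  qed
  ultimately show ?thesis by blast
qed

lemma not_h_defective_spinor_plucker:
  assumes h: "h \<ge> 1" "h \<le> n div 2" and S: "S \<in> spinor_varieties s Q n"
  shows "\<not> h_defective (linear_span S) h S"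
proof -
  let ?r = "2 * (n div 2)"
  show ?thesis
  \<comment> \<open>The signed permutation matrix is \<open>std_skew\<close> on the first
    \<open>2 * (n div 2)\<close> indices. Both rows of a block are slots carrying the same
    parameter, as the sign of the lower entry cancels against skew-symmetry. For odd
    \<open>n\<close> the last index is fixed by the permutation and is no slot.\<close>
  proof (rule plucker_not_h_defective[where \<pi> = "\<lambda>i. if i < ?r then mate i else i" and
        \<epsilon> = "\<lambda>i. if i < ?r \<and> odd i then - 1 else 1" and r = ?r, OF h(1)])
    show "\<exists>W. subspace W \<and> dim W = n \<and> isotropic W \<and> L = exterior_power s n W" if "L \<in> S" for L
      using that spinor_variety_subset[OF S] orthogonal_grassmannian_iff by blast
    show "fn.span {wedge s n (chart_vec e f M)} \<in> S"
      if "frame e f" "exterior_power s n (span (e ` {..<n})) \<in> S" "chart_condition M" for e f M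
      using S that by (rule chart_in_spinor_variety)
    show "S \<noteq> {}" using S nonempty_connected_components_of by (auto simp: spinor_varieties_def)
    show "?r \<le> n" "2 * h - 1 \<le> ?r" using h by auto
  next
    have mate_less: "mate i < ?r" if "i < ?r" for i
      using that mate_div2[of i] by (metis div_less_iff_less_mult mult.commute zero_less_numeral)
    have mate_odd: "odd (mate i) \<longleftrightarrow> even i" for i by (auto simp: mate_def)
    fix i
    show "(if i < ?r then mate i else i) < n" if "i < n"
      using that mate_less[of i] by auto
    show "(if (if i < ?r then mate i else i) < ?r then mate (if i < ?r then mate i else i)
        else (if i < ?r then mate i else i)) = i"
      using mate_less[of i] by (simp add: mate_mate)
    show "(if i < ?r then mate i else i) < ?r" if "i < ?r" using that mate_less[of i] by simp
    show "(if i < ?r \<and> odd i then - 1 else 1) * (if i < ?r \<and> odd i then - 1 else 1) = (1 :: complex)" by simp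
    show "(if (if i < ?r then mate i else i) < ?r \<and> odd (if i < ?r then mate i else i) then - 1 else 1) =
        - 1 * (if i < ?r \<and> odd i then - 1 else (1 :: complex))" if "i < ?r"
      using that mate_less[of i] mate_odd[of i] by simp
    assume "(i, if i < ?r then mate i else i) \<in> params"
    then have "i < (if i < ?r then mate i else i)" by (simp add: params_def)
    then show "i < ?r \<and> (if i < ?r \<and> odd i then - 1 else 1) = (1 :: complex)"
      by (auto simp: mate_def split: if_splits)
  qed
qed

text \<open>The chart is connected to its centre, so all of it lies in the one component
  \<open>S\<close>, and membership in \<open>S\<close> imposes no restriction on
  \<open>B\<close>.\<close>

lemma spinor_embedding_image_eq:
  assumes S: "S \<in> spinor_varieties s Q n" and fr: "hyperbolic_basis Q n e f"
    and base: "exterior_power s n (span (e ` {..<n})) \<in> S"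
  shows "spinor_embedding_image s n e f S =
    zariski (half_spin n) closure_of {pfaffian_point n B | B. B \<in> skew_matrices n}"
proof -
  have frame: "frame e f" using fr by (simp add: frame_def hyperbolic_basis_def)
  have "exterior_power s n (chart_subspace s n e f B) \<in> S" if B: "B \<in> skew_matrices n" for B
  proof -
    have car: "B \<in> carrier_mat n n" and tr: "transpose_mat B = - B" using B by (auto simp: skew_matrices_def)
    have "chart_condition (\<lambda>i j. B $$ (i, j))"
      unfolding chart_condition_def
    proof (intro allI impI)
      fix i j assume "i < n" "j < n"
      then show "B $$ (j, i) = - 1 * B $$ (i, j)"
        using arg_cong[OF tr, of "\<lambda>A. A $$ (i, j)"] car by auto
    qed
    from chart_in_spinor_variety[OF S frame base this]
    have "fn.span {wedge s n (chart_vec e f (\<lambda>i j. B $$ (i, j)))} \<in> S" .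
    moreover have "chart_subspace s n e f B = span (chart_vec e f (\<lambda>i j. B $$ (i, j)) ` {..<n})"
      by (simp add: chart_subspace_def chart_vec_def[abs_def])
    ultimately show ?thesis using exterior_power_span[OF vector_space_axioms] by metis
  qed
  then have "{pfaffian_point n B | B. B \<in> skew_matrices n \<and> exterior_power s n (chart_subspace s n e f B) \<in> S} =
      {pfaffian_point n B | B. B \<in> skew_matrices n}" by blast
  then show ?thesis by (simp only: spinor_embedding_image_def)
qed

end

theorem theorem1p2:
  fixes s :: "complex \<Rightarrow> 'v :: ab_group_add \<Rightarrow> 'v"
    and Basis :: "'v set"
    and n h :: nat
  assumes V: "finite_dimensional_vector_space s Basis"
    and dim_V: "Vector_Spaces.vector_space.dim s (UNIV :: 'v set) = 2 * n"
    and h: "h \<ge> 1"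
  shows "(\<forall>\<omega>. symplectic_form s \<omega> \<longrightarrow> h \<le> (n + 1) div 2 \<longrightarrow>
            (let X = lagrangian_grassmannian s \<omega> n in \<not> h_defective (linear_span X) h X))
       \<and> (\<forall>Q. nondegenerate_quadratic_form s Q \<longrightarrow> h \<le> n div 2 \<longrightarrow>
            (\<forall>S \<in> spinor_varieties s Q n. \<not> h_defective (linear_span S) h S))
       \<and> (\<forall>Q. nondegenerate_quadratic_form s Q \<longrightarrow> h \<le> (n + 2) div 4 \<longrightarrow>
            (\<forall>S \<in> spinor_varieties s Q n. \<forall>e f. hyperbolic_basis Q n e f \<longrightarrow>
               exterior_power s n (Modules.module.span s (e ` {..<n})) \<in> S \<longrightarrow>
               \<not> h_defective (half_spin n) h (spinor_embedding_image s n e f S)))"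
proof (intro conjI allI impI ballI)
  fix \<omega> assume "symplectic_form s \<omega>" and h': "h \<le> (n + 1) div 2"
  with V dim_V interpret polar_space s Basis \<omega> "- 1" n by (intro symplectic_polar_space)
  show "let X = lagrangian_grassmannian s \<omega> n in \<not> h_defective (linear_span X) h X"
    using not_h_defective_lagrangian[OF h h'] by simp
next
  fix Q S assume Q: "nondegenerate_quadratic_form s Q" and h': "h \<le> n div 2"
    and S: "S \<in> spinor_varieties s Q n"
  interpret polar_space s Basis "polar_form Q" 1 n by (rule quadratic_polar_space[OF V dim_V Q])
  interpret quadratic_space s Basis Q n
    by unfold_locales (use Q in \<open>auto simp: nondegenerate_quadratic_form_def\<close>)
  show "\<not> h_defective (linear_span S) h S" by (rule not_h_defective_spinor_plucker[OF h h' S])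
next
  fix Q S e f assume Q: "nondegenerate_quadratic_form s Q" and h': "h \<le> (n + 2) div 4"
    and S: "S \<in> spinor_varieties s Q n" and ef: "hyperbolic_basis Q n e f"
    and base: "exterior_power s n (Modules.module.span s (e ` {..<n})) \<in> S"
  interpret polar_space s Basis "polar_form Q" 1 n by (rule quadratic_polar_space[OF V dim_V Q])
  interpret quadratic_space s Basis Q n
    by unfold_locales (use Q in \<open>auto simp: nondegenerate_quadratic_form_def\<close>)
  show "\<not> h_defective (half_spin n) h (spinor_embedding_image s n e f S)"
    unfolding spinor_embedding_image_eq[OF S ef base]
    by (rule spinor_embedding_not_h_defective[OF h h'])
qed

end
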